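(* Let $\mu$ be a strictly non-degenerate finitely supported probability measure on the group $\widetilde F$, and let $\alpha=\sum_{g}\mu(g)\chi_a(g)$ and $\beta=\sum_g\mu(g)\chi_b(g)$. For a.e. sample path $(g_n)$ of the random walk $(\widetilde F,\mu)$ issued from the identity and every $\gamma\in\Gamma$ let $\omega_\gamma=\lim_n\gamma.g_n\in\partial\Gamma$ (this limit exists), and let $\lambda$ be the distribution of $(\omega_\gamma)_{\gamma\in\Gamma}$ on $\operatorname{Fun}(\Gamma,\partial\Gamma)$. Then $\lambda$ is concentrated on $$ \begin{cases} \operatorname{Fun}(\Gamma,\partial_-\Gamma\cup\partial_+\Gamma), & \text{if } \alpha>0 \text{ and } \alpha+\beta<0,\\ \operatorname{Fun}(\Gamma,\partial_-\Gamma), & \text{if } \alpha>0 \text{ and } \alpha+\beta\ge 0,\\ \operatorname{Fun}(\Gamma,\partial_+\Gamma), & \text{if } \alpha\le 0 \text{ and } \alpha+\beta<0,\\ \operatorname{Fun}(\Gamma,\partial\overline\Gamma), & \text{if } \alpha\le 0 \text{ and } \alpha+\beta\ge 0. \end{cases} $$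
   Context: **The group and its Schreier graph.** $\widetilde A,\widetilde B:\mathbb{R}\to\mathbb{R}$ are the piecewise linear homeomorphisms $\widetilde A(\gamma)=\gamma-1$ and $\widetilde B(\gamma)=\gamma$ for $\gamma\le 0$, $\widetilde B(\gamma)=\gamma/2$ for $0\le\gamma\le 2$, $\widetilde B(\gamma)=\gamma-1$ for $\gamma\ge 2$. $\widetilde F$ is the group of homeomorphisms of $\mathbb{R}$ generated by $\widetilde A,\widetilde B$ (isomorphic to Thompson's group $F$), with group operation $(g_1g_2)(\gamma)=g_2(g_1(\gamma))$, so that $\gamma.g=g(\gamma)$ is a right action. It preserves the set $\mathbb{Z}[\frac12]$ of dyadic rationals and is transitive on it. $\Gamma$ is the Schreier graph of this action: the vertex set is $\mathbb{Z}[\frac12]$, and each $\gamma$ is joined by edges to $\gamma.\widetilde A^{\pm1}$ and $\gamma.\widetilde B^{\pm1}$. The abelianization of $\widetilde F$ is $\mathbb{Z}^2$, freely generated by the images of $\widetilde A,\widetilde B$; $\chi_a,\chi_b:\widetilde F\to\mathbb{Z}$ are the homomorphisms with $\chi_a(\widetilde A)=1,\ \chi_a(\widetilde B)=0,\ \chi_b(\widetilde A)=0,\ \chi_b(\widetilde B)=1$. **Ends.** The negative type rays in $\Gamma$ are the connected components of the subgraph with vertex set $(-\infty,0]\cap\mathbb{Z}[\frac12]$, i.e. the rays $s-1,s-2,\dots$ with $s\in(0,1]\cap\mathbb{Z}[\frac12]$; the positive type rays are the connected components of the subgraph with vertex set $[2,\infty)\cap\mathbb{Z}[\frac12]$, i.e.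 the rays $s+1,s+2,\dots$ with $s\in[1,2)\cap\mathbb{Z}[\frac12]$. The skeleton $\overline\Gamma$ is the tree obtained from $\Gamma$ by removing all these rays (its vertex set is $(0,2)\cap\mathbb{Z}[\frac12]$). The space of ends of $\Gamma$ is the disjoint union $\partial\Gamma=\partial\overline\Gamma\cup\partial_-\Gamma\cup\partial_+\Gamma$, where $\partial\overline\Gamma$ is the space of ends of $\overline\Gamma$, and $\partial_-\Gamma$ (resp. $\partial_+\Gamma$) is the set of ends determined by the negative (resp. positive) type rays. Convergence to ends is in the end compactification of $\Gamma$. For a subset $E\subset\partial\Gamma$, $\operatorname{Fun}(\Gamma,E)=E^\Gamma$ is the space of all functions from the vertex set of $\Gamma$ to $E$ (with the product Borel structure). **Random walk.** The random walk $(\widetilde F,\mu)$ issued from the identity is $g_n=h_1h_2\cdots h_n$ with $h_i$ i.i.d. of law $\mu$. $\mu$ is strictly non-degenerate if the semigroup generated by $\operatorname{supp}\mu$ is $\widetilde F$. *)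

theory Defs
  imports "HOL-Probability.Probability" "HOL-Algebra.Elementary_Groups"
begin

section \<open>The group\<close>

definition dyadic :: "real set" where
  "dyadic = {real_of_int k / 2 ^ n | (k::int) (n::nat). True}"

text \<open>The product \<open>f g\<close> is "first \<open>f\<close>, then \<open>g\<close>", so that
  \<open>\<gamma>.g = g \<gamma>\<close> is a right action.\<close>

definition homeo_R :: "(real \<Rightarrow> real) monoid" where
  "homeo_R = \<lparr>carrier = {f. \<exists>g. homeomorphism UNIV UNIV f g},
              mult = (\<lambda>f g. g \<circ> f), one = id\<rparr>"

definition gen_A :: "real \<Rightarrow> real" where
  "gen_A x = x - 1"

definition gen_B :: "real \<Rightarrow> real" where
  "gen_B x = (if x \<le> 0 then x else if x \<le> 2 then x / 2 else x - 1)"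

definition thompson_F :: "(real \<Rightarrow> real) monoid" where
  "thompson_F = subgroup_generated homeo_R {gen_A, gen_B}"

lemma group_homeo_R: "group homeo_R"
proof (rule groupI)
  fix f g h
  assume f: "f \<in> carrier homeo_R"
  then obtain f' where f': "homeomorphism UNIV UNIV f f'"
    by (auto simp: homeo_R_def)
  have "f' \<otimes>\<^bsub>homeo_R\<^esub> f = \<one>\<^bsub>homeo_R\<^esub>"
    using f' by (auto simp: homeo_R_def homeomorphism_def)
  moreover have "f' \<in> carrier homeo_R"
    using f' by (auto simp: homeo_R_def intro: homeomorphism_symD)
  ultimately show "\<exists>g\<in>carrier homeo_R. g \<otimes>\<^bsub>homeo_R\<^esub> f = \<one>\<^bsub>homeo_R\<^esub>"
    by blast
  assume "g \<in> carrier homeo_R"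
  then show "f \<otimes>\<^bsub>homeo_R\<^esub> g \<in> carrier homeo_R"
    using f by (auto simp: homeo_R_def intro: homeomorphism_compose)
qed (auto simp: homeo_R_def intro: homeomorphism_ident exI[of _ id] simp: id_def)

lemma gen_A_homeo: "gen_A \<in> carrier homeo_R"
proof -
  have "homeomorphism UNIV UNIV gen_A (\<lambda>x. x + 1)"
    unfolding homeomorphism_def gen_A_def
    by (auto intro!: continuous_intros simp: image_iff)
  then show ?thesis by (auto simp: homeo_R_def)
qed

lemma gen_B_homeo: "gen_B \<in> carrier homeo_R"
proof -
  define g :: "real \<Rightarrow> real" where "g = (\<lambda>x. max x (min (2 * x) (x + 1)))"
  have g: "g x = (if x \<le> 0 then x else if x \<le> 1 then 2 * x else x + 1)" for x
    by (auto simp: g_def)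
  have B: "gen_B = (\<lambda>x. min x (max (x / 2) (x - 1)))"
    by (auto simp: gen_B_def fun_eq_iff)
  have 1: "g (gen_B x) = x" "gen_B (g x) = x" for x
    by (auto simp: g gen_B_def)
  have "continuous_on UNIV gen_B" "continuous_on UNIV g"
    unfolding B g_def by (auto intro!: continuous_intros)
  moreover have "range gen_B = UNIV" "range g = UNIV"
    using 1 by (metis surj_def)+
  ultimately have "homeomorphism UNIV UNIV gen_B g"
    using 1 by (simp add: homeomorphism_def)
  then show ?thesis by (auto simp: homeo_R_def)
qed

lemma group_thompson_F: "group thompson_F"
  unfolding thompson_F_def by (simp add: group.group_subgroup_generated group_homeo_R)

lemma carrier_thompson_F: "carrier thompson_F = generate homeo_R {gen_A, gen_B}"
  by (simp add: thompson_F_def carrier_subgroup_generated gen_A_homeo gen_B_homeo)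

lemma mult_thompson_F: "f \<otimes>\<^bsub>thompson_F\<^esub> g = g \<circ> f"
  by (simp add: thompson_F_def homeo_R_def)

text \<open>The homomorphisms \<open>\<chi>\<^sub>a\<close> and \<open>\<chi>\<^sub>b\<close> exist: they can be read off
  from the translation lengths near \<open>-\<infinity>\<close> and \<open>+\<infinity>\<close>.\<close>

lemma germ_hom_exists:
  fixes \<Phi> :: "real filter" and a b :: int
  assumes ne: "\<Phi> \<noteq> bot" and shift: "\<And>c. filterlim (\<lambda>x. x - c) \<Phi> \<Phi>"
    and A: "\<forall>\<^sub>F x in \<Phi>. gen_A x = x - real_of_int a"
    and B: "\<forall>\<^sub>F x in \<Phi>. gen_B x = x - real_of_int b"
  shows "\<exists>\<phi>\<in>hom thompson_F integer_group. \<phi> gen_A = a \<and> \<phi> gen_B = b"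
proof -
  define P where "P g c \<longleftrightarrow> (\<forall>\<^sub>F x in \<Phi>. g x = x - real_of_int c)" for g c
  have uniq: "c = d" if "P g c" "P g d" for g c d
  proof -
    have "\<forall>\<^sub>F x in \<Phi>. c = d"
      using that unfolding P_def by eventually_elim simp
    then show ?thesis using ne by (simp add: eventually_const_iff)
  qed
  have comp: "P (g \<circ> f) (c + d)" if "P f c" "P g d" for f g c d
  proof -
    have "\<forall>\<^sub>F x in \<Phi>. g (x - real_of_int c) = x - real_of_int c - real_of_int d"
      using that(2) shift unfolding P_def by (rule eventually_compose_filterlim)
    with that(1) show ?thesis
      unfolding P_def by eventually_elim simp
  qed
  have m_inv: "P (inv\<^bsub>homeo_R\<^esub> g) (- c)" if "P g c" "g \<in> carrier homeo_R" for g c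
  proof -
    have shifted: "\<forall>\<^sub>F x in \<Phi>. g (x - real_of_int (- c)) = x - real_of_int (- c) - real_of_int c"
      using that(1) shift unfolding P_def by (rule eventually_compose_filterlim)
    have "(inv\<^bsub>homeo_R\<^esub> g) (g x) = x" for x
      using group.r_inv[OF group_homeo_R that(2)]
      by (simp add: homeo_R_def fun_eq_iff)
    then have "(inv\<^bsub>homeo_R\<^esub> g) x = x + real_of_int c"
      if "g (x - real_of_int (- c)) = x - real_of_int (- c) - real_of_int c" for x
      using that by (metis add_diff_cancel_right' diff_minus_eq_add of_int_minus)
    with shifted show ?thesis
      unfolding P_def by (auto elim!: eventually_mono)
  qed
  have ex: "\<exists>c. P g c" if "g \<in> carrier thompson_F" for g
    using that unfolding carrier_thompson_F
  proof (induction rule: generate.induct)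
    case one
    show ?case by (intro exI[of _ 0]) (simp add: P_def homeo_R_def)
  next
    case (incl g)
    then show ?case using A B by (auto simp: P_def)
  next
    case (inv g)
    moreover have "P gen_A a" "P gen_B b" using A B by (auto simp: P_def)
    ultimately show ?case
      using m_inv[of gen_A a] m_inv[of gen_B b] gen_A_homeo gen_B_homeo by blast
  next
    case (eng g h)
    then obtain c d where "P g c" "P h d" by blast
    then have "P (h \<circ> g) (c + d)" by (rule comp)
    then show ?case by (auto simp: homeo_R_def comp_def)
  qed
  define \<phi> where "\<phi> g = (THE c. P g c)" for g
  have \<phi>: "\<phi> g = c" if "P g c" for g c
    using that uniq unfolding \<phi>_def by blast
  have "\<phi> \<in> hom thompson_F integer_group"
  proof (rule homI)
    fix f g assume "f \<in> carrier thompson_F" "g \<in> carrier thompson_F"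
    then obtain c d where cd: "P f c" "P g d" using ex by blast
    then show "\<phi> (f \<otimes>\<^bsub>thompson_F\<^esub> g) = \<phi> f \<otimes>\<^bsub>integer_group\<^esub> \<phi> g"
      using \<phi>[OF comp[OF cd]] \<phi>[OF cd(1)] \<phi>[OF cd(2)] by (simp add: mult_thompson_F)
  qed auto
  moreover have "\<phi> gen_A = a" "\<phi> gen_B = b"
    using A B by (auto intro!: \<phi> simp: P_def)
  ultimately show ?thesis by blast
qed

lemma characters_exist:
  "\<exists>\<chi>a\<in>hom thompson_F integer_group. \<chi>a gen_A = 1 \<and> \<chi>a gen_B = 0"
  "\<exists>\<chi>b\<in>hom thompson_F integer_group. \<chi>b gen_A = 0 \<and> \<chi>b gen_B = 1"
proof -
  have bot: "filterlim (\<lambda>x. x - c) at_bot at_bot" for c :: real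
    unfolding filterlim_at_bot
    by (auto simp: diff_le_eq)
  have top: "filterlim (\<lambda>x. x - c) at_top at_top" for c :: real
    unfolding filterlim_at_top
    by (auto simp: le_diff_eq)
  have "\<exists>\<phi>\<in>hom thompson_F integer_group. \<phi> gen_A = 1 \<and> \<phi> gen_B = 0"
    by (rule germ_hom_exists[of at_bot])
       (auto simp: bot gen_A_def gen_B_def intro: eventually_mono[OF eventually_le_at_bot[of 0]])
  then obtain f where f: "f \<in> hom thompson_F integer_group" "f gen_A = 1" "f gen_B = 0"
    by blast
  have "\<exists>\<phi>\<in>hom thompson_F integer_group. \<phi> gen_A = 1 \<and> \<phi> gen_B = 1"
    by (rule germ_hom_exists[of at_top])
       (auto simp: top gen_A_def gen_B_def intro: eventually_mono[OF eventually_ge_at_top[of 2]])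
  then obtain g where g: "g \<in> hom thompson_F integer_group" "g gen_A = 1" "g gen_B = 1"
    by blast
  have "(\<lambda>x. g x - f x) \<in> hom thompson_F integer_group"
    using f(1) g(1) by (simp add: hom_def)
  with f g show "\<exists>\<chi>a\<in>hom thompson_F integer_group. \<chi>a gen_A = 1 \<and> \<chi>a gen_B = 0"
    "\<exists>\<chi>b\<in>hom thompson_F integer_group. \<chi>b gen_A = 0 \<and> \<chi>b gen_B = 1"
    by (auto intro: bexI[of _ f] bexI[of _ "\<lambda>x. g x - f x"])
qed

definition semigroup_span :: "('g, 'm) monoid_scheme \<Rightarrow> 'g set \<Rightarrow> 'g set" where
  "semigroup_span G S =
     \<Inter>{H. S \<subseteq> H \<and> (\<forall>x\<in>H. \<forall>y\<in>H. x \<otimes>\<^bsub>G\<^esub> y \<in> H)}"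

definition strictly_nondegenerate :: "('g, 'm) monoid_scheme \<Rightarrow> 'g pmf \<Rightarrow> bool" where
  "strictly_nondegenerate G \<mu> \<longleftrightarrow> semigroup_span G (set_pmf \<mu>) = carrier G"


section \<open>Ends of graphs\<close>

text \<open>A graph is given by a vertex set \<open>V\<close> and a symmetric adjacency relation \<open>E\<close>;
  loops and edge multiplicities play no role for ends. The relation \<open>E\<close> may be larger
  than \<open>V \<times> V\<close>, in which case it is restricted, so that passing to a smaller \<open>V\<close> means
  passing to the induced subgraph.\<close>

definition graph_components :: "'v rel \<Rightarrow> 'v set \<Rightarrow> 'v set set" where
  "graph_components E V = V // {(u, v) \<in> V \<times> V. (u, v) \<in> (E \<inter> V \<times> V)\<^sup>*}"

definition rays :: "'v rel \<Rightarrow> 'v set \<Rightarrow> (nat \<Rightarrow> 'v) set" where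
  "rays E V = {r. inj r \<and> (\<forall>n. r n \<in> V \<and> (r n, r (Suc n)) \<in> E)}"

text \<open>Two rays are equivalent if no finite set of vertices separates their tails.\<close>

definition ray_equiv :: "'v rel \<Rightarrow> 'v set \<Rightarrow> (nat \<Rightarrow> 'v) rel" where
  "ray_equiv E V = {(r, r'). r \<in> rays E V \<and> r' \<in> rays E V \<and>
     (\<forall>K. finite K \<longrightarrow> (\<exists>C\<in>graph_components E (V - K).
        (\<forall>\<^sub>F n in sequentially. r n \<in> C) \<and> (\<forall>\<^sub>F n in sequentially. r' n \<in> C)))}"

type_synonym 'v graph_end = "(nat \<Rightarrow> 'v) set"

definition ends :: "'v rel \<Rightarrow> 'v set \<Rightarrow> 'v graph_end set" where
  "ends E V = rays E V // ray_equiv E V"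

definition ends_in :: "'v rel \<Rightarrow> 'v set \<Rightarrow> 'v set \<Rightarrow> 'v graph_end set" where
  "ends_in E V C = {e \<in> ends E V. \<forall>r\<in>e. \<forall>\<^sub>F n in sequentially. r n \<in> C}"

text \<open>The end compactification of a connected locally finite graph: vertices are isolated
  points, and the complementary components of finite sets, together with the ends they
  contain, are basic neighbourhoods of these ends.\<close>

definition end_compactification :: "'v rel \<Rightarrow> 'v set \<Rightarrow> ('v + 'v graph_end) topology" where
  "end_compactification E V = topology_generated_by
     ({{Inl v} | v. v \<in> V} \<union>
      {Inl ` C \<union> Inr ` ends_in E V C | C K. finite K \<and> C \<in> graph_components E (V - K)})"

definition end_space :: "'v rel \<Rightarrow> 'v set \<Rightarrow> 'v graph_end topology" where
  "end_space E V = pullback_topology (ends E V) Inr (end_compactification E V)"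

definition tends_to_end ::
    "'v rel \<Rightarrow> 'v set \<Rightarrow> (nat \<Rightarrow> 'v) \<Rightarrow> 'v graph_end \<Rightarrow> bool" where
  "tends_to_end E V x e \<longleftrightarrow>
     limitin (end_compactification E V) (\<lambda>n. Inl (x n)) (Inr e) sequentially"

text \<open>A sequence that does not tend to any end is sent to a fixed but arbitrary end.\<close>

definition limit_end :: "'v rel \<Rightarrow> 'v set \<Rightarrow> (nat \<Rightarrow> 'v) \<Rightarrow> 'v graph_end" where
  "limit_end E V x =
     (if \<exists>e. tends_to_end E V x e then THE e. tends_to_end E V x e
      else SOME e. e \<in> ends E V)"

definition borel_of :: "'a topology \<Rightarrow> 'a measure" where
  "borel_of T = sigma (topspace T) {U. openin T U}"


section \<open>The Schreier graph and its ends\<close>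

definition schreier_edges :: "real rel" where
  "schreier_edges = {(\<gamma>, s \<gamma>) | \<gamma> s. \<gamma> \<in> dyadic \<and>
     s \<in> {gen_A, inv\<^bsub>thompson_F\<^esub> gen_A, gen_B, inv\<^bsub>thompson_F\<^esub> gen_B}}"

abbreviation Gamma_ends :: "real graph_end set" where
  "Gamma_ends \<equiv> ends schreier_edges dyadic"

abbreviation tends_to_Gamma_end :: "(nat \<Rightarrow> real) \<Rightarrow> real graph_end \<Rightarrow> bool" where
  "tends_to_Gamma_end \<equiv> tends_to_end schreier_edges dyadic"

abbreviation Gamma_end_borel :: "real graph_end measure" where
  "Gamma_end_borel \<equiv> borel_of (end_space schreier_edges dyadic)"

definition negative_ends :: "real graph_end set" where
  "negative_ends = {e \<in> Gamma_ends. \<exists>s\<in>dyadic \<inter> {0<..1}. (\<lambda>n. s - 1 - real n) \<in> e}"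

definition positive_ends :: "real graph_end set" where
  "positive_ends = {e \<in> Gamma_ends. \<exists>s\<in>dyadic \<inter> {1..<2}. (\<lambda>n. s + 1 + real n) \<in> e}"

text \<open>The ends of the skeleton as a subset of the ends of the whole graph: the end of the
  skeleton given by a class \<open>e'\<close> of rays is identified with the end \<open>e \<supseteq> e'\<close> of the
  whole graph which these rays determine.\<close>

definition skeleton_ends :: "real graph_end set" where
  "skeleton_ends =
     {e \<in> Gamma_ends. \<exists>e'\<in>ends schreier_edges (dyadic \<inter> {0<..<2}). e' \<subseteq> e}"


section \<open>Random walk\<close>

text \<open>\<open>h i\<close> is the increment number \<open>i + 1\<close>.\<close>

primrec walk :: "('g, 'm) monoid_scheme \<Rightarrow> (nat \<Rightarrow> 'w \<Rightarrow> 'g) \<Rightarrow> nat \<Rightarrow> 'w \<Rightarrow> 'g" where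
  "walk G h 0 w = \<one>\<^bsub>G\<^esub>"
| "walk G h (Suc n) w = walk G h n w \<otimes>\<^bsub>G\<^esub> h n w"

definition iid_increments ::
    "('g, 'm) monoid_scheme \<Rightarrow> 'g pmf \<Rightarrow> 'w measure \<Rightarrow> (nat \<Rightarrow> 'w \<Rightarrow> 'g) \<Rightarrow> bool" where
  "iid_increments G \<mu> M h \<longleftrightarrow>
     prob_space M \<and>
     prob_space.indep_vars M (\<lambda>_. count_space (carrier G)) h UNIV \<and>
     (\<forall>i. distr M (count_space UNIV) (h i) = measure_pmf \<mu>)"

definition limit_configuration :: "(nat \<Rightarrow> 'w \<Rightarrow> real \<Rightarrow> real) \<Rightarrow> 'w \<Rightarrow> real \<Rightarrow> real graph_end" where
  "limit_configuration h w =
     (\<lambda>\<gamma>\<in>dyadic. limit_end schreier_edges dyadic (\<lambda>n. walk thompson_F h n w \<gamma>))"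

definition boundary_law ::
    "'w measure \<Rightarrow> (nat \<Rightarrow> 'w \<Rightarrow> real \<Rightarrow> real) \<Rightarrow> (real \<Rightarrow> real graph_end) measure" where
  "boundary_law M h =
     distr M (\<Pi>\<^sub>M \<gamma>\<in>dyadic. Gamma_end_borel) (limit_configuration h)"

end

theory Submission
  imports Defs
begin

text \<open>Counting measure on the dyadic rationals is invariant under the walk, so the energy of the truncated
  Green function is bounded by its value at the starting point; since all increments of the support
  generate the group as a semigroup, this controls \<open>f - f \<circ> g\<close> in \<open>\<ell>\<^sup>2\<close> for every group element \<open>g\<close>.
  The Schreier graph contains a binary tree, on which averaging over levels bounds a finitely supported
  function at the root by such differences. Hence the walk on the graph is transient. As
  increments displace all but finitely many points without crossing a given finite set, the walk
  converges to an end.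

  Far out on the negative and positive rays the walk is a random walk on the integers with outward drift
  \<open>\<alpha>\<close> and \<open>- (\<alpha> + \<beta>)\<close>, respectively. If this drift is non-positive, it cannot tend to infinity there. If one
  of them is positive, then the expected number of visits to any bounded interval is finite, because
  from every point the walk enters a ray and stays there forever with probability bounded below; so
  the limit end is the end of a ray.\<close>

section \<open>Ends of graphs\<close>

text \<open>The law \<open>\<mu>\<close> need not be symmetric, but the energy estimate sees only
  the symmetric part of the walk, and that is enough. The energy of the Green function is at most
  linear in its value at the starting point, while point values are controlled by the square root of
  the energy. So this value is bounded by a constant times its own square root, hence bounded
  uniformly in the truncation. An end is a class of rays, whereas the walk jumps. Existence and
  measurability of the limit are therefore both reduced to a criterion that speaks only of
  components of complements of finite sets. The four cases are not treated one by one. For each sign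
  \<epsilon>, a non-positive outward drift excludes the ends of that type; a positive drift for at
  least one sign excludes the ends of the skeleton; the table combines these statements. Zero drift
  needs no recurrence theorem: optional stopping for the coordinate \<epsilon> z makes it unlikely
  to reach a high level before dropping below a threshold, with probability tending to zero as the
  level grows.\<close>

lemma component_equiv:
  assumes "sym E"
  shows "equiv V {(u, v) \<in> V \<times> V. (u, v) \<in> (E \<inter> V \<times> V)\<^sup>*}"
proof (rule equivI)
  have "sym (E \<inter> V \<times> V)" using assms by (auto simp: sym_def)
  then have "sym ((E \<inter> V \<times> V)\<^sup>*)" by (rule sym_rtrancl)
  then show "sym {(u, v) \<in> V \<times> V. (u, v) \<in> (E \<inter> V \<times> V)\<^sup>*}" by (auto simp: sym_def)
  show "trans {(u, v) \<in> V \<times> V. (u, v) \<in> (E \<inter> V \<times> V)\<^sup>*}"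
    by (auto simp: trans_def)
qed (auto simp: refl_on_def)

lemma graph_componentsD:
  assumes "C \<in> graph_components E V"
  obtains v where "v \<in> V" "C = {u \<in> V. (v, u) \<in> (E \<inter> V \<times> V)\<^sup>*}"
  using assms by (auto simp: graph_components_def elim!: quotientE)

lemma graph_component_subset: "C \<in> graph_components E V \<Longrightarrow> C \<subseteq> V"
  by (auto elim!: graph_componentsD)

lemma ex_graph_component:
  assumes "v \<in> V"
  shows "\<exists>C \<in> graph_components E V. v \<in> C"
proof
  show "{u \<in> V. (v, u) \<in> (E \<inter> V \<times> V)\<^sup>*} \<in> graph_components E V"
    using assms unfolding graph_components_def quotient_def by fastforce
qed (use assms in auto)

lemma graph_component_eq:
  assumes "sym E" "C \<in> graph_components E V" "D \<in> graph_components E V" "x \<in> C" "x \<in> D"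
  shows "C = D"
  using quotient_disj[OF component_equiv[OF assms(1)], of C V D] assms
  by (auto simp: graph_components_def)

lemma graph_component_path:
  assumes "C \<in> graph_components E V" "x \<in> C" "(x, y) \<in> (E \<inter> V \<times> V)\<^sup>*"
  shows "y \<in> C"
proof -
  obtain v where v: "v \<in> V" "C = {u \<in> V. (v, u) \<in> (E \<inter> V \<times> V)\<^sup>*}"
    using assms(1) by (rule graph_componentsD)
  have "y \<in> V"
    using assms(3)
  proof cases
    case base
    then show ?thesis using assms(2) v by auto
  qed auto
  then show ?thesis using assms v by auto
qed

lemma graph_component_step:
  assumes "C \<in> graph_components E V" "x \<in> C" "(x, y) \<in> E" "y \<in> V"
  shows "y \<in> C"
proof -
  have "x \<in> V" using graph_component_subset[OF assms(1)] assms(2) by auto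
  then show ?thesis using assms by (intro graph_component_path[OF assms(1,2)]) auto
qed

lemma graph_component_connected:
  assumes "sym E" "C \<in> graph_components E V" "x \<in> C" "y \<in> C"
  shows "(x, y) \<in> (E \<inter> C \<times> C)\<^sup>*"
proof -
  obtain v where v: "v \<in> V" "C = {u \<in> V. (v, u) \<in> (E \<inter> V \<times> V)\<^sup>*}"
    using assms(2) by (rule graph_componentsD)
  have "sym (E \<inter> V \<times> V)" using assms(1) by (auto simp: sym_def)
  then have "sym ((E \<inter> V \<times> V)\<^sup>*)" by (rule sym_rtrancl)
  then have "(x, v) \<in> (E \<inter> V \<times> V)\<^sup>*" using assms(3) v by (auto simp: sym_def)
  then have "(x, y) \<in> (E \<inter> V \<times> V)\<^sup>*" using assms(4) v by auto
  then show ?thesis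
  proof (induction rule: rtrancl_induct)
    case (step y z)
    have "y \<in> C" by (rule graph_component_path[OF assms(2,3) step(1)])
    moreover from this have "z \<in> C"
      by (rule graph_component_step[OF assms(2)]) (use step in auto)
    ultimately have "(y, z) \<in> E \<inter> C \<times> C" using step by auto
    then show ?case by (rule rtrancl_into_rtrancl[OF step.IH])
  qed auto
qed

text \<open>This compares the components left by a larger and a smaller finite set: one common point
  decides.\<close>

lemma graph_component_mono:
  assumes "sym E" "C \<in> graph_components E V" "D \<in> graph_components E W" "V \<subseteq> W"
    "x \<in> C" "x \<in> D"
  shows "C \<subseteq> D"
proof
  fix y assume "y \<in> C"
  then have "(x, y) \<in> (E \<inter> C \<times> C)\<^sup>*" by (rule graph_component_connected[OF assms(1,2,5)])
  moreover have "E \<inter> C \<times> C \<subseteq> E \<inter> W \<times> W"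
    using graph_component_subset[OF assms(2)] assms(4) by auto
  ultimately have "(x, y) \<in> (E \<inter> W \<times> W)\<^sup>*" using rtrancl_mono by blast
  then show "y \<in> D" by (rule graph_component_path[OF assms(3,6)])
qed

section \<open>Rays, their equivalence and their ends\<close>

lemma ray_leaves_finite:
  assumes "r \<in> rays E V" "finite K"
  shows "\<forall>\<^sub>F n in sequentially. r n \<notin> K"
proof -
  have "finite (r -` K)" using assms by (intro finite_vimageI) (auto simp: rays_def)
  then show ?thesis
    by (simp add: cofinite_eq_sequentially[symmetric] eventually_cofinite vimage_def)
qed

lemma path_tail_component:
  assumes "\<And>n. n \<ge> N \<Longrightarrow> x n \<in> V \<and> (x n, x (Suc n)) \<in> E"
  shows "\<exists>C\<in>graph_components E V. \<forall>n\<ge>N. x n \<in> C"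
proof -
  obtain C where C: "C \<in> graph_components E V" "x N \<in> C"
    using ex_graph_component[of "x N" V E] assms by auto
  have "x n \<in> C" if "n \<ge> N" for n
    using that
  proof (induction rule: dec_induct)
    case (step n)
    then show ?case using graph_component_step[OF C(1), of "x n" "x (Suc n)"] assms by auto
  qed (rule C)
  with C show ?thesis by auto
qed

lemma ray_tail_component:
  assumes "r \<in> rays E V" "finite K"
  shows "\<exists>C\<in>graph_components E (V - K). \<forall>\<^sub>F n in sequentially. r n \<in> C"
proof -
  obtain N where "\<And>n. n \<ge> N \<Longrightarrow> r n \<notin> K"
    using ray_leaves_finite[OF assms] by (auto simp: eventually_sequentially)
  then have "\<exists>C\<in>graph_components E (V - K). \<forall>n\<ge>N. r n \<in> C"
    using assms(1) by (intro path_tail_component) (auto simp: rays_def)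
  then show ?thesis by (auto simp: eventually_sequentially)
qed

lemma eventually_component_unique:
  assumes "sym E" "C \<in> graph_components E V" "D \<in> graph_components E V"
    "\<forall>\<^sub>F n in sequentially. x n \<in> C" "\<forall>\<^sub>F n in sequentially. x n \<in> D"
  shows "C = D"
proof -
  have "\<forall>\<^sub>F n in sequentially. x n \<in> C \<and> x n \<in> D" using assms by (simp add: eventually_conj_iff)
  then obtain n where "x n \<in> C" "x n \<in> D" by (auto simp: eventually_sequentially)
  then show ?thesis using graph_component_eq[OF assms(1-3)] by auto
qed

lemma ray_equiv_component:
  assumes "sym E" "(r, r') \<in> ray_equiv E V" "finite K" "C \<in> graph_components E (V - K)"
    "\<forall>\<^sub>F n in sequentially. r n \<in> C"
  shows "\<forall>\<^sub>F n in sequentially. r' n \<in> C"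
proof -
  obtain D where D: "D \<in> graph_components E (V - K)"
    "\<forall>\<^sub>F n in sequentially. r n \<in> D" "\<forall>\<^sub>F n in sequentially. r' n \<in> D"
    using assms(2,3) by (auto simp: ray_equiv_def)
  then show ?thesis using eventually_component_unique[OF assms(1,4) D(1) assms(5)] by auto
qed

text \<open>Transitivity rests on uniqueness: the tail of the middle ray lies in exactly one
  component, so both witnesses for a given finite set coincide.\<close>

lemma equiv_ray_equiv:
  assumes "sym E"
  shows "equiv (rays E V) (ray_equiv E V)"
proof (rule equivI)
  show "refl_on (rays E V) (ray_equiv E V)"
    using ray_tail_component[of _ E V] by (fastforce simp: refl_on_def ray_equiv_def)
  show "sym (ray_equiv E V)"
    by (fastforce simp: sym_def ray_equiv_def)
  show "trans (ray_equiv E V)"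
  proof (rule transI)
    fix a b c assume ab: "(a, b) \<in> ray_equiv E V" and bc: "(b, c) \<in> ray_equiv E V"
    have "\<exists>C\<in>graph_components E (V - K). (\<forall>\<^sub>F n in sequentially. a n \<in> C) \<and>
        (\<forall>\<^sub>F n in sequentially. c n \<in> C)" if K: "finite K" for K
    proof -
      obtain C where C: "C \<in> graph_components E (V - K)"
        "\<forall>\<^sub>F n in sequentially. a n \<in> C" "\<forall>\<^sub>F n in sequentially. b n \<in> C"
        using ab K by (auto simp: ray_equiv_def)
      then show ?thesis using ray_equiv_component[OF assms bc K C(1)] by auto
    qed
    with ab bc show "(a, c) \<in> ray_equiv E V" by (auto simp: ray_equiv_def)
  qed
qed (auto simp: ray_equiv_def)

definition end_of :: "'v rel \<Rightarrow> 'v set \<Rightarrow> (nat \<Rightarrow> 'v) \<Rightarrow> 'v graph_end" where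
  "end_of E V r = ray_equiv E V `` {r}"

lemma end_of_in_ends: "r \<in> rays E V \<Longrightarrow> end_of E V r \<in> ends E V"
  by (auto simp: ends_def end_of_def intro: quotientI)

lemma endsE:
  assumes "e \<in> ends E V"
  obtains r where "r \<in> rays E V" "e = end_of E V r"
  using assms by (auto simp: ends_def end_of_def elim: quotientE)

lemma ray_in_end_of: "sym E \<Longrightarrow> r \<in> rays E V \<Longrightarrow> r \<in> end_of E V r"
  using equiv_ray_equiv[of E V] by (auto simp: end_of_def equiv_def refl_on_def)

lemma end_of_eqI: "sym E \<Longrightarrow> (r, r') \<in> ray_equiv E V \<Longrightarrow> end_of E V r = end_of E V r'"
  unfolding end_of_def by (rule equiv_class_eq[OF equiv_ray_equiv])

lemma end_eq_end_of:
  assumes "sym E" "e \<in> ends E V" "r \<in> e"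
  shows "e = end_of E V r" "r \<in> rays E V"
proof -
  obtain q where q: "q \<in> rays E V" "e = end_of E V q" using assms(2) by (rule endsE)
  have qr: "(q, r) \<in> ray_equiv E V" using assms(3) by (simp add: q end_of_def)
  then show "e = end_of E V r" using end_of_eqI[OF assms(1)] q by blast
  show "r \<in> rays E V" using qr by (auto simp: ray_equiv_def)
qed

text \<open>Equivalent rays have their tails in the same component, so testing one representative
  suffices.\<close>

lemma end_of_in_ends_in:
  assumes "sym E" "r \<in> rays E V" "finite K" "C \<in> graph_components E (V - K)"
  shows "end_of E V r \<in> ends_in E V C \<longleftrightarrow> (\<forall>\<^sub>F n in sequentially. r n \<in> C)"
  using end_of_in_ends[OF assms(2)] ray_in_end_of[OF assms(1,2)]
    ray_equiv_component[OF assms(1) _ assms(3,4), of r]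
  by (auto simp: ends_in_def end_of_def)

lemma ex_ends_in:
  assumes "sym E" "e \<in> ends E V" "finite K"
  obtains C where "C \<in> graph_components E (V - K)" "e \<in> ends_in E V C"
proof -
  obtain r where r: "r \<in> rays E V" "e = end_of E V r" using assms(2) by (rule endsE)
  obtain C where "C \<in> graph_components E (V - K)" "\<forall>\<^sub>F n in sequentially. r n \<in> C"
    using ray_tail_component[OF r(1) assms(3)] by auto
  with that r show ?thesis using end_of_in_ends_in[OF assms(1) r(1) assms(3)] by auto
qed

text \<open>The Hausdorff property for ends, from which uniqueness of limits follows. Inequivalence
  of two representatives is by definition a finite set that separates their tails.\<close>

lemma ends_separated:
  assumes "sym E" "e \<in> ends E V" "e' \<in> ends E V" "e \<noteq> e'"
  obtains K C D where "finite K" "C \<in> graph_components E (V - K)" "D \<in> graph_components E (V - K)"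
    "e \<in> ends_in E V C" "e' \<in> ends_in E V D" "C \<inter> D = {}"
proof -
  obtain r where r: "r \<in> rays E V" "e = end_of E V r" using assms(2) by (rule endsE)
  obtain q where q: "q \<in> rays E V" "e' = end_of E V q" using assms(3) by (rule endsE)
  have "(r, q) \<notin> ray_equiv E V" using end_of_eqI[OF assms(1)] assms(4) r q by blast
  then obtain K where K: "finite K"
    "\<And>C. C \<in> graph_components E (V - K) \<Longrightarrow> \<forall>\<^sub>F n in sequentially. r n \<in> C \<Longrightarrow>
       \<forall>\<^sub>F n in sequentially. q n \<in> C \<Longrightarrow> False"
    using r q by (auto simp: ray_equiv_def)
  obtain C where C: "C \<in> graph_components E (V - K)" "e \<in> ends_in E V C"
    using ex_ends_in[OF assms(1,2) K(1)] .
  obtain D where D: "D \<in> graph_components E (V - K)" "e' \<in> ends_in E V D"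
    using ex_ends_in[OF assms(1,3) K(1)] .
  have "C \<noteq> D"
    using K(2)[OF C(1)] C D r q end_of_in_ends_in[OF assms(1) r(1) K(1) C(1)]
      end_of_in_ends_in[OF assms(1) q(1) K(1) C(1)] by auto
  then have "C \<inter> D = {}" using graph_component_eq[OF assms(1) C(1) D(1)] by auto
  with that K(1) C D show ?thesis by blast
qed

section \<open>Convergence in the end compactification\<close>

definition end_subbasis :: "'v rel \<Rightarrow> 'v set \<Rightarrow> ('v + 'v graph_end) set set" where
  "end_subbasis E V = {{Inl v} | v. v \<in> V} \<union>
      {Inl ` C \<union> Inr ` ends_in E V C | C K. finite K \<and> C \<in> graph_components E (V - K)}"

lemma openin_end_compactification:
  "openin (end_compactification E V) U \<longleftrightarrow> generate_topology_on (end_subbasis E V) U"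
  by (simp add: end_compactification_def end_subbasis_def openin_topology_generated_by_iff)

lemma topspace_end_compactification: "topspace (end_compactification E V) = \<Union>(end_subbasis E V)"
  by (simp add: end_compactification_def end_subbasis_def)

lemma end_subbasis_component:
  "finite K \<Longrightarrow> C \<in> graph_components E (V - K) \<Longrightarrow>
    Inl ` C \<union> Inr ` ends_in E V C \<in> end_subbasis E V"
  by (auto simp: end_subbasis_def)

lemma Inr_in_topspace:
  assumes "sym E"
  shows "Inr e \<in> topspace (end_compactification E V) \<longleftrightarrow> e \<in> ends E V"
proof
  assume "Inr e \<in> topspace (end_compactification E V)"
  then show "e \<in> ends E V"
    by (auto simp: topspace_end_compactification end_subbasis_def ends_in_def)
next
  assume "e \<in> ends E V"
  then obtain C where C: "C \<in> graph_components E (V - {})" "e \<in> ends_in E V C"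
    using ex_ends_in[OF assms, of e V "{}"] by blast
  then show "Inr e \<in> topspace (end_compactification E V)"
    using end_subbasis_component[of "{}" C E V]
    unfolding topspace_end_compactification by blast
qed

text \<open>Being eventually in a set passes to finite intersections and to supersets, so it is
  enough to test generators of the topology. The singletons of vertices contain no end, which leaves
  the sets coming from components.\<close>

lemma tends_to_end_iff:
  assumes "sym E"
  shows "tends_to_end E V x e \<longleftrightarrow> e \<in> ends E V \<and>
    (\<forall>K C. finite K \<longrightarrow> C \<in> graph_components E (V - K) \<longrightarrow> e \<in> ends_in E V C \<longrightarrow>
       (\<forall>\<^sub>F n in sequentially. x n \<in> C))" (is "_ \<longleftrightarrow> _ \<and> ?R")
proof safe
  assume "tends_to_end E V x e"
  then have lim: "limitin (end_compactification E V) (\<lambda>n. Inl (x n)) (Inr e) sequentially"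
    by (simp add: tends_to_end_def)
  then show "e \<in> ends E V" using Inr_in_topspace[OF assms] by (auto simp: limitin_def)
  fix K C assume KC: "finite K" "C \<in> graph_components E (V - K)" "e \<in> ends_in E V C"
  have "openin (end_compactification E V) (Inl ` C \<union> Inr ` ends_in E V C)"
    using end_subbasis_component[OF KC(1,2)]
    by (auto simp: openin_end_compactification intro: generate_topology_on.intros)
  then have "\<forall>\<^sub>F n in sequentially. Inl (x n) \<in> Inl ` C \<union> Inr ` ends_in E V C"
    using lim KC(3) unfolding limitin_def by blast
  then show "\<forall>\<^sub>F n in sequentially. x n \<in> C" by eventually_elim auto
next
  assume e: "e \<in> ends E V" and R: ?R
  have "\<forall>\<^sub>F n in sequentially. Inl (x n) \<in> U"
    if "generate_topology_on (end_subbasis E V) U" "Inr e \<in> U" for U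
    using that
  proof (induction U)
    case (Int a b)
    then show ?case by (simp add: eventually_conj_iff)
  next
    case (UN K)
    then obtain k where "k \<in> K" "Inr e \<in> k" by auto
    with UN.IH have "\<forall>\<^sub>F n in sequentially. Inl (x n) \<in> k" by auto
    then show ?case by eventually_elim (use \<open>k \<in> K\<close> in auto)
  next
    case (Basis s)
    then obtain C K where CK: "finite K" "C \<in> graph_components E (V - K)" "e \<in> ends_in E V C"
      "s = Inl ` C \<union> Inr ` ends_in E V C" by (auto simp: end_subbasis_def)
    then have "\<forall>\<^sub>F n in sequentially. x n \<in> C" using R by auto
    then show ?case by eventually_elim (use CK in auto)
  qed auto
  then show "tends_to_end E V x e"
    using Inr_in_topspace[OF assms] e
    by (auto simp: tends_to_end_def limitin_def openin_end_compactification)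
qed

lemma tends_to_end_in_ends: "sym E \<Longrightarrow> tends_to_end E V x e \<Longrightarrow> e \<in> ends E V"
  by (simp add: tends_to_end_iff)

lemma tends_to_end_unique:
  assumes "sym E" "tends_to_end E V x e" "tends_to_end E V x e'"
  shows "e = e'"
proof (rule ccontr)
  assume "e \<noteq> e'"
  then obtain K C D where *: "finite K" "C \<in> graph_components E (V - K)" "D \<in> graph_components E (V - K)"
    "e \<in> ends_in E V C" "e' \<in> ends_in E V D" "C \<inter> D = {}"
    using ends_separated[OF assms(1), of e V e'] assms tends_to_end_in_ends by metis
  have "\<forall>\<^sub>F n in sequentially. x n \<in> C" "\<forall>\<^sub>F n in sequentially. x n \<in> D"
    using assms * by (auto simp: tends_to_end_iff)
  then have "C = D" by (rule eventually_component_unique[OF assms(1) *(2,3)])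
  then have "C = {}" using *(6) by auto
  with \<open>\<forall>\<^sub>F n in sequentially. x n \<in> C\<close> show False by simp
qed

lemma limit_end_eq: "sym E \<Longrightarrow> tends_to_end E V x e \<Longrightarrow> limit_end E V x = e"
  unfolding limit_end_def using tends_to_end_unique by (metis the_equality)

text \<open>Basic neighbourhoods also behave like closed sets: the limit has its own component for
  \<open>K\<close>, and the sequence cannot eventually lie in two different components.\<close>

lemma tends_to_end_ends_in:
  assumes "sym E" "tends_to_end E V x e" "finite K" "C \<in> graph_components E (V - K)"
  shows "e \<in> ends_in E V C \<longleftrightarrow> (\<forall>\<^sub>F n in sequentially. x n \<in> C)"
proof
  assume "\<forall>\<^sub>F n in sequentially. x n \<in> C"
  obtain D where D: "D \<in> graph_components E (V - K)" "e \<in> ends_in E V D"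
    using ex_ends_in[OF assms(1) tends_to_end_in_ends[OF assms(1,2)] assms(3)] .
  then have "\<forall>\<^sub>F n in sequentially. x n \<in> D" using assms by (auto simp: tends_to_end_iff)
  then have "C = D" using eventually_component_unique[OF assms(1,4) D(1)] \<open>\<forall>\<^sub>F n in sequentially. x n \<in> C\<close> by blast
  with D show "e \<in> ends_in E V C" by simp
qed (use assms in \<open>auto simp: tends_to_end_iff\<close>)

text \<open>The loop erasure: after the last visit to a vertex, continue with the next one.\<close>

lemma loop_erasure:
  assumes fin: "\<And>v. finite {i. y i = v}" and V: "\<And>i. y i \<in> V"
    and step: "\<And>i. y i = y (Suc i) \<or> (y i, y (Suc i)) \<in> E"
  obtains t :: "nat \<Rightarrow> nat" where "strict_mono t" "(\<lambda>k. y (t k)) \<in> rays E V"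
proof -
  define last where "last v = Max {i. y i = v}" for v
  have last: "y (last (y i)) = y i" "i \<le> last (y i)" for i
    using Max_in[OF fin[of "y i"]] Max_ge[OF fin[of "y i"], of i] by (auto simp: last_def)
  have after: "y j \<noteq> y i" if "last (y i) < j" for i j
    using Max_ge[OF fin[of "y i"], of j] that by (auto simp: last_def)
  define t where "t = rec_nat (last (y 0)) (\<lambda>_ m. last (y (Suc m)))"
  have tS: "t (Suc k) = last (y (Suc (t k)))" for k by (simp add: t_def)
  have t_last: "last (y (t k)) = t k" for k
    by (cases k) (simp_all add: t_def last(1))
  have mono: "strict_mono t"
    unfolding strict_mono_Suc_iff using last(2) tS by (metis Suc_le_eq)
  have neq: "y (t l) \<noteq> y (t k)" if "k < l" for k l
    by (rule after) (use t_last strict_monoD[OF mono that] in simp)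
  have "inj (\<lambda>k. y (t k))"
    by (rule injI) (metis neq nat_neq_iff)
  moreover have "(y (t k), y (t (Suc k))) \<in> E" for k
    using step[of "t k"] last(1)[of "Suc (t k)"] neq[of k "Suc k"] by (auto simp: tS)
  ultimately have "(\<lambda>k. y (t k)) \<in> rays E V" using V by (auto simp: rays_def)
  with mono that show ?thesis by blast
qed

text \<open>Finite paths inside shrinking sets are joined into one infinite walk that finally stays
  in each of the sets. Its loop erasure will represent the limit end.\<close>

lemma concatenate_paths:
  fixes z :: "nat \<Rightarrow> 'v"
  assumes "\<And>n. z n \<in> C n" and "\<And>n. C (Suc n) \<subseteq> C n"
    and "\<And>n. (z n, z (Suc n)) \<in> (E \<inter> C n \<times> C n)\<^sup>*"
  obtains y :: "nat \<Rightarrow> 'v" where "\<And>i. y i = y (Suc i) \<or> (y i, y (Suc i)) \<in> E"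
    "\<And>i. y i \<in> C 0" "\<And>n. \<forall>\<^sub>F i in sequentially. y i \<in> C n"
proof -
  have "\<exists>k f. f 0 = z n \<and> f k = z (Suc n) \<and> (\<forall>i<k. (f i, f (Suc i)) \<in> E \<inter> C n \<times> C n)" for n
    using assms(3)[of n] unfolding rtrancl_power relpow_fun_conv by blast
  then obtain k f where f: "\<And>n. f n 0 = z n" "\<And>n. f n (k n) = z (Suc n)"
    "\<And>n i. i < k n \<Longrightarrow> (f n i, f n (Suc i)) \<in> E \<inter> C n \<times> C n" by metis
  \<comment> \<open>The state \<open>(n, j)\<close> means position \<open>j\<close> on segment
    \<open>n\<close>. The joint \<open>z (Suc n)\<close> is visited twice, as the last point of one
    segment and the first of the next; hence the alternative \<open>y i = y (Suc i)\<close> in the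
    conclusion.\<close>
  define st where "st = rec_nat (0::nat, 0::nat)
     (\<lambda>_ (n, j). if j < k n then (n, Suc j) else (Suc n, 0))"
  have st0: "st 0 = (0, 0)" by (simp add: st_def)
  have stS: "st (Suc i) = (if snd (st i) < k (fst (st i)) then (fst (st i), Suc (snd (st i)))
     else (Suc (fst (st i)), 0))" for i
    by (simp add: st_def split: prod.split)
  have le: "snd (st i) \<le> k (fst (st i))" for i
    by (induction i) (auto simp: st0 stS)
  have mono: "mono (\<lambda>i. fst (st i))"
    unfolding mono_iff_le_Suc by (auto simp: stS)
  have run: "st (i + j) = (n, j)" if "st i = (n, 0)" "j \<le> k n" for i j n
    using that(2) by (induction j) (auto simp: that stS)
  have reach: "\<exists>i. st i = (n, 0)" for n
  proof (induction n)
    case (Suc n)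
    then obtain i where "st i = (n, 0)" by blast
    then have "st (i + k n) = (n, k n)" using run by blast
    then have "st (Suc (i + k n)) = (Suc n, 0)" by (simp add: stS)
    then show ?case by blast
  qed (use st0 in blast)
  define y where "y i = f (fst (st i)) (snd (st i))" for i
  have anti: "C m \<subseteq> C n" if "n \<le> m" for n m
    using lift_Suc_antimono_le[of C, OF assms(2) that] .
  have yC: "y i \<in> C (fst (st i))" for i
  proof (cases "snd (st i)")
    case (Suc j)
    then have "j < k (fst (st i))" using le[of i] by simp
    then show ?thesis using f(3)[of j "fst (st i)"] Suc by (simp add: y_def)
  qed (simp add: y_def f assms)
  have "y i = y (Suc i) \<or> (y i, y (Suc i)) \<in> E" for i
  proof (cases "snd (st i) < k (fst (st i))")
    case True
    then show ?thesis using f(3)[OF True] by (simp add: y_def stS)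
  next
    case False
    then have "snd (st i) = k (fst (st i))" using le[of i] by simp
    then show ?thesis by (simp add: y_def stS f)
  qed
  moreover have "y i \<in> C 0" for i using yC anti[of 0] by blast
  moreover have "\<forall>\<^sub>F i in sequentially. y i \<in> C n" for n
  proof -
    obtain i where i: "st i = (n, 0)" using reach by blast
    have "y j \<in> C n" if "j \<ge> i" for j
      using monoD[OF mono that] i yC anti by fastforce
    then show ?thesis by (auto simp: eventually_sequentially)
  qed
  ultimately show ?thesis by (rule that)
qed

text \<open>A criterion for convergence that names no end. For the converse direction,
  \<open>V\<close> is exhausted by finite sets; the components that capture the sequence are nested,
  and a walk through them visits each vertex finitely often, so its loop erasure is a ray. The end
  of this ray is the limit.\<close>

theorem tends_to_end_exists_iff:
  assumes "sym E" "countable V"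
  shows "(\<exists>e. tends_to_end E V x e) \<longleftrightarrow>
    (\<forall>K. finite K \<longrightarrow> (\<exists>C\<in>graph_components E (V - K). \<forall>\<^sub>F n in sequentially. x n \<in> C))"
    (is "?L \<longleftrightarrow> ?R")
proof
  assume ?L
  then obtain e where e: "tends_to_end E V x e" by blast
  show ?R
  proof (intro allI impI)
    fix K :: "'a set" assume K: "finite K"
    obtain C where C: "C \<in> graph_components E (V - K)" "e \<in> ends_in E V C"
      using ex_ends_in[OF assms(1) tends_to_end_in_ends[OF assms(1) e] K] .
    then show "\<exists>C\<in>graph_components E (V - K). \<forall>\<^sub>F n in sequentially. x n \<in> C"
      using e K assms by (auto simp: tends_to_end_iff)
  qed
next
  assume R: ?R
  have "V \<noteq> {}"
    using R[rule_format, of "{}"] graph_component_subset[of _ E V] by (fastforce simp: eventually_sequentially)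
  define K where "K n = from_nat_into V ` {..<n}" for n
  have K: "finite (K n)" "K n \<subseteq> K (Suc n)" for n by (auto simp: K_def)
  have VK: "\<exists>n. v \<in> K n" if v: "v \<in> V" for v
    using from_nat_into_surj[OF assms(2) v] unfolding K_def by blast
  obtain C where C: "\<And>n. C n \<in> graph_components E (V - K n)"
    "\<And>n. \<forall>\<^sub>F i in sequentially. x i \<in> C n"
  proof -
    have "\<forall>n. \<exists>C. C \<in> graph_components E (V - K n) \<and> (\<forall>\<^sub>F i in sequentially. x i \<in> C)"
      using R K(1) by blast
    then show ?thesis using that by (metis (no_types))
  qed
  have C_mono: "C (Suc n) \<subseteq> C n" for n
  proof -
    have "\<forall>\<^sub>F i in sequentially. x i \<in> C (Suc n) \<and> x i \<in> C n"
      using C by (simp add: eventually_conj_iff)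
    then obtain i where "x i \<in> C (Suc n)" "x i \<in> C n" by (auto simp: eventually_sequentially)
    then show ?thesis
      using graph_component_mono[OF assms(1) C(1) C(1), of "Suc n" n "x i"] K(2)[of n] by blast
  qed
  have "\<exists>i. x i \<in> C n" for n
    using C(2)[of n] by (auto simp: eventually_sequentially)
  then obtain i where "\<And>n. x (i n) \<in> C n" by metis
  then obtain z where z: "\<And>n. z n \<in> C n" by (rule that[of "\<lambda>n. x (i n)"])
  have path: "(z n, z (Suc n)) \<in> (E \<inter> C n \<times> C n)\<^sup>*" for n
    using graph_component_connected[OF assms(1) C(1)] z C_mono by blast
  obtain y where y: "\<And>i. y i = y (Suc i) \<or> (y i, y (Suc i)) \<in> E"
    "\<And>i. y i \<in> C 0" "\<And>n. \<forall>\<^sub>F i in sequentially. y i \<in> C n"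
    using concatenate_paths[of z C E, OF z C_mono path] by blast
  have yV: "y i \<in> V" for i
    using y(2) graph_component_subset[OF C(1), of 0] by auto
  have "finite {i. y i = v}" for v
  proof (cases "v \<in> V")
    case True
    then obtain n where n: "v \<in> K n" using VK by blast
    have "\<forall>\<^sub>F i in sequentially. y i \<noteq> v"
      using y(3)[of n] by eventually_elim (use n graph_component_subset[OF C(1)] in blast)
    then show ?thesis by (simp add: cofinite_eq_sequentially[symmetric] eventually_cofinite)
  next
    case False
    then have "{i. y i = v} = {}" using yV by auto
    then show ?thesis by simp
  qed
  then obtain t where t: "strict_mono t" "(\<lambda>k. y (t k)) \<in> rays E V"
    using loop_erasure[of y V E] yV y(1) by blast
  define r where "r = (\<lambda>k. y (t k))"
  have r: "r \<in> rays E V" using t by (simp add: r_def)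
  have rC: "\<forall>\<^sub>F i in sequentially. r i \<in> C n" for n
    unfolding r_def using y(3)[of n] filterlim_subseq[OF t(1)]
    by (rule eventually_compose_filterlim)
  have "tends_to_end E V x (end_of E V r)"
    unfolding tends_to_end_iff[OF assms(1)]
  proof (intro conjI allI impI)
    fix L D
    assume L: "finite L" and D: "D \<in> graph_components E (V - L)" "end_of E V r \<in> ends_in E V D"
    \<comment> \<open>The set \<open>L\<close> may contain points outside \<open>V\<close>, which
      the exhaustion never reaches; they do not affect \<open>V - L\<close>.\<close>
    have "\<exists>n. L \<inter> V \<subseteq> K n"
    proof -
      obtain N where N: "\<And>v. v \<in> V \<Longrightarrow> v \<in> K (N v)" using VK by metis
      have KK: "K m \<subseteq> K n" if "m \<le> n" for m n using that by (auto simp: K_def)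
      have "L \<inter> V \<subseteq> K (Max (N ` (L \<inter> V)))"
      proof
        fix v assume v: "v \<in> L \<inter> V"
        then have "N v \<le> Max (N ` (L \<inter> V))" using L by auto
        then show "v \<in> K (Max (N ` (L \<inter> V)))" using N[of v] KK v by blast
      qed
      then show ?thesis by blast
    qed
    then obtain n where n: "L \<inter> V \<subseteq> K n" by blast
    have "\<forall>\<^sub>F i in sequentially. r i \<in> D"
      using D L end_of_in_ends_in[OF assms(1) r] by blast
    then have "\<forall>\<^sub>F i in sequentially. r i \<in> D \<and> r i \<in> C n"
      using rC by (simp add: eventually_conj_iff)
    then obtain i where i: "r i \<in> D" "r i \<in> C n" by (auto simp: eventually_sequentially)
    have "C n \<subseteq> D"
      by (rule graph_component_mono[OF assms(1) C(1) D(1) _ i(2,1)]) (use n in blast)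
    then show "\<forall>\<^sub>F n in sequentially. x n \<in> D"
      using C(2)[of n] by (auto elim: eventually_mono)
  qed (rule end_of_in_ends[OF r])
  then show ?L by blast
qed

text \<open>The form needed for a walk with jumps: consecutive points need not be adjacent, only
  connected outside the finite set.\<close>

lemma tends_to_end_if_component:
  assumes "sym E" "countable V"
    "\<And>K. finite K \<Longrightarrow> \<exists>N. \<forall>n\<ge>N. x n \<in> V - K \<and> (x n, x (Suc n)) \<in> (E \<inter> (V - K) \<times> (V - K))\<^sup>*"
  shows "\<exists>e. tends_to_end E V x e"
  unfolding tends_to_end_exists_iff[OF assms(1,2)]
proof (intro allI impI)
  fix K :: "'a set" assume "finite K"
  then obtain N where N: "\<And>n. n \<ge> N \<Longrightarrow> x n \<in> V - K"
    "\<And>n. n \<ge> N \<Longrightarrow> (x n, x (Suc n)) \<in> (E \<inter> (V - K) \<times> (V - K))\<^sup>*"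
    using assms(3) by blast
  obtain C where C: "C \<in> graph_components E (V - K)" "x N \<in> C"
    using ex_graph_component[OF N(1)[OF order_refl]] by blast
  have "x n \<in> C" if "n \<ge> N" for n
    using that
  proof (induction rule: dec_induct)
    case (step n)
    then show ?case using graph_component_path[OF C(1) _ N(2)] by blast
  qed (rule C)
  with C show "\<exists>C\<in>graph_components E (V - K). \<forall>\<^sub>F n in sequentially. x n \<in> C"
    by (auto simp: eventually_sequentially)
qed

section \<open>Measurability of the limit end\<close>

text \<open>Open sets are arbitrary unions of finite intersections of generators. With countably
  many generators there are only countably many such intersections, so every union is a countable
  one.\<close>

lemma sets_generate_topology_on:
  assumes "generate_topology_on S U" "countable S"
    and "\<And>s. s \<in> S \<Longrightarrow> {w \<in> space M. f w \<in> s} \<in> sets M"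
  shows "{w \<in> space M. f w \<in> U} \<in> sets M"
proof -
  define B where "B = Inter ` {F. finite F \<and> F \<noteq> {} \<and> F \<subseteq> S}"
  have "countable {F. finite F \<and> F \<subseteq> S}" by (rule countable_Collect_finite_subset[OF assms(2)])
  then have "countable B"
    unfolding B_def by (intro countable_image) (rule countable_subset[rotated], auto)
  have "{w \<in> space M. f w \<in> b} \<in> sets M" if "b \<in> B" for b
  proof -
    from that obtain F where F: "b = \<Inter>F" "F \<in> {F. finite F \<and> F \<noteq> {} \<and> F \<subseteq> S}"
      unfolding B_def by (rule imageE)
    have "(\<Inter>s\<in>F. {w \<in> space M. f w \<in> s}) \<in> sets M"
      using F assms(3) by (intro sets.finite_INT) auto
    also have "(\<Inter>s\<in>F. {w \<in> space M. f w \<in> s}) = {w \<in> space M. f w \<in> b}"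
      using F by auto
    finally show ?thesis .
  qed
  then have "(\<Union>b\<in>{b \<in> B. b \<subseteq> U}. {w \<in> space M. f w \<in> b}) \<in> sets M"
    using \<open>countable B\<close> by (intro sets.countable_UN'') auto
  moreover have "U \<subseteq> \<Union>{b \<in> B. b \<subseteq> U}"
  proof
    fix p assume "p \<in> U"
    have "\<exists>K. K \<subseteq> Collect (finite' intersection_of (\<lambda>x. x \<in> S)) \<and> \<Union>K = U"
      using assms(1) unfolding generate_topology_on_eq union_of_def by blast
    then obtain K where K: "\<And>a. a \<in> K \<Longrightarrow> (finite' intersection_of (\<lambda>x. x \<in> S)) a" "\<Union>K = U"
      by blast
    with \<open>p \<in> U\<close> obtain a where a: "a \<in> K" "p \<in> a" by auto
    have "\<exists>F. (finite' F \<and> F \<subseteq> S) \<and> \<Inter>F = a"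
      using K(1)[OF a(1)] by (simp add: intersection_of_def)
    then obtain F where "finite' F" "F \<subseteq> S" "\<Inter>F = a" by blast
    then have "a \<in> B" unfolding B_def by (intro image_eqI[of _ _ F]) simp_all
    then show "p \<in> \<Union>{b \<in> B. b \<subseteq> U}" using a K(2) by auto
  qed
  then have "(\<Union>b\<in>{b \<in> B. b \<subseteq> U}. {w \<in> space M. f w \<in> b}) = {w \<in> space M. f w \<in> U}"
    by blast
  ultimately show ?thesis by simp
qed

lemma graph_components_diff_Int: "graph_components E (V - K) = graph_components E (V - (K \<inter> V))"
proof -
  have "V - K = V - (K \<inter> V)" by auto
  then show ?thesis by simp
qed

lemma countable_graph_components: "countable V \<Longrightarrow> countable (graph_components E V)"
  unfolding graph_components_def quotient_def by auto

lemma countable_end_subbasis: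
  assumes "countable V"
  shows "countable (end_subbasis E V)"
proof -
  have "{C. \<exists>K. finite K \<and> C \<in> graph_components E (V - K)} \<subseteq>
      (\<Union>K\<in>{K. finite K \<and> K \<subseteq> V}. graph_components E (V - K))"
  proof clarify
    fix C K assume "finite (K :: 'a set)" "C \<in> graph_components E (V - K)"
    then show "C \<in> (\<Union>K\<in>{K. finite K \<and> K \<subseteq> V}. graph_components E (V - K))"
      using graph_components_diff_Int[of E V K] by (intro UN_I[of "K \<inter> V"]) auto
  qed
  moreover have "countable \<dots>"
    using assms by (intro countable_UN countable_Collect_finite_subset countable_graph_components) auto
  ultimately have "countable {C. \<exists>K. finite K \<and> C \<in> graph_components E (V - K)}"
    by (rule countable_subset)
  then have "countable ((\<lambda>v. {Inl v}) ` V \<union>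
      (\<lambda>C. Inl ` C \<union> Inr ` ends_in E V C) ` {C. \<exists>K. finite K \<and> C \<in> graph_components E (V - K)})"
    using assms by auto
  moreover have "end_subbasis E V \<subseteq> (\<lambda>v. {Inl v}) ` V \<union>
      (\<lambda>C. Inl ` C \<union> Inr ` ends_in E V C) ` {C. \<exists>K. finite K \<and> C \<in> graph_components E (V - K)}"
    by (auto simp: end_subbasis_def)
  ultimately show ?thesis by (rule countable_subset[rotated])
qed

lemma topspace_end_space: "sym E \<Longrightarrow> topspace (end_space E V) = ends E V"
  using Inr_in_topspace[of E _ V] unfolding end_space_def topspace_pullback_topology by auto

lemma openin_end_space_ends_in:
  assumes "finite K" "C \<in> graph_components E (V - K)"
  shows "openin (end_space E V) (ends_in E V C)"
  unfolding end_space_def openin_pullback_topology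
  using end_subbasis_component[OF assms]
  by (intro exI[of _ "Inl ` C \<union> Inr ` ends_in E V C"])
     (auto simp: openin_end_compactification ends_in_def intro: generate_topology_on.intros)

lemma openin_subset_Pow: "{U. openin T U} \<subseteq> Pow (topspace T)"
  using openin_subset by auto

lemma space_borel_of: "space (borel_of T) = topspace T"
  by (simp add: borel_of_def space_measure_of[OF openin_subset_Pow])

lemma openin_sets_borel_of: "openin T U \<Longrightarrow> U \<in> sets (borel_of T)"
  by (simp add: borel_of_def sets_measure_of[OF openin_subset_Pow])

text \<open>Where the sequence converges, the limit lies in a basic set iff the sequence is
  eventually in the component, a countable combination of events; elsewhere the value is a fixed
  end. It remains to see that convergence itself is an event.\<close>

lemma measurable_limit_end:
  fixes X :: "nat \<Rightarrow> 'w \<Rightarrow> 'v"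
  assumes "sym E" "countable V" "ends E V \<noteq> {}"
    and X: "\<And>n. X n \<in> M \<rightarrow>\<^sub>M count_space UNIV"
  shows "(\<lambda>w. limit_end E V (\<lambda>n. X n w)) \<in> M \<rightarrow>\<^sub>M borel_of (end_space E V)"
proof -
  define L where "L w = limit_end E V (\<lambda>n. X n w)" for w
  define d where "d = (SOME e. e \<in> ends E V)"
  have d: "d \<in> ends E V" unfolding d_def using assms(3) by (auto intro: someI)
  define conv where "conv w \<longleftrightarrow> (\<exists>e. tends_to_end E V (\<lambda>n. X n w) e)" for w
  have L: "tends_to_end E V (\<lambda>n. X n w) (L w)" if "conv w" for w
    using that limit_end_eq[OF assms(1)] by (auto simp: conv_def L_def)
  have Ld: "L w = d" if "\<not> conv w" for w
    using that by (simp add: conv_def L_def limit_end_def d_def)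
  have Lends: "L w \<in> ends E V" for w
    using L[of w] Ld[of w] d tends_to_end_in_ends[OF assms(1)] by metis
  \<comment> \<open>Restricting \<open>K\<close> to subsets of \<open>V\<close> turns the quantifier
    over finite sets into a countable one.\<close>
  have conv_iff: "conv w \<longleftrightarrow> (\<forall>K\<in>{K. finite K \<and> K \<subseteq> V}. \<exists>C\<in>graph_components E (V - K).
      \<exists>N. \<forall>n\<ge>N. X n w \<in> C)" for w
  proof -
    have "(\<exists>C\<in>graph_components E (V - K). \<exists>N. \<forall>n\<ge>N. X n w \<in> C)"
      if "\<exists>C\<in>graph_components E (V - (K \<inter> V)). \<exists>N. \<forall>n\<ge>N. X n w \<in> C" for K
      using that graph_components_diff_Int[of E V K] by metis
    then show ?thesis
      unfolding conv_def tends_to_end_exists_iff[OF assms(1,2)] eventually_sequentially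
      by (auto simp del: ex_simps)
  qed
  have ev: "{w \<in> space M. \<exists>N. \<forall>n\<ge>N. X n w \<in> C} \<in> sets M" for C
  proof -
    have "{w \<in> space M. X n w \<in> C} \<in> sets M" for n
      using measurable_sets[OF X, of C n] by (simp add: vimage_def Int_def conj_commute)
    then show ?thesis
      by (intro sets.sets_Collect_countable_Ex sets.sets_Collect_countable_All sets.sets_Collect_imp
          sets.sets_Collect_const)
  qed
  have "{w \<in> space M. \<forall>K\<in>{K. finite K \<and> K \<subseteq> V}. \<exists>C\<in>graph_components E (V - K).
      \<exists>N. \<forall>n\<ge>N. X n w \<in> C} \<in> sets M"
  proof (rule sets.sets_Collect_countable_All')
    show "countable {K. finite K \<and> K \<subseteq> V}" by (rule countable_Collect_finite_subset[OF assms(2)])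
    show "{w \<in> space M. \<exists>C\<in>graph_components E (V - K). \<exists>N. \<forall>n\<ge>N. X n w \<in> C} \<in> sets M" for K
      by (rule sets.sets_Collect_countable_Ex'[OF ev countable_graph_components[OF countable_Diff[OF assms(2)]]])
  qed
  then have conv: "{w \<in> space M. conv w} \<in> sets M" by (simp only: conv_iff)
  have gen: "{w \<in> space M. Inr (L w) \<in> s} \<in> sets M" if s: "s \<in> end_subbasis E V" for s
    using s[unfolded end_subbasis_def]
  proof (rule UnE)
    assume "s \<in> {Inl ` C \<union> Inr ` ends_in E V C | C K. finite K \<and> C \<in> graph_components E (V - K)}"
    then obtain C K where CK: "finite K" "C \<in> graph_components E (V - K)"
      "s = Inl ` C \<union> Inr ` ends_in E V C" by blast
    have "{w \<in> space M. Inr (L w) \<in> s} =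
        ({w \<in> space M. conv w} \<inter> {w \<in> space M. \<exists>N. \<forall>n\<ge>N. X n w \<in> C}) \<union>
        (if d \<in> ends_in E V C then space M - {w \<in> space M. conv w} else {})"
    proof -
      have "L w \<in> ends_in E V C \<longleftrightarrow> (\<exists>N. \<forall>n\<ge>N. X n w \<in> C)" if "conv w" for w
        using tends_to_end_ends_in[OF assms(1) L[OF that] CK(1,2)]
        by (simp add: eventually_sequentially)
      then have "Inr (L w) \<in> s \<longleftrightarrow>
          (if conv w then \<exists>N. \<forall>n\<ge>N. X n w \<in> C else d \<in> ends_in E V C)" for w
        using Ld[of w] by (cases "conv w") (simp_all add: CK(3) image_iff)
      then show ?thesis by (simp only:) (simp add: set_eq_iff)
    qed
    also have "\<dots> \<in> sets M"
    proof (intro sets.Un sets.Int conv ev)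
      show "(if d \<in> ends_in E V C then space M - {w \<in> space M. conv w} else {}) \<in> sets M"
        by (simp only: split: if_split) (intro conjI impI sets.compl_sets conv sets.empty_sets)
    qed
    finally show ?thesis .
  qed auto
  have "L \<in> M \<rightarrow>\<^sub>M borel_of (end_space E V)"
    unfolding borel_of_def
  proof (rule measurable_measure_of[OF openin_subset_Pow])
    fix U assume "U \<in> {U. openin (end_space E V) U}"
    then obtain W where W: "openin (end_compactification E V) W" "U = Inr -` W \<inter> ends E V"
      by (auto simp: end_space_def openin_pullback_topology)
    have "{w \<in> space M. Inr (L w) \<in> W} \<in> sets M"
      using W(1)[unfolded openin_end_compactification] countable_end_subbasis[OF assms(2)] gen
      by (rule sets_generate_topology_on)
    also have "{w \<in> space M. Inr (L w) \<in> W} = L -` U \<inter> space M"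
      using Lends W(2) by auto
    finally show "L -` U \<inter> space M \<in> sets M" .
  qed (use Lends topspace_end_space[OF assms(1)] in auto)
  then show ?thesis by (simp add: L_def[abs_def])
qed

section \<open>Dyadic rationals and the generators\<close>

lemma dyadicI: "x = real_of_int k / 2 ^ n \<Longrightarrow> x \<in> dyadic"
  by (auto simp: dyadic_def)

lemma dyadicE:
  assumes "x \<in> dyadic"
  obtains k n where "x = real_of_int k / 2 ^ n"
  using assms by (auto simp: dyadic_def)

lemma countable_dyadic: "countable dyadic"
proof -
  have "dyadic = (\<lambda>(k, n). real_of_int k / 2 ^ n) ` UNIV"
    by (auto simp: dyadic_def image_def)
  also have "countable \<dots>" by (intro countable_image countableI_type)
  finally show ?thesis .
qed

lemma dyadic_of_int: "real_of_int k \<in> dyadic"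
  by (rule dyadicI[of _ k 0]) simp

lemma dyadic_add:
  assumes "x \<in> dyadic" "y \<in> dyadic"
  shows "x + y \<in> dyadic"
proof -
  obtain k n l m where "x = real_of_int k / 2 ^ n" "y = real_of_int l / 2 ^ m"
    using assms by (auto elim!: dyadicE)
  then have "x + y = real_of_int (k * 2 ^ m + l * 2 ^ n) / 2 ^ (n + m)"
    by (simp add: power_add add_divide_distrib)
  then show ?thesis by (rule dyadicI)
qed

lemma dyadic_add_of_int: "x \<in> dyadic \<Longrightarrow> x + real_of_int k \<in> dyadic"
  by (intro dyadic_add dyadic_of_int)

lemma dyadic_half:
  assumes "x \<in> dyadic"
  shows "x / 2 \<in> dyadic"
proof -
  obtain k n where "x = real_of_int k / 2 ^ n" using assms by (rule dyadicE)
  then show ?thesis by (intro dyadicI[of _ k "Suc n"]) simp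
qed

lemma dyadic_double: "x \<in> dyadic \<Longrightarrow> 2 * x \<in> dyadic"
  using dyadic_add[of x x] by simp

lemma dyadic_succ: "x \<in> dyadic \<Longrightarrow> x + 1 \<in> dyadic" and dyadic_pred: "x \<in> dyadic \<Longrightarrow> x - 1 \<in> dyadic"
  using dyadic_add_of_int[of x 1] dyadic_add_of_int[of x "-1"] by auto

definition gen_B_inv :: "real \<Rightarrow> real" where
  "gen_B_inv x = (if x \<le> 0 then x else if x \<le> 1 then 2 * x else x + 1)"

lemma gen_B_inverse: "gen_B_inv (gen_B x) = x" "gen_B (gen_B_inv x) = x"
  by (auto simp: gen_B_def gen_B_inv_def)

lemma one_thompson_F: "\<one>\<^bsub>thompson_F\<^esub> = id"
  by (simp add: thompson_F_def homeo_R_def)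

lemma gens_in_carrier: "gen_A \<in> carrier thompson_F" "gen_B \<in> carrier thompson_F"
  by (auto simp: carrier_thompson_F intro: generate.incl)

lemma inv_thompson_F_apply:
  assumes "g \<in> carrier thompson_F"
  shows "(inv\<^bsub>thompson_F\<^esub> g) (g x) = x" "g ((inv\<^bsub>thompson_F\<^esub> g) x) = x"
proof -
  have "(inv\<^bsub>thompson_F\<^esub> g) \<circ> g = id" "g \<circ> (inv\<^bsub>thompson_F\<^esub> g) = id"
    using group.r_inv[OF group_thompson_F assms] group.l_inv[OF group_thompson_F assms]
    by (simp_all add: mult_thompson_F one_thompson_F)
  then show "(inv\<^bsub>thompson_F\<^esub> g) (g x) = x" "g ((inv\<^bsub>thompson_F\<^esub> g) x) = x"
    by (simp_all add: fun_eq_iff)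
qed

lemma inv_gen_A: "inv\<^bsub>thompson_F\<^esub> gen_A = (\<lambda>x. x + 1)"
proof
  fix x :: real
  show "(inv\<^bsub>thompson_F\<^esub> gen_A) x = x + 1"
    using inv_thompson_F_apply(1)[OF gens_in_carrier(1), of "x + 1"] by (simp add: gen_A_def)
qed

lemma inv_gen_B: "inv\<^bsub>thompson_F\<^esub> gen_B = gen_B_inv"
proof
  fix x :: real
  show "(inv\<^bsub>thompson_F\<^esub> gen_B) x = gen_B_inv x"
    using inv_thompson_F_apply(1)[OF gens_in_carrier(2), of "gen_B_inv x"] by (simp add: gen_B_inverse)
qed

text \<open>Induction over words, with the inverse generators in closed form instead of as group
  inverses.\<close>

lemma thompson_F_induct [consumes 1, case_names one A A_inv B B_inv mult]:
  assumes "g \<in> carrier thompson_F"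
    and "P id" "P gen_A" "P (\<lambda>x. x + 1)" "P gen_B" "P gen_B_inv"
    and mult: "\<And>f g. f \<in> carrier thompson_F \<Longrightarrow> g \<in> carrier thompson_F \<Longrightarrow> P f \<Longrightarrow> P g \<Longrightarrow> P (g \<circ> f)"
  shows "P g"
proof -
  have inv_eq: "inv\<^bsub>homeo_R\<^esub> g = inv\<^bsub>thompson_F\<^esub> g" if "g \<in> {gen_A, gen_B}" for g
    using that gens_in_carrier group.inv_subgroup_generated[OF group_homeo_R, of g "{gen_A, gen_B}"]
    by (auto simp: thompson_F_def)
  show ?thesis
    using assms(1)[unfolded carrier_thompson_F]
  proof (induction rule: generate.induct)
    case one
    then show ?case using assms(2) by (simp add: homeo_R_def id_def)
  next
    case (inv h)
    then show ?case using inv_eq[of h] inv_gen_A inv_gen_B assms(4,6) by auto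
  next
    case (eng f g)
    then have "P (g \<circ> f)" by (intro mult) (auto simp: carrier_thompson_F)
    then show ?case by (simp add: homeo_R_def comp_def)
  qed (use assms(3,5) in auto)
qed

lemma thompson_F_mult_closed:
  "f \<in> carrier thompson_F \<Longrightarrow> g \<in> carrier thompson_F \<Longrightarrow> g \<circ> f \<in> carrier thompson_F"
  using monoid.m_closed[OF group.is_monoid[OF group_thompson_F]] by (simp add: mult_thompson_F)

lemma succ_in_carrier: "(\<lambda>x. x + 1) \<in> carrier thompson_F"
  using group.inv_closed[OF group_thompson_F gens_in_carrier(1)] by (simp add: inv_gen_A)

lemma gen_B_inv_in_carrier: "gen_B_inv \<in> carrier thompson_F"
  using group.inv_closed[OF group_thompson_F gens_in_carrier(2)] by (simp add: inv_gen_B)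

lemma translation_in_carrier: "(\<lambda>x. x + real_of_int k) \<in> carrier thompson_F"
proof -
  have pos: "(\<lambda>x. x + real n) \<in> carrier thompson_F" for n
  proof (induction n)
    case 0
    then show ?case using monoid.one_closed[OF group.is_monoid[OF group_thompson_F]]
      by (simp add: one_thompson_F id_def)
  next
    case (Suc n)
    then show ?case using thompson_F_mult_closed[OF Suc succ_in_carrier]
      by (simp add: o_def algebra_simps)
  qed
  have neg: "(\<lambda>x. x - real n) \<in> carrier thompson_F" for n
  proof (induction n)
    case 0
    then show ?case using pos[of 0] by simp
  next
    case (Suc n)
    then show ?case using thompson_F_mult_closed[OF Suc gens_in_carrier(1)]
      by (simp add: o_def gen_A_def algebra_simps)
  qed
  show ?thesis
    using pos[of "nat k"] neg[of "nat (- k)"] by (cases "k \<ge> 0") simp_all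
qed

lemma inj_thompson_F: "g \<in> carrier thompson_F \<Longrightarrow> inj g"
  using inv_thompson_F_apply(1) by (metis injI)

lemma thompson_F_dyadic: "g \<in> carrier thompson_F \<Longrightarrow> x \<in> dyadic \<Longrightarrow> g x \<in> dyadic"
  by (induction g arbitrary: x rule: thompson_F_induct)
     (auto simp: gen_A_def gen_B_def gen_B_inv_def dyadic_half dyadic_double dyadic_succ dyadic_pred)

text \<open>The orbit of \<open>1\<close> under the maps \<open>x \<mapsto> x / 2\<close> and \<open>x \<mapsto> x / 2 + 1\<close>, which agree on
  \<open>(0, 2)\<close> with two elements of the group, is a binary tree with vertex set \<open>(0, 2) \<inter> dyadic\<close>;
  its level \<open>n\<close> consists of the following points with \<open>k < 2 ^ n\<close>.\<close>

definition tree_point :: "nat \<Rightarrow> nat \<Rightarrow> real" where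
  "tree_point n k = (2 * real k + 1) / 2 ^ n"

definition upper_half :: "real \<Rightarrow> real" where
  "upper_half x = gen_B x + 1"

lemma upper_half_in_carrier: "upper_half \<in> carrier thompson_F"
  using thompson_F_mult_closed[OF gens_in_carrier(2) succ_in_carrier]
  by (simp add: upper_half_def[abs_def] o_def)

lemma tree_point_bounds:
  assumes "k < 2 ^ n"
  shows "0 < tree_point n k" "tree_point n k < 2"
proof -
  have "2 * k + 1 < 2 * 2 ^ n" using assms by simp
  then have "real (2 * k + 1) < real (2 * 2 ^ n)" by (rule of_nat_less_iff[THEN iffD2])
  then show "tree_point n k < 2" by (simp add: tree_point_def divide_simps)
qed (simp add: tree_point_def)

lemma gen_B_half: "0 < x \<Longrightarrow> x < 2 \<Longrightarrow> gen_B x = x / 2"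
  by (simp add: gen_B_def)

lemma tree_point_Suc:
  assumes "k < 2 ^ n"
  shows "tree_point (Suc n) k = gen_B (tree_point n k)"
    "tree_point (Suc n) (k + 2 ^ n) = upper_half (tree_point n k)"
proof -
  show *: "tree_point (Suc n) k = gen_B (tree_point n k)"
    using tree_point_bounds[OF assms] by (simp add: gen_B_half tree_point_def del: divide_eq_eq_numeral1 eq_divide_eq_numeral1 divide_less_eq_numeral1)
  have "tree_point (Suc n) (k + 2 ^ n) = tree_point (Suc n) k + 1"
    by (simp add: tree_point_def field_simps)
  then show "tree_point (Suc n) (k + 2 ^ n) = upper_half (tree_point n k)"
    by (simp add: upper_half_def *)
qed

lemma inj_tree_point: "inj (tree_point n)"
  by (auto simp: inj_def tree_point_def)

lemma tree_point_orbit: "k < 2 ^ n \<Longrightarrow> \<exists>g\<in>carrier thompson_F. g 1 = tree_point n k"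
proof (induction n arbitrary: k)
  case 0
  then show ?case
    using monoid.one_closed[OF group.is_monoid[OF group_thompson_F]]
    by (intro bexI[of _ id]) (simp_all add: one_thompson_F tree_point_def)
next
  case (Suc n)
  define l where "l = (if k < 2 ^ n then k else k - 2 ^ n)"
  have l: "l < 2 ^ n" using Suc.prems by (auto simp: l_def)
  obtain g where g: "g \<in> carrier thompson_F" "g 1 = tree_point n l" using Suc.IH[OF l] by blast
  show ?case
  proof (cases "k < 2 ^ n")
    case True
    then show ?thesis
      using tree_point_Suc(1)[OF l] g thompson_F_mult_closed[OF g(1) gens_in_carrier(2)]
      by (intro bexI[of _ "gen_B \<circ> g"]) (auto simp: l_def)
  next
    case False
    then show ?thesis
      using tree_point_Suc(2)[OF l] g thompson_F_mult_closed[OF g(1) upper_half_in_carrier]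
      by (intro bexI[of _ "upper_half \<circ> g"]) (auto simp: l_def)
  qed
qed

text \<open>Up to an integer translation a dyadic number with odd numerator is a point of the tree;
  an even numerator is halved, and integers are translates of \<open>1\<close>.\<close>

lemma thompson_F_transitive:
  assumes "y \<in> dyadic"
  shows "\<exists>g\<in>carrier thompson_F. g 1 = y"
proof -
  obtain j n where y: "y = real_of_int j / 2 ^ n" using assms by (rule dyadicE)
  have "\<exists>g\<in>carrier thompson_F. g 1 = real_of_int j / 2 ^ n" for j
  proof (induction n arbitrary: j)
    case 0
    then show ?case using translation_in_carrier[of "j - 1"]
      by (intro bexI[of _ "\<lambda>x. x + real_of_int (j - 1)"]) auto
  next
    case (Suc n)
    show ?case
    proof (cases "even j")
      case True
      then obtain i where "j = 2 * i" by (rule evenE)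
      then show ?thesis using Suc[of i] by simp
    next
      case False
      then obtain i where i: "j = 2 * i + 1" by (rule oddE)
      \<comment> \<open>Division with remainder of \<open>i\<close> by \<open>2 ^ n\<close>: the
        remainder is the index of the tree point, the quotient the integer translation.\<close>
      define k where "k = nat (i mod 2 ^ n)"
      have k: "int k = i mod 2 ^ n" by (simp add: k_def)
      then have "int k < int (2 ^ n)" by simp
      then have "k < 2 ^ n" by (simp only: of_nat_less_iff)
      then have "k < 2 ^ Suc n" by simp
      then obtain g where g: "g \<in> carrier thompson_F" "g 1 = tree_point (Suc n) k"
        using tree_point_orbit by blast
      have "i = i div 2 ^ n * 2 ^ n + int k" using div_mult_mod_eq[of i "2 ^ n"] k by simp
      then have "real_of_int i = real_of_int (i div 2 ^ n) * 2 ^ n + real k"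
        by (drule_tac arg_cong[where f = real_of_int]) simp
      then have "real_of_int j / 2 ^ Suc n = tree_point (Suc n) k + real_of_int (i div 2 ^ n)"
        by (simp add: i tree_point_def field_simps)
      then show ?thesis
        using thompson_F_mult_closed[OF g(1) translation_in_carrier[of "i div 2 ^ n"]] g(2)
        by (intro bexI[of _ "(\<lambda>x. x + real_of_int (i div 2 ^ n)) \<circ> g"]) auto
    qed
  qed
  then show ?thesis using y by blast
qed

section \<open>The Schreier graph\<close>

lemma schreier_edges_iff: "(x, y) \<in> schreier_edges \<longleftrightarrow>
    x \<in> dyadic \<and> (y = x - 1 \<or> y = x + 1 \<or> y = gen_B x \<or> y = gen_B_inv x)"
  by (auto simp: schreier_edges_def inv_gen_A inv_gen_B gen_A_def[symmetric])

lemma schreier_edges_dyadic: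
  assumes "(x, y) \<in> schreier_edges"
  shows "x \<in> dyadic" "y \<in> dyadic"
  using assms thompson_F_dyadic[OF gens_in_carrier(2), of x] thompson_F_dyadic[OF gen_B_inv_in_carrier, of x]
  by (auto simp: schreier_edges_iff dyadic_succ dyadic_pred)

lemma sym_schreier_edges: "sym schreier_edges"
proof (rule symI)
  fix x y assume "(x, y) \<in> schreier_edges"
  then show "(y, x) \<in> schreier_edges"
    using schreier_edges_dyadic(2)[of x y] unfolding schreier_edges_iff by (auto simp: gen_B_inverse)
qed

text \<open>A generator moves a point along one edge, which meets \<open>K\<close> at most in its
  two end points. Group elements are injective, so preimages of finite exceptional sets are finite,
  and the exceptional sets of two factors combine to one for the product.\<close>

lemma schreier_displacement:
  assumes "g \<in> carrier thompson_F" "finite K"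
  shows "\<exists>K'. finite K' \<and> (\<forall>x\<in>dyadic - K'. x \<notin> K \<and> g x \<notin> K \<and>
    (x, g x) \<in> (schreier_edges \<inter> (dyadic - K) \<times> (dyadic - K))\<^sup>*)"
proof -
  have edge: "\<exists>K'. finite K' \<and> (\<forall>x\<in>dyadic - K'. x \<notin> K \<and> s x \<notin> K \<and>
      (x, s x) \<in> (schreier_edges \<inter> (dyadic - K) \<times> (dyadic - K))\<^sup>*)"
    if s: "s \<in> carrier thompson_F" and e: "\<And>x. x \<in> dyadic \<Longrightarrow> (x, s x) \<in> schreier_edges" for s
  proof (intro exI conjI ballI)
    show "finite (K \<union> s -` K)" using assms(2) inj_thompson_F[OF s] by (simp add: finite_vimageI)
    fix x assume x: "x \<in> dyadic - (K \<union> s -` K)"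
    then show "x \<notin> K" "s x \<notin> K" by auto
    then show "(x, s x) \<in> (schreier_edges \<inter> (dyadic - K) \<times> (dyadic - K))\<^sup>*"
      using x e[of x] schreier_edges_dyadic[of x "s x"] by blast
  qed
  from assms(1) show ?thesis
  proof (induction g rule: thompson_F_induct)
    case one
    show ?case using assms(2) by auto
  next
    case (mult f g)
    from mult.IH obtain Kf Kg where Kf: "finite Kf"
      "\<forall>x\<in>dyadic - Kf. x \<notin> K \<and> f x \<notin> K \<and>
         (x, f x) \<in> (schreier_edges \<inter> (dyadic - K) \<times> (dyadic - K))\<^sup>*"
      and Kg: "finite Kg" "\<forall>x\<in>dyadic - Kg. x \<notin> K \<and> g x \<notin> K \<and>
         (x, g x) \<in> (schreier_edges \<inter> (dyadic - K) \<times> (dyadic - K))\<^sup>*"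
      by blast
    show ?case
    proof (intro exI[of _ "Kf \<union> f -` Kg"] conjI ballI)
      show "finite (Kf \<union> f -` Kg)"
        using Kf Kg inj_thompson_F[OF mult.hyps(1)] by (simp add: finite_vimageI)
      fix x assume x: "x \<in> dyadic - (Kf \<union> f -` Kg)"
      then have "f x \<in> dyadic - Kg" using thompson_F_dyadic[OF mult.hyps(1)] by auto
      then show "x \<notin> K" "(g \<circ> f) x \<notin> K"
        "(x, (g \<circ> f) x) \<in> (schreier_edges \<inter> (dyadic - K) \<times> (dyadic - K))\<^sup>*"
        using x Kf(2) Kg(2) by (auto intro: rtrancl_trans[of x "f x"])
    qed
  next
    case A
    show ?case by (rule edge[OF gens_in_carrier(1)]) (simp add: schreier_edges_iff gen_A_def)
  next
    case A_inv
    show ?case by (rule edge[OF succ_in_carrier]) (simp add: schreier_edges_iff)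
  next
    case B
    show ?case by (rule edge[OF gens_in_carrier(2)]) (simp add: schreier_edges_iff)
  next
    case B_inv
    show ?case by (rule edge[OF gen_B_inv_in_carrier]) (simp add: schreier_edges_iff)
  qed
qed

text \<open>The two types of rays are distinguished by a sign: \<open>far (-1)\<close> is \<open>(-\<infinity>, 0]\<close> and
  \<open>far 1\<close> is \<open>[2, \<infinity>)\<close>. The starting points \<open>s\<close> of the rays \<open>s + \<epsilon>, s + 2 \<epsilon>, \<dots>\<close>
  are \<open>(0, 1]\<close> and \<open>[1, 2)\<close>, respectively.\<close>

definition far :: "real \<Rightarrow> real \<Rightarrow> bool" where
  "far \<epsilon> x \<longleftrightarrow> 1 + \<epsilon> \<le> \<epsilon> * x"

definition ray_base :: "real \<Rightarrow> real set" where
  "ray_base \<epsilon> = {s \<in> dyadic. \<not> far \<epsilon> s \<and> far \<epsilon> (s + \<epsilon>)}"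

definition ray :: "real \<Rightarrow> real \<Rightarrow> nat \<Rightarrow> real" where
  "ray \<epsilon> s n = s + \<epsilon> * (1 + real n)"

lemma far_neighbour:
  assumes "\<epsilon> \<in> {-1, 1}" "far \<epsilon> x" "(x, y) \<in> schreier_edges"
  shows "y = x + \<epsilon> \<or> y = x - \<epsilon> \<or> y = x"
  using assms by (auto simp: far_def schreier_edges_iff gen_B_def gen_B_inv_def)

lemma far_entrance:
  assumes "\<epsilon> \<in> {-1, 1}" "0 < x" "x < 2" "(x, y) \<in> schreier_edges" "far \<epsilon> y"
  shows "y = x + \<epsilon>"
  using assms by (auto simp: far_def schreier_edges_iff gen_B_def gen_B_inv_def split: if_splits)

lemma dyadic_add_eps: "\<epsilon> \<in> {-1, 1} \<Longrightarrow> x \<in> dyadic \<Longrightarrow> x + \<epsilon> * real n \<in> dyadic"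
  using dyadic_add_of_int[of x "int n"] dyadic_add_of_int[of x "- int n"] by auto

lemma ray_dyadic: "\<epsilon> \<in> {-1, 1} \<Longrightarrow> s \<in> dyadic \<Longrightarrow> ray \<epsilon> s n \<in> dyadic"
  using dyadic_add_eps[of \<epsilon> s "Suc n"] by (simp add: ray_def)

lemma ray_edge:
  assumes "\<epsilon> \<in> {-1, 1}" "s \<in> dyadic"
  shows "(ray \<epsilon> s n, ray \<epsilon> s (Suc n)) \<in> schreier_edges"
  using ray_dyadic[OF assms] assms(1) by (auto simp: schreier_edges_iff ray_def)

lemma ray_in_rays: "\<epsilon> \<in> {-1, 1} \<Longrightarrow> s \<in> dyadic \<Longrightarrow> ray \<epsilon> s \<in> rays schreier_edges dyadic"
  using ray_dyadic ray_edge by (auto simp: rays_def inj_def ray_def)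

lemma far_ray:
  assumes "\<epsilon> \<in> {-1, 1}" "s \<in> ray_base \<epsilon>"
  shows "far \<epsilon> (ray \<epsilon> s n)"
  using assms by (auto simp: ray_base_def far_def ray_def)

lemma far_on_ray:
  assumes "\<epsilon> \<in> {-1, 1}" "far \<epsilon> x" "x \<in> dyadic"
  obtains s n where "s \<in> ray_base \<epsilon>" "x = ray \<epsilon> s n"
proof (cases "\<epsilon> = 1")
  case True
  \<comment> \<open>The index is chosen so that \<open>x - real (Suc n)\<close> falls into the
    interval [1, 2) of starting points; in the negative case the ceiling leads into (0, 1].\<close>
  define n where "n = nat (\<lfloor>x\<rfloor> - 2)"
  have "2 \<le> \<lfloor>x\<rfloor>" using assms(2) True by (simp add: far_def le_floor_iff)
  then have n: "real n = of_int \<lfloor>x\<rfloor> - 2" by (simp add: n_def)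
  have "x - real (Suc n) \<in> ray_base \<epsilon>"
    using n of_int_floor_le[of x] real_of_int_floor_add_one_gt[of x] True
      dyadic_add_of_int[OF assms(3), of "- int (Suc n)"]
    by (auto simp: ray_base_def far_def algebra_simps)
  then show ?thesis by (rule that[of _ n]) (simp add: ray_def True)
next
  case False
  define n where "n = nat (- \<lceil>x\<rceil>)"
  have "\<lceil>x\<rceil> \<le> 0" using assms(1,2) False by (auto simp: far_def ceiling_le_iff)
  then have n: "real n = - of_int \<lceil>x\<rceil>" by (simp add: n_def)
  have "x + real (Suc n) \<in> ray_base \<epsilon>"
    using n le_of_int_ceiling[of x] ceiling_correct[of x] False assms(1)
      dyadic_add_of_int[OF assms(3), of "int (Suc n)"]
    by (auto simp: ray_base_def far_def algebra_simps)
  then show ?thesis by (rule that[of _ n]) (use assms(1) False in \<open>auto simp: ray_def\<close>)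
qed

section \<open>The ends of the rays are isolated\<close>

definition ray_tail :: "real \<Rightarrow> real \<Rightarrow> real set" where
  "ray_tail \<epsilon> s = range (\<lambda>n. ray \<epsilon> s (Suc n))"

text \<open>In the far region a vertex is adjacent only to its two neighbours on the ray and
  possibly to itself. The tail leaves out the point with index 0, and deleting this single vertex
  cuts the tail off.\<close>

lemma ray_tail_is_component:
  assumes "\<epsilon> \<in> {-1, 1}" "s \<in> ray_base \<epsilon>"
  shows "ray_tail \<epsilon> s \<in> graph_components schreier_edges (dyadic - {ray \<epsilon> s 0})"
proof -
  have s: "s \<in> dyadic" using assms(2) by (simp add: ray_base_def)
  have ne: "ray \<epsilon> s (Suc n) \<noteq> ray \<epsilon> s 0" for n using assms(1) by (auto simp: ray_def)
  obtain C where C: "C \<in> graph_components schreier_edges (dyadic - {ray \<epsilon> s 0})"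
    "\<And>n. ray \<epsilon> s (Suc n) \<in> C"
    using path_tail_component[of 0 "\<lambda>n. ray \<epsilon> s (Suc n)" "dyadic - {ray \<epsilon> s 0}" schreier_edges]
      ray_dyadic[OF assms(1) s] ray_edge[OF assms(1) s] ne by auto
  have "C \<subseteq> ray_tail \<epsilon> s"
  proof
    fix y assume "y \<in> C"
    then have "(ray \<epsilon> s (Suc 0), y) \<in> (schreier_edges \<inter> C \<times> C)\<^sup>*"
      by (rule graph_component_connected[OF sym_schreier_edges C(1) C(2)])
    then show "y \<in> ray_tail \<epsilon> s"
    proof (induction rule: rtrancl_induct)
      case (step y z)
      then obtain n where n: "y = ray \<epsilon> s (Suc n)" by (auto simp: ray_tail_def)
      have "z \<noteq> ray \<epsilon> s 0" using step graph_component_subset[OF C(1)] by auto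
      moreover have "z = y + \<epsilon> \<or> z = y - \<epsilon> \<or> z = y"
        using far_neighbour[OF assms(1)] far_ray[OF assms] step n by blast
      ultimately consider "z = ray \<epsilon> s (Suc (Suc n))" | "z = ray \<epsilon> s n" "n \<noteq> 0" | "z = y"
        by (cases n) (auto simp: n ray_def algebra_simps)
      then show ?case
      proof cases
        case 2
        then obtain m where "n = Suc m" by (cases n) auto
        with 2 show ?thesis by (simp add: ray_tail_def)
      qed (use step in \<open>auto simp: ray_tail_def\<close>)
    qed (auto simp: ray_tail_def)
  qed
  then have "C = ray_tail \<epsilon> s" using C(2) by (auto simp: ray_tail_def)
  with C(1) show ?thesis by simp
qed

text \<open>Being injective, \<open>r\<close> visits any initial segment of \<open>q\<close> only
  finitely often, so it ends up in the component that contains the tail of \<open>q\<close>.\<close>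

lemma ray_equiv_subrange:
  assumes "sym E" "r \<in> rays E V" "q \<in> rays E V" "\<forall>\<^sub>F n in sequentially. r n \<in> range q"
  shows "(r, q) \<in> ray_equiv E V"
proof -
  have "\<exists>D\<in>graph_components E (V - K). (\<forall>\<^sub>F n in sequentially. r n \<in> D) \<and> (\<forall>\<^sub>F n in sequentially. q n \<in> D)"
    if K: "finite K" for K
  proof -
    obtain D where D: "D \<in> graph_components E (V - K)" "\<forall>\<^sub>F n in sequentially. q n \<in> D"
      using ray_tail_component[OF assms(3) K] by blast
    then obtain N where N: "\<And>n. n \<ge> N \<Longrightarrow> q n \<in> D" by (auto simp: eventually_sequentially)
    have "\<forall>\<^sub>F n in sequentially. r n \<notin> q ` {..<N}"
      by (rule ray_leaves_finite[OF assms(2)]) simp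
    with assms(4) have "\<forall>\<^sub>F n in sequentially. r n \<in> D"
    proof eventually_elim
      case (elim n)
      then obtain m where "r n = q m" by auto
      with elim(2) N[of m] show ?case by (cases "m < N") auto
    qed
    with D show ?thesis by blast
  qed
  with assms show ?thesis by (auto simp: ray_equiv_def)
qed

definition ray_ends :: "real \<Rightarrow> real graph_end set" where
  "ray_ends \<epsilon> = (\<lambda>s. end_of schreier_edges dyadic (ray \<epsilon> s)) ` ray_base \<epsilon>"

text \<open>Each end of a ray is thus an isolated point of the end space, and convergence to it
  means that the sequence finally stays in the tail.\<close>

lemma ends_in_ray_tail:
  assumes "\<epsilon> \<in> {-1, 1}" "s \<in> ray_base \<epsilon>"
  shows "ends_in schreier_edges dyadic (ray_tail \<epsilon> s) = {end_of schreier_edges dyadic (ray \<epsilon> s)}"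
proof -
  have s: "s \<in> dyadic" using assms(2) by (simp add: ray_base_def)
  note iff = end_of_in_ends_in[OF sym_schreier_edges _ _ ray_tail_is_component[OF assms], simplified]
  have "e = end_of schreier_edges dyadic (ray \<epsilon> s)"
    if e: "e \<in> ends_in schreier_edges dyadic (ray_tail \<epsilon> s)" for e
  proof -
    have "e \<in> Gamma_ends" using e by (simp add: ends_in_def)
    then obtain r where r: "r \<in> rays schreier_edges dyadic" "e = end_of schreier_edges dyadic r"
      by (rule endsE)
    then have "\<forall>\<^sub>F n in sequentially. r n \<in> ray_tail \<epsilon> s" using e iff by blast
    then have "\<forall>\<^sub>F n in sequentially. r n \<in> range (ray \<epsilon> s)"
      by eventually_elim (auto simp: ray_tail_def)
    then have "(r, ray \<epsilon> s) \<in> ray_equiv schreier_edges dyadic"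
      by (rule ray_equiv_subrange[OF sym_schreier_edges r(1) ray_in_rays[OF assms(1) s]])
    then show ?thesis unfolding r(2) by (rule end_of_eqI[OF sym_schreier_edges])
  qed
  moreover have "end_of schreier_edges dyadic (ray \<epsilon> s) \<in> ends_in schreier_edges dyadic (ray_tail \<epsilon> s)"
  proof -
    have "\<forall>\<^sub>F n in sequentially. ray \<epsilon> s n \<in> ray_tail \<epsilon> s"
    proof (rule eventually_sequentiallyI[of 1])
      fix n :: nat assume "1 \<le> n"
      then obtain m where "n = Suc m" by (cases n) auto
      then show "ray \<epsilon> s n \<in> ray_tail \<epsilon> s" by (simp add: ray_tail_def)
    qed
    then show ?thesis using iff[OF ray_in_rays[OF assms(1) s]] by blast
  qed
  ultimately show ?thesis by blast
qed

lemma ray_ends_eq: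
  assumes "\<epsilon> \<in> {-1, 1}"
  shows "ray_ends \<epsilon> = {e \<in> Gamma_ends. \<exists>s\<in>ray_base \<epsilon>. ray \<epsilon> s \<in> e}"
proof -
  have "end_of schreier_edges dyadic (ray \<epsilon> s) \<in> Gamma_ends"
    "ray \<epsilon> s \<in> end_of schreier_edges dyadic (ray \<epsilon> s)" if "s \<in> ray_base \<epsilon>" for s
    using ray_in_rays[OF assms, of s] that
    by (auto simp: ray_base_def intro: end_of_in_ends ray_in_end_of[OF sym_schreier_edges])
  moreover have "e = end_of schreier_edges dyadic (ray \<epsilon> s)" if "e \<in> Gamma_ends" "ray \<epsilon> s \<in> e" for e s
    using end_eq_end_of(1)[OF sym_schreier_edges that] .
  ultimately show ?thesis unfolding ray_ends_def by blast
qed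

lemma negative_ends_eq: "negative_ends = ray_ends (-1)"
proof -
  have "dyadic \<inter> {0<..1} = ray_base (-1)" by (auto simp: ray_base_def far_def)
  moreover have "ray (-1) s = (\<lambda>n. s - 1 - real n)" for s by (auto simp: ray_def)
  ultimately show ?thesis by (simp add: negative_ends_def ray_ends_eq)
qed

lemma positive_ends_eq: "positive_ends = ray_ends 1"
proof -
  have "dyadic \<inter> {1..<2} = ray_base 1" by (auto simp: ray_base_def far_def)
  moreover have "ray 1 s = (\<lambda>n. s + 1 + real n)" for s by (auto simp: ray_def)
  ultimately show ?thesis by (simp add: positive_ends_def ray_ends_eq)
qed

text \<open>A single outward step in the far region decides everything: by injectivity the path can
  neither turn back nor stay, so it continues outwards forever.\<close>

lemma outgoing_ray:
  assumes e: "\<epsilon> \<in> {-1, 1}" and r: "r \<in> rays schreier_edges dyadic"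
    and m: "far \<epsilon> (r m)" "r (Suc m) = r m + \<epsilon>"
  shows "end_of schreier_edges dyadic r \<in> ray_ends \<epsilon>"
proof -
  have r': "inj r" "r n \<in> dyadic" "(r n, r (Suc n)) \<in> schreier_edges" for n
    using r by (auto simp: rays_def)
  obtain s k where s: "s \<in> ray_base \<epsilon>" "r m = ray \<epsilon> s k" using far_on_ray[OF e m(1) r'(2)] .
  have "r (m + n) = ray \<epsilon> s (k + n) \<and> r (Suc (m + n)) = ray \<epsilon> s (Suc (k + n))" for n
  proof (induction n)
    case 0
    then show ?case using m s by (simp add: ray_def algebra_simps)
  next
    case (Suc n)
    have "far \<epsilon> (r (Suc (m + n)))" using Suc far_ray[OF e s(1)] by simp
    then have "r (Suc (Suc (m + n))) = r (Suc (m + n)) + \<epsilon> \<or> r (Suc (Suc (m + n))) = r (Suc (m + n)) - \<epsilon> \<or>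
        r (Suc (Suc (m + n))) = r (Suc (m + n))"
      using far_neighbour[OF e _ r'(3)] by blast
    moreover have "r (Suc (m + n)) - \<epsilon> = r (m + n)" using Suc by (simp add: ray_def algebra_simps)
    ultimately have "r (Suc (Suc (m + n))) = r (Suc (m + n)) + \<epsilon>"
      using injD[OF r'(1), of "Suc (Suc (m + n))" "m + n"]
        injD[OF r'(1), of "Suc (Suc (m + n))" "Suc (m + n)"] by auto
    then show ?case using Suc by (simp add: ray_def algebra_simps)
  qed
  then have "r n \<in> range (ray \<epsilon> s)" if "n \<ge> m" for n
    using that by (metis le_add_diff_inverse rangeI)
  then have "\<forall>\<^sub>F n in sequentially. r n \<in> range (ray \<epsilon> s)" by (auto simp: eventually_sequentially)
  then have "(r, ray \<epsilon> s) \<in> ray_equiv schreier_edges dyadic"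
    using s(1) by (intro ray_equiv_subrange[OF sym_schreier_edges r ray_in_rays[OF e]]) (auto simp: ray_base_def)
  then show ?thesis using end_of_eqI[OF sym_schreier_edges] s(1) by (auto simp: ray_ends_def)
qed

text \<open>Without outward steps every step in the far region goes inwards by one. The far region
  is left after finitely many steps, and the first point outside it lies in the vertex set of the
  skeleton.\<close>

lemma incoming_ray:
  assumes e: "\<epsilon> \<in> {-1, 1}" and r: "r \<in> rays schreier_edges dyadic"
    and m: "\<And>m. far \<epsilon> (r m) \<Longrightarrow> r (Suc m) \<noteq> r m + \<epsilon>" and 0: "far \<epsilon> (r 0)"
  shows "\<exists>n. 0 < r n \<and> r n < 2"
proof -
  have r': "inj r" "(r n, r (Suc n)) \<in> schreier_edges" for n
    using r by (auto simp: rays_def)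
  have step: "r (Suc n) = r n - \<epsilon>" if "far \<epsilon> (r n)" for n
    using far_neighbour[OF e that r'(2)] m[OF that] injD[OF r'(1), of "Suc n" n] by auto
  have "\<exists>n. \<not> far \<epsilon> (r n)"
  proof (rule ccontr)
    assume "\<nexists>n. \<not> far \<epsilon> (r n)"
    then have far: "far \<epsilon> (r n)" for n by auto
    have rn: "r n = r 0 - \<epsilon> * real n" for n
      by (induction n) (auto simp: step[OF far] algebra_simps)
    obtain n where "\<bar>r 0\<bar> < real n" using reals_Archimedean2 by blast
    then show False using far[of n] rn[of n] e by (auto simp: far_def)
  qed
  define n where "n = (LEAST n. \<not> far \<epsilon> (r n))"
  have n: "\<not> far \<epsilon> (r n)" using \<open>\<exists>n. \<not> far \<epsilon> (r n)\<close> unfolding n_def by (rule LeastI_ex)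
  then obtain k where k: "n = Suc k" using 0 by (cases n) auto
  then have "far \<epsilon> (r k)" using not_less_Least[of k "\<lambda>n. \<not> far \<epsilon> (r n)"] by (auto simp: n_def)
  then show ?thesis using step[of k] n k e by (intro exI[of _ n]) (auto simp: far_def)
qed

text \<open>Outward steps in a far region are excluded by the assumption on the end. After entering
  the skeleton the path cannot leave it: a step into a far region would have to be followed by an
  outward step, a loop or a return, and injectivity forbids the last two.\<close>

lemma ray_dichotomy:
  assumes r: "r \<in> rays schreier_edges dyadic"
    and e: "end_of schreier_edges dyadic r \<notin> ray_ends (-1) \<union> ray_ends 1"
  shows "\<exists>m. \<forall>n\<ge>m. 0 < r n \<and> r n < 2"
proof -
  have r': "inj r" "(r n, r (Suc n)) \<in> schreier_edges" for n
    using r by (auto simp: rays_def)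
  have out: "r (Suc m) \<noteq> r m + \<epsilon>" if "\<epsilon> \<in> {-1, 1}" "far \<epsilon> (r m)" for \<epsilon> m
    using outgoing_ray[OF that(1) r that(2)] e that(1) by auto
  have "\<exists>n. 0 < r n \<and> r n < 2"
  proof (cases "far (-1) (r 0) \<or> far 1 (r 0)")
    case True
    then obtain \<epsilon> :: real where E: "\<epsilon> \<in> {-1, 1}" "far \<epsilon> (r 0)" by auto
    show ?thesis by (rule incoming_ray[OF E(1) r out[OF E(1)] E(2)])
  qed (intro exI[of _ 0], auto simp: far_def)
  then obtain m where m: "0 < r m" "r m < 2" by blast
  have "0 < r n \<and> r n < 2" if "n \<ge> m" for n
    using that
  proof (induction rule: dec_induct)
    case (step n)
    have "\<not> far \<epsilon> (r (Suc n))" if E: "\<epsilon> \<in> {-1, 1}" for \<epsilon>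
    proof
      assume far: "far \<epsilon> (r (Suc n))"
      then have *: "r (Suc n) = r n + \<epsilon>" using far_entrance[OF E _ _ r'(2)] step by blast
      have "r (Suc (Suc n)) = r (Suc n) - \<epsilon> \<or> r (Suc (Suc n)) = r (Suc n)"
        using far_neighbour[OF E far r'(2)] out[OF E far] by auto
      then show False
        using * injD[OF r'(1), of "Suc (Suc n)" n] injD[OF r'(1), of "Suc (Suc n)" "Suc n"] by auto
    qed
    from this[of "-1"] this[of 1] show ?case by (auto simp: far_def)
  qed (use m in auto)
  then show ?thesis by blast
qed

section \<open>The ends of the skeleton\<close>

lemma rays_mono: "V \<subseteq> W \<Longrightarrow> rays E V \<subseteq> rays E W"
  by (auto simp: rays_def)

text \<open>A component of the smaller graph lies in one of the larger graph, so rays that cannot be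
  separated in the subgraph cannot be separated in the whole graph. A class of rays of the skeleton
  therefore lies in one end of the whole graph.\<close>

lemma ray_equiv_mono:
  assumes "sym E" "V \<subseteq> W"
  shows "ray_equiv E V \<subseteq> ray_equiv E W"
proof clarify
  fix r q assume rq: "(r, q) \<in> ray_equiv E V"
  have "\<exists>D\<in>graph_components E (W - K). (\<forall>\<^sub>F n in sequentially. r n \<in> D) \<and> (\<forall>\<^sub>F n in sequentially. q n \<in> D)"
    if K: "finite K" for K
  proof -
    obtain C where C: "C \<in> graph_components E (V - K)" "\<forall>\<^sub>F n in sequentially. r n \<in> C"
      "\<forall>\<^sub>F n in sequentially. q n \<in> C" using rq K by (auto simp: ray_equiv_def)
    from C(1) obtain x where x: "x \<in> V - K" "x \<in> C" by (auto elim!: graph_componentsD)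
    then obtain D where D: "D \<in> graph_components E (W - K)" "x \<in> D"
      using ex_graph_component[of x "W - K" E] assms(2) by blast
    have "C \<subseteq> D"
      by (rule graph_component_mono[OF assms(1) C(1) D(1) _ x(2) D(2)]) (use assms(2) in auto)
    then have "\<forall>\<^sub>F n in sequentially. r n \<in> D" "\<forall>\<^sub>F n in sequentially. q n \<in> D"
      using C(2,3) by (auto elim: eventually_mono)
    with D(1) show ?thesis by blast
  qed
  with rq rays_mono[OF assms(2)] show "(r, q) \<in> ray_equiv E W" by (auto simp: ray_equiv_def)
qed

text \<open>A ray inside (0, 2) never meets the tail of a ray outside it. Conversely, when the end
  is not that of such a ray, any representative stays in (0, 2) after finitely many steps, and
  dropping these steps does not change its end.\<close>

lemma skeleton_ends_eq: "skeleton_ends = Gamma_ends - (ray_ends (-1) \<union> ray_ends 1)"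
proof (intro equalityI subsetI)
  fix e assume e: "e \<in> skeleton_ends"
  then have "e \<in> Gamma_ends" by (simp add: skeleton_ends_def)
  obtain r where r: "r \<in> rays schreier_edges (dyadic \<inter> {0<..<2})" "r \<in> e"
    using e ray_in_end_of[OF sym_schreier_edges] by (auto simp: skeleton_ends_def elim!: endsE)
  have "e \<notin> ray_ends \<epsilon>" if E: "\<epsilon> \<in> {-1, 1}" for \<epsilon>
  proof
    assume "e \<in> ray_ends \<epsilon>"
    then obtain s where s: "s \<in> ray_base \<epsilon>" "e \<in> ends_in schreier_edges dyadic (ray_tail \<epsilon> s)"
      using ends_in_ray_tail[OF E] by (auto simp: ray_ends_def)
    then have "\<forall>\<^sub>F n in sequentially. r n \<in> ray_tail \<epsilon> s" using r(2) by (simp add: ends_in_def)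
    then obtain n where "r n \<in> ray_tail \<epsilon> s" by (auto simp: eventually_sequentially)
    then have "far \<epsilon> (r n)" using far_ray[OF E s(1)] by (auto simp: ray_tail_def)
    moreover have "0 < r n" "r n < 2" using r(1) by (auto simp: rays_def)
    ultimately show False using E by (auto simp: far_def)
  qed
  from this[of "-1"] this[of 1] \<open>e \<in> Gamma_ends\<close>
  show "e \<in> Gamma_ends - (ray_ends (-1) \<union> ray_ends 1)" by auto
next
  fix e assume "e \<in> Gamma_ends - (ray_ends (-1) \<union> ray_ends 1)"
  then have e: "e \<in> Gamma_ends" "e \<notin> ray_ends (-1)" "e \<notin> ray_ends 1" by auto
  from e(1) obtain r where r: "r \<in> rays schreier_edges dyadic" "e = end_of schreier_edges dyadic r"
    by (rule endsE)
  then obtain m where m: "\<And>n. n \<ge> m \<Longrightarrow> 0 < r n \<and> r n < 2" using ray_dichotomy[of r] e by auto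
  define q where "q n = r (n + m)" for n
  have "inj r" using r(1) by (simp add: rays_def)
  then have "inj q" by (intro injI) (simp add: q_def inj_eq)
  then have q: "q \<in> rays schreier_edges (dyadic \<inter> {0<..<2})"
    using r(1) m by (auto simp: rays_def q_def)
  then have q': "q \<in> rays schreier_edges dyadic" using rays_mono[of "dyadic \<inter> {0<..<2}" dyadic] by auto
  have "(q, r) \<in> ray_equiv schreier_edges dyadic"
    by (rule ray_equiv_subrange[OF sym_schreier_edges q' r(1)]) (simp add: q_def)
  then have "e = end_of schreier_edges dyadic q"
    unfolding r(2) using end_of_eqI[OF sym_schreier_edges] by blast
  then have "end_of schreier_edges (dyadic \<inter> {0<..<2}) q \<subseteq> e"
    using ray_equiv_mono[OF sym_schreier_edges, of "dyadic \<inter> {0<..<2}" dyadic] by (auto simp: end_of_def)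
  with e(1) end_of_in_ends[OF q] show "e \<in> skeleton_ends" by (auto simp: skeleton_ends_def)
qed

lemma openin_ray_ends:
  assumes "\<epsilon> \<in> {-1, 1}"
  shows "openin (end_space schreier_edges dyadic) (ray_ends \<epsilon>)"
proof -
  have "ray_ends \<epsilon> = (\<Union>s\<in>ray_base \<epsilon>. ends_in schreier_edges dyadic (ray_tail \<epsilon> s))"
    using ends_in_ray_tail[OF assms] by (auto simp: ray_ends_def)
  then show ?thesis
    using openin_end_space_ends_in[OF _ ray_tail_is_component[OF assms]] by auto
qed

lemma sets_ray_ends: "\<epsilon> \<in> {-1, 1} \<Longrightarrow> ray_ends \<epsilon> \<in> sets Gamma_end_borel"
  by (intro openin_sets_borel_of openin_ray_ends)

lemma space_Gamma_end_borel: "space Gamma_end_borel = Gamma_ends"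
  by (simp add: space_borel_of topspace_end_space[OF sym_schreier_edges])

lemma sets_skeleton_ends: "skeleton_ends \<in> sets Gamma_end_borel"
  unfolding skeleton_ends_eq space_Gamma_end_borel[symmetric]
  by (intro sets.compl_sets sets.Un sets_ray_ends) auto

lemma tends_to_ray_end:
  assumes "\<epsilon> \<in> {-1, 1}" "tends_to_Gamma_end x e" "s \<in> ray_base \<epsilon>"
  shows "e = end_of schreier_edges dyadic (ray \<epsilon> s) \<longleftrightarrow> (\<forall>\<^sub>F n in sequentially. x n \<in> ray_tail \<epsilon> s)"
  using tends_to_end_ends_in[OF sym_schreier_edges assms(2) _ ray_tail_is_component[OF assms(1,3)]]
    ends_in_ray_tail[OF assms(1,3)] by auto

section \<open>Finitely supported functions\<close>

definition supp :: "('a \<Rightarrow> real) \<Rightarrow> 'a set" where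
  "supp f = {x. f x \<noteq> 0}"

text \<open>Summing over the support makes this the usual norm on finitely supported functions
  without any summability condition; for infinite support the value is the default 0.\<close>

definition l2 :: "('a \<Rightarrow> real) \<Rightarrow> real" where
  "l2 f = L2_set f (supp f)"

lemma l2_nonneg: "0 \<le> l2 f"
  by (simp add: l2_def)

lemma l2_eq:
  assumes "finite A" "supp f \<subseteq> A"
  shows "l2 f = L2_set f A"
  unfolding l2_def L2_set_def
  using assms by (intro arg_cong[of _ _ sqrt] sum.mono_neutral_left) (auto simp: supp_def)

lemma l2_power2:
  assumes "finite A" "supp f \<subseteq> A"
  shows "(l2 f)\<^sup>2 = (\<Sum>x\<in>A. (f x)\<^sup>2)"
  by (simp add: l2_eq[OF assms] L2_set_def sum_nonneg)

lemma sum_power2_le_l2: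
  assumes "finite A" "finite (supp f)"
  shows "(\<Sum>x\<in>A. (f x)\<^sup>2) \<le> (l2 f)\<^sup>2"
  using l2_power2[of "A \<union> supp f" f] assms by (auto intro!: sum_mono2)

lemma abs_le_l2:
  assumes "finite (supp f)"
  shows "\<bar>f x\<bar> \<le> l2 f"
  using sum_power2_le_l2[of "{x}" f] assms l2_nonneg[of f] by (simp add: abs_le_square_iff[symmetric])

lemma finite_supp_diff:
  assumes "finite (supp f)" "finite (supp g)"
  shows "finite (supp (\<lambda>x. f x - g x))"
  by (rule finite_subset[of _ "supp f \<union> supp g"]) (use assms in \<open>auto simp: supp_def\<close>)

lemma l2_triangle:
  assumes "finite (supp f)" "finite (supp g)"
  shows "l2 (\<lambda>x. f x + g x) \<le> l2 f + l2 g"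
proof -
  let ?A = "supp f \<union> supp g"
  have A: "finite ?A" using assms by simp
  have "supp (\<lambda>x. f x + g x) \<subseteq> ?A" by (auto simp: supp_def)
  then show ?thesis
    using L2_set_triangle_ineq[of f g ?A] by (simp add: l2_eq[OF A])
qed

lemma supp_comp: "supp (\<lambda>x. f (g x)) = g -` supp f"
  by (auto simp: supp_def)

lemma finite_supp_comp: "bij g \<Longrightarrow> finite (supp f) \<Longrightarrow> finite (supp (\<lambda>x. f (g x)))"
  by (simp add: supp_comp finite_vimageI bij_is_inj)

lemma sum_vimage_bij:
  assumes "bij g"
  shows "(\<Sum>x\<in>g -` A. f (g x)) = (\<Sum>x\<in>A. f x)"
proof (rule sum.reindex_bij_betw)
  show "bij_betw g (g -` A) A"
    using assms by (auto simp: bij_betw_def inj_on_def bij_def surj_image_vimage_eq)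
qed

lemma l2_comp:
  assumes "bij g"
  shows "l2 (\<lambda>x. f (g x)) = l2 f"
  unfolding l2_def supp_comp L2_set_def sum_vimage_bij[OF assms, of "\<lambda>x. (f x)\<^sup>2"] ..

definition defect :: "('a \<Rightarrow> real) \<Rightarrow> ('a \<Rightarrow> 'a) \<Rightarrow> real" where
  "defect f g = l2 (\<lambda>x. f x - f (g x))"

lemma finite_supp_defect:
  "bij g \<Longrightarrow> finite (supp f) \<Longrightarrow> finite (supp (\<lambda>x. f x - f (g x)))"
  by (rule finite_supp_diff[OF _ finite_supp_comp])

text \<open>Here invariance of the counting measure enters: a bijection preserves the sum of
  squares, so the two square terms of the expanded difference agree.\<close>

lemma defect_power2:
  assumes g: "bij g" and A: "finite A" "supp f \<subseteq> A"
  shows "(defect f g)\<^sup>2 = 2 * (\<Sum>x\<in>A. (f x)\<^sup>2) - 2 * (\<Sum>x\<in>A. f x * f (g x))"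
proof -
  let ?B = "A \<union> g -` A"
  have B: "finite ?B" using A g by (simp add: finite_vimageI bij_is_inj)
  have z: "f x = 0" if "x \<notin> A" for x using that A(2) by (auto simp: supp_def)
  have "supp (\<lambda>x. f x - f (g x)) \<subseteq> ?B"
    using z by (fastforce simp: supp_def)
  then have "(defect f g)\<^sup>2 = (\<Sum>x\<in>?B. (f x - f (g x))\<^sup>2)"
    unfolding defect_def by (rule l2_power2[OF B])
  also have "\<dots> = (\<Sum>x\<in>?B. (f x)\<^sup>2) + (\<Sum>x\<in>?B. (f (g x))\<^sup>2) - 2 * (\<Sum>x\<in>?B. f x * f (g x))"
    by (simp add: power2_diff sum.distrib sum_subtractf sum_distrib_left mult.assoc)
  also have "(\<Sum>x\<in>?B. (f x)\<^sup>2) = (\<Sum>x\<in>A. (f x)\<^sup>2)"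
    using B z by (intro sum.mono_neutral_right) auto
  also have "(\<Sum>x\<in>?B. f x * f (g x)) = (\<Sum>x\<in>A. f x * f (g x))"
    using B z by (intro sum.mono_neutral_right) auto
  also have "(\<Sum>x\<in>?B. (f (g x))\<^sup>2) = (\<Sum>x\<in>g -` A. (f (g x))\<^sup>2)"
    using B z by (intro sum.mono_neutral_right) auto
  also have "\<dots> = (\<Sum>x\<in>A. (f x)\<^sup>2)" by (rule sum_vimage_bij[OF g])
  finally show ?thesis by simp
qed

text \<open>The function f - f \<circ> h \<circ> g is the sum of f - f \<circ> g and (f - f \<circ>
  h) \<circ> g, and composition with a bijection preserves the norm.\<close>

lemma defect_comp:
  assumes "bij g" "bij h" "finite (supp f)"
  shows "defect f (h \<circ> g) \<le> defect f g + defect f h"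
proof -
  have "defect f (h \<circ> g) = l2 (\<lambda>x. (f x - f (g x)) + (f (g x) - f (h (g x))))"
    by (simp add: defect_def)
  also have "\<dots> \<le> l2 (\<lambda>x. f x - f (g x)) + l2 (\<lambda>x. f (g x) - f (h (g x)))"
    using finite_supp_defect[OF assms(1,3)] finite_supp_comp[OF assms(1) finite_supp_defect[OF assms(2,3)]]
    by (rule l2_triangle)
  also have "l2 (\<lambda>x. f (g x) - f (h (g x))) = defect f h"
    using l2_comp[OF assms(1), of "\<lambda>x. f x - f (h x)"] by (simp add: defect_def)
  finally show ?thesis by (simp add: defect_def)
qed

lemma abs_diff_le_defect:
  assumes "bij g" "finite (supp f)"
  shows "\<bar>f x - f (g x)\<bar> \<le> defect f g"
  unfolding defect_def
  by (rule abs_le_l2[where f = "\<lambda>x. f x - f (g x)", OF finite_supp_defect[OF assms]])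

section \<open>Transience of the binary tree\<close>

lemma bij_thompson_F: "g \<in> carrier thompson_F \<Longrightarrow> bij g"
  by (rule bijI[OF inj_thompson_F]) (auto intro!: surjI inv_thompson_F_apply(2))

definition level_mean :: "(real \<Rightarrow> real) \<Rightarrow> nat \<Rightarrow> real" where
  "level_mean f n = (\<Sum>k<2 ^ n. f (tree_point n k)) / 2 ^ n"

text \<open>The Cauchy-Schwarz inequality against the constant 1 on the \<open>2 ^ n\<close>
  distinct points of a level.\<close>

lemma level_sum_le:
  assumes "finite (supp f)"
  shows "\<bar>\<Sum>k<2 ^ n. f (tree_point n k)\<bar> \<le> sqrt (2 ^ n) * l2 f"
proof -
  have "(\<Sum>k<2 ^ n. \<bar>1\<bar> * \<bar>f (tree_point n k)\<bar>) \<le>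
      L2_set (\<lambda>_. 1) {..<2 ^ n :: nat} * L2_set (\<lambda>k. f (tree_point n k)) {..<2 ^ n}"
    by (rule L2_set_mult_ineq)
  also have "L2_set (\<lambda>_. 1) {..<2 ^ n :: nat} = sqrt (2 ^ n)"
    by (simp add: L2_set_def)
  also have "L2_set (\<lambda>k. f (tree_point n k)) {..<2 ^ n} \<le> l2 f"
  proof -
    have "(\<Sum>k<2 ^ n. (f (tree_point n k))\<^sup>2) = (\<Sum>x\<in>tree_point n ` {..<2 ^ n}. (f x)\<^sup>2)"
      by (simp add: sum.reindex[OF inj_on_subset[OF inj_tree_point subset_UNIV]])
    also have "\<dots> \<le> (l2 f)\<^sup>2" by (rule sum_power2_le_l2) (use assms in auto)
    finally show ?thesis unfolding L2_set_def by (intro real_le_lsqrt l2_nonneg)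
  qed
  finally have "(\<Sum>k<2 ^ n. \<bar>f (tree_point n k)\<bar>) \<le> sqrt (2 ^ n) * l2 f"
    by (simp add: mult_left_mono)
  then show ?thesis using sum_abs[of "\<lambda>k. f (tree_point n k)" "{..<2 ^ n}"] by linarith
qed

lemma sum_lessThan_double:
  fixes f :: "nat \<Rightarrow> real"
  shows "(\<Sum>k<2 * m. f k) = (\<Sum>k<m. f k) + (\<Sum>k<m. f (k + m))"
proof -
  have "(\<Sum>k<2 * m. f k) = (\<Sum>k=0..<m. f k) + (\<Sum>k=m..<2 * m. f k)"
    by (simp add: sum.atLeastLessThan_concat lessThan_atLeast0)
  also have "(\<Sum>k=m..<2 * m. f k) = (\<Sum>k=0..<m. f (k + m))"
    using sum.shift_bounds_nat_ivl[of f 0 m m] by (simp add: mult_2)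
  finally show ?thesis by (simp add: lessThan_atLeast0)
qed

lemma sqrt_2_power: "sqrt (2 ^ n) / 2 ^ n = (1 / sqrt 2) ^ n"
proof -
  have "sqrt (2 ^ n) / 2 ^ n = sqrt (2 ^ n) / (sqrt (2 ^ n) * sqrt (2 ^ n))"
    by (subst real_sqrt_mult_self) simp
  also have "\<dots> = 1 / sqrt (2 ^ n)" by (simp del: real_sqrt_mult_self)
  also have "\<dots> = (1 / sqrt 2) ^ n" by (simp add: power_one_over real_sqrt_power)
  finally show ?thesis .
qed

text \<open>Passing from a level to its children averages f - f \<circ> g along the edges given by
  \<open>gen_B\<close> and \<open>upper_half\<close>. The level sum is of order
  \<open>sqrt (2 ^ n)\<close>, the normalisation \<open>2 ^ Suc n\<close>; exponential growth of the
  tree thus yields a geometric factor.\<close>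

lemma level_mean_diff:
  assumes "finite (supp f)"
  shows "\<bar>level_mean f n - level_mean f (Suc n)\<bar> \<le>
    (1 / sqrt 2) ^ n * ((defect f gen_B + defect f upper_half) / 2)"
proof -
  let ?a = "\<lambda>x. f x - f (gen_B x)" and ?b = "\<lambda>x. f x - f (upper_half x)"
  have fin: "finite (supp ?a)" "finite (supp ?b)"
    by (rule finite_supp_defect[OF bij_thompson_F[OF gens_in_carrier(2)] assms]
        finite_supp_defect[OF bij_thompson_F[OF upper_half_in_carrier] assms])+
  have "(\<Sum>k<2 ^ Suc n. f (tree_point (Suc n) k)) =
      (\<Sum>k<2 ^ n. f (gen_B (tree_point n k))) + (\<Sum>k<2 ^ n. f (upper_half (tree_point n k)))"
    by (simp add: sum_lessThan_double tree_point_Suc)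
  then have "level_mean f n - level_mean f (Suc n) =
      ((\<Sum>k<2 ^ n. ?a (tree_point n k)) + (\<Sum>k<2 ^ n. ?b (tree_point n k))) / 2 ^ Suc n"
    by (simp add: level_mean_def sum_subtractf field_simps)
  also have "\<bar>\<dots>\<bar> \<le> (sqrt (2 ^ n) * l2 ?a + sqrt (2 ^ n) * l2 ?b) / 2 ^ Suc n"
    using level_sum_le[OF fin(1), of n] level_sum_le[OF fin(2), of n]
    by (simp add: divide_right_mono)
  also have "\<dots> = sqrt (2 ^ n) / 2 ^ n * ((defect f gen_B + defect f upper_half) / 2)"
    by (simp add: defect_def field_simps)
  also have "sqrt (2 ^ n) / 2 ^ n = (1 / sqrt 2) ^ n" by (rule sqrt_2_power)
  finally show ?thesis .
qed

text \<open>The value at the root is the mean over level 0. The level means tend to 0, since the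
  norm is finite, and their differences are summable; \<open>1 / (1 - 1 / sqrt 2) / 2\<close> is the
  geometric series times the factor 1/2 of the averaging.\<close>

lemma root_le_defects:
  "\<exists>K>0. \<forall>f. finite (supp f) \<longrightarrow> \<bar>f 1\<bar> \<le> K * (defect f gen_B + defect f upper_half)"
proof (intro exI[of _ "1 / (1 - 1 / sqrt 2) / 2"] conjI allI impI)
  let ?q = "1 / sqrt 2 :: real"
  have "0 \<le> ?q" by simp
  moreover have "?q < 1" by (subst divide_less_eq_1_pos) auto
  ultimately have q: "0 \<le> ?q" "?q < 1" .
  show "0 < 1 / (1 - ?q) / 2"
    using q by (intro divide_pos_pos zero_less_one zero_less_numeral) linarith
  fix f :: "real \<Rightarrow> real" assume f: "finite (supp f)"
  let ?L = "(defect f gen_B + defect f upper_half) / 2"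
  have L: "0 \<le> ?L" by (simp add: defect_def l2_nonneg)
  have geo: "(\<Sum>i<n. ?q ^ i) \<le> 1 / (1 - ?q)" for n
    using q by (simp add: sum_gp_strict divide_right_mono)
  have tele: "\<bar>level_mean f 0 - level_mean f n\<bar> \<le> (\<Sum>i<n. ?q ^ i) * ?L" for n
  proof (induction n)
    case (Suc n)
    moreover have "(\<Sum>i<Suc n. ?q ^ i) * ?L = (\<Sum>i<n. ?q ^ i) * ?L + ?q ^ n * ?L"
      by (simp only: sum.lessThan_Suc distrib_right)
    ultimately show ?case using level_mean_diff[OF f, of n] by linarith
  qed simp
  have mean: "\<bar>level_mean f n\<bar> \<le> l2 f * ?q ^ n" for n
  proof -
    have "\<bar>level_mean f n\<bar> \<le> sqrt (2 ^ n) * l2 f / 2 ^ n"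
      using level_sum_le[OF f, of n] by (simp add: level_mean_def divide_right_mono)
    also have "\<dots> = l2 f * ?q ^ n"
      unfolding sqrt_2_power[symmetric] by (simp add: mult.commute)
    finally show ?thesis .
  qed
  have "\<bar>f 1\<bar> \<le> l2 f * ?q ^ n + 1 / (1 - ?q) * ?L" for n
  proof -
    have "level_mean f 0 = f 1" by (simp add: level_mean_def tree_point_def)
    then have "\<bar>f 1\<bar> \<le> \<bar>level_mean f n\<bar> + \<bar>level_mean f 0 - level_mean f n\<bar>" by simp
    also have "\<dots> \<le> l2 f * ?q ^ n + 1 / (1 - ?q) * ?L"
      using mean[of n] tele[of n] mult_right_mono[OF geo L, of n] by linarith
    finally show ?thesis .
  qed
  moreover have "(\<lambda>n. l2 f * ?q ^ n + 1 / (1 - ?q) * ?L) \<longlonglongrightarrow> l2 f * 0 + 1 / (1 - ?q) * ?L"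
    using q by (intro tendsto_intros LIMSEQ_power_zero) auto
  ultimately have "\<bar>f 1\<bar> \<le> l2 f * 0 + 1 / (1 - ?q) * ?L"
    by (intro LIMSEQ_le_const) auto
  then show "\<bar>f 1\<bar> \<le> 1 / (1 - ?q) / 2 * (defect f gen_B + defect f upper_half)" by simp
qed

section \<open>The Markov chain\<close>

text \<open>The update \<open>H\<close> is a parameter because two chains occur: the walk itself and
  the walk stopped outside a window.\<close>

primrec chain :: "('a \<Rightarrow> 'g \<Rightarrow> 'a) \<Rightarrow> 'g pmf \<Rightarrow> 'a \<Rightarrow> nat \<Rightarrow> 'a pmf" where
  "chain H \<mu> x 0 = return_pmf x"
| "chain H \<mu> x (Suc n) = bind_pmf (chain H \<mu> x n) (\<lambda>z. map_pmf (H z) \<mu>)"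

lemma finite_set_chain: "finite (set_pmf \<mu>) \<Longrightarrow> finite (set_pmf (chain H \<mu> x n))"
  by (induction n) auto

lemma set_chain_subset:
  assumes "x \<in> S" "\<And>z g. z \<in> S \<Longrightarrow> g \<in> set_pmf \<mu> \<Longrightarrow> H z g \<in> S"
  shows "set_pmf (chain H \<mu> x n) \<subseteq> S"
  using assms by (induction n) auto

lemma chain_add: "chain H \<mu> x (m + n) = bind_pmf (chain H \<mu> x m) (\<lambda>z. chain H \<mu> z n)"
  by (induction n) (simp_all add: bind_return_pmf' bind_assoc_pmf)

lemma expectation_finite:
  fixes f :: "'a \<Rightarrow> real"
  assumes "finite A" "set_pmf p \<subseteq> A"
  shows "measure_pmf.expectation p f = (\<Sum>x\<in>A. pmf p x * f x)"
  using integral_measure_pmf[of A p f] assms by (auto simp: set_pmf_iff mult.commute subset_eq)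

lemma expectation_chain_add:
  fixes f :: "'a \<Rightarrow> real"
  assumes "finite (set_pmf \<mu>)"
  shows "measure_pmf.expectation (chain H \<mu> x (m + n)) f =
    measure_pmf.expectation (chain H \<mu> x m) (\<lambda>z. measure_pmf.expectation (chain H \<mu> z n) f)"
  unfolding chain_add
  by (simp add: pmf_expectation_bind[OF finite_set_chain[OF assms] finite_set_chain[OF assms] order_refl]
      expectation_finite[OF finite_set_chain[OF assms, of H x m] order_refl])

lemma expectation_chain_Suc:
  fixes f :: "'a \<Rightarrow> real"
  assumes "finite (set_pmf \<mu>)"
  shows "measure_pmf.expectation (chain H \<mu> x (Suc n)) f =
    measure_pmf.expectation (chain H \<mu> x n) (\<lambda>z. measure_pmf.expectation \<mu> (\<lambda>g. f (H z g)))"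
  using expectation_chain_add[OF assms, of H x n 1 f] by (simp add: bind_return_pmf)

abbreviation walk_law :: "(real \<Rightarrow> real) pmf \<Rightarrow> real \<Rightarrow> nat \<Rightarrow> real pmf" where
  "walk_law \<equiv> chain (\<lambda>z g. g z)"

definition green :: "(real \<Rightarrow> real) pmf \<Rightarrow> real \<Rightarrow> nat \<Rightarrow> real \<Rightarrow> real" where
  "green \<mu> x n y = (\<Sum>k\<le>n. pmf (walk_law \<mu> x k) y)"

lemma finite_supp_green:
  assumes "finite (set_pmf \<mu>)"
  shows "finite (supp (green \<mu> x n))"
proof (rule finite_subset)
  show "supp (green \<mu> x n) \<subseteq> (\<Union>k\<le>n. set_pmf (walk_law \<mu> x k))"
  proof
    fix y assume "y \<in> supp (green \<mu> x n)"
    then have "(\<Sum>k\<le>n. pmf (walk_law \<mu> x k) y) \<noteq> 0" by (simp add: supp_def green_def)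
    then show "y \<in> (\<Union>k\<le>n. set_pmf (walk_law \<mu> x k))"
      by (rule sum.not_neutral_contains_not_neutral) (auto simp: set_pmf_iff)
  qed
qed (simp add: finite_set_chain[OF assms])

lemma green_nonneg: "0 \<le> green \<mu> x n y"
  by (simp add: green_def sum_nonneg)

text \<open>The counting measure is invariant under the walk. Hence the symmetric part of \<open>I - P\<close> is a
  Dirichlet form, and pairing \<open>(I - P\<^sup>*) green = \<delta>\<^sub>x - pmf (walk_law (Suc n))\<close> with \<open>green\<close> bounds
  the energy of \<open>green\<close> by its value at \<open>x\<close>.\<close>

lemma green_energy:
  assumes fin: "finite (set_pmf \<mu>)" and bij: "\<And>g. g \<in> set_pmf \<mu> \<Longrightarrow> bij g"
  shows "(\<Sum>g\<in>set_pmf \<mu>. pmf \<mu> g * (defect (green \<mu> x n) g)\<^sup>2) \<le> 2 * green \<mu> x n x"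
proof -
  define U where "U = green \<mu> x n"
  \<comment> \<open>The bound is \<open>Suc n\<close>, not \<open>n\<close>: pushing the summands
    one step forward reaches the law at time \<open>Suc n\<close>.\<close>
  define A where "A = (\<Union>k\<le>Suc n. set_pmf (walk_law \<mu> x k))"
  have A: "finite A" by (simp add: A_def finite_set_chain[OF fin])
  have setA: "set_pmf (walk_law \<mu> x k) \<subseteq> A" if "k \<le> Suc n" for k
    using that by (auto simp: A_def)
  have "supp U \<subseteq> A"
  proof
    fix y assume "y \<in> supp U"
    then have "(\<Sum>k\<le>n. pmf (walk_law \<mu> x k) y) \<noteq> 0" by (simp add: supp_def U_def green_def)
    then obtain k where "k \<le> n" "pmf (walk_law \<mu> x k) y \<noteq> 0"
      by (rule sum.not_neutral_contains_not_neutral) auto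
    then show "y \<in> A" using setA[of k] by (auto simp: set_pmf_iff)
  qed
  have xA: "x \<in> A" using setA[of 0] by simp
  have "(\<Sum>y\<in>A. U y * (\<Sum>g\<in>set_pmf \<mu>. pmf \<mu> g * U (g y))) =
      (\<Sum>k\<le>n. \<Sum>y\<in>A. pmf (walk_law \<mu> x k) y * (\<Sum>g\<in>set_pmf \<mu>. pmf \<mu> g * U (g y)))"
    by (subst sum.swap) (simp add: U_def green_def sum_distrib_right)
  also have "\<dots> = (\<Sum>k\<le>n. \<Sum>y\<in>A. pmf (walk_law \<mu> x (Suc k)) y * U y)"
  proof (rule sum.cong[OF refl])
    fix k assume "k \<in> {..n}"
    then have "set_pmf (walk_law \<mu> x k) \<subseteq> A" "set_pmf (walk_law \<mu> x (Suc k)) \<subseteq> A"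
      using setA[of k] setA[of "Suc k"] by auto
    then show "(\<Sum>y\<in>A. pmf (walk_law \<mu> x k) y * (\<Sum>g\<in>set_pmf \<mu>. pmf \<mu> g * U (g y))) =
        (\<Sum>y\<in>A. pmf (walk_law \<mu> x (Suc k)) y * U y)"
      using expectation_chain_Suc[OF fin, of "\<lambda>z g. g z" x k U]
      by (simp only: expectation_finite[OF A] expectation_finite[OF fin order_refl])
  qed
  also have "\<dots> = (\<Sum>y\<in>A. (\<Sum>k\<le>n. pmf (walk_law \<mu> x (Suc k)) y) * U y)"
    by (subst sum.swap) (simp only: sum_distrib_right)
  also have "\<dots> \<ge> (\<Sum>y\<in>A. (U y - indicator {x} y) * U y)"
  proof (intro sum_mono mult_right_mono)
    fix y
    have "(\<Sum>k\<le>n. pmf (walk_law \<mu> x (Suc k)) y) =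
        (\<Sum>k\<le>Suc n. pmf (walk_law \<mu> x k) y) - pmf (walk_law \<mu> x 0) y"
      by (simp only: sum.atMost_Suc_shift)
    also have "\<dots> = U y - indicator {x} y + pmf (walk_law \<mu> x (Suc n)) y"
      by (simp add: U_def green_def indicator_def)
    finally show "U y - indicator {x} y \<le> (\<Sum>k\<le>n. pmf (walk_law \<mu> x (Suc k)) y)" by simp
  qed (simp add: U_def green_nonneg)
  also have "(\<Sum>y\<in>A. (U y - indicator {x} y) * U y) = (\<Sum>y\<in>A. (U y)\<^sup>2) - U x"
    using A xA by (simp add: left_diff_distrib sum_subtractf power2_eq_square indicator_def
        if_distrib[of "\<lambda>c. c * _"] cong: if_cong)
  finally have *: "(\<Sum>y\<in>A. (U y)\<^sup>2) - (\<Sum>y\<in>A. U y * (\<Sum>g\<in>set_pmf \<mu>. pmf \<mu> g * U (g y))) \<le> U x"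
    by simp
  have "(\<Sum>g\<in>set_pmf \<mu>. pmf \<mu> g * (defect U g)\<^sup>2) =
      (\<Sum>g\<in>set_pmf \<mu>. pmf \<mu> g * (2 * (\<Sum>y\<in>A. (U y)\<^sup>2)) - 2 * (\<Sum>y\<in>A. U y * (pmf \<mu> g * U (g y))))"
    by (intro sum.cong refl)
       (simp add: defect_power2[OF bij A \<open>supp U \<subseteq> A\<close>] right_diff_distrib sum_distrib_left mult_ac)
  also have "\<dots> = 2 * (\<Sum>y\<in>A. (U y)\<^sup>2) - 2 * (\<Sum>g\<in>set_pmf \<mu>. \<Sum>y\<in>A. U y * (pmf \<mu> g * U (g y)))"
    by (simp add: sum_subtractf sum_distrib_right[symmetric] sum_pmf_eq_1[OF fin order_refl]
        sum_distrib_left[symmetric])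
  also have "(\<Sum>g\<in>set_pmf \<mu>. \<Sum>y\<in>A. U y * (pmf \<mu> g * U (g y))) =
      (\<Sum>y\<in>A. U y * (\<Sum>g\<in>set_pmf \<mu>. pmf \<mu> g * U (g y)))"
    by (subst sum.swap) (simp add: sum_distrib_left)
  finally show ?thesis using * by (simp add: U_def)
qed

lemma semigroup_span_induct [consumes 1, case_names incl mult]:
  assumes "x \<in> semigroup_span G S"
    and "\<And>s. s \<in> S \<Longrightarrow> P s"
    and "\<And>x y. P x \<Longrightarrow> P y \<Longrightarrow> P (x \<otimes>\<^bsub>G\<^esub> y)"
  shows "P x"
proof -
  have "semigroup_span G S \<subseteq> {x. P x}"
    unfolding semigroup_span_def by (rule Inter_lower) (use assms(2,3) in auto)
  then show ?thesis using assms(1) by auto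
qed

text \<open>For an increment the energy bound is divided by its weight; products follow from
  subadditivity of the defect. The point is that the constant does not depend on the truncation
  \<open>n\<close>.\<close>

lemma green_defect:
  assumes \<mu>: "set_pmf \<mu> \<subseteq> carrier thompson_F" "finite (set_pmf \<mu>)" "strictly_nondegenerate thompson_F \<mu>"
    and "g \<in> carrier thompson_F"
  shows "\<exists>C\<ge>0. \<forall>n. defect (green \<mu> x n) g \<le> C * sqrt (green \<mu> x n x)"
proof -
  have bij: "bij g" if "g \<in> set_pmf \<mu>" for g using that \<mu>(1) bij_thompson_F by auto
  have "g \<in> semigroup_span thompson_F (set_pmf \<mu>)"
    using assms(3,4) by (simp add: strictly_nondegenerate_def)
  then have "bij g \<and> (\<exists>C\<ge>0. \<forall>n. defect (green \<mu> x n) g \<le> C * sqrt (green \<mu> x n x))"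
  proof (induction g rule: semigroup_span_induct)
    case (incl g)
    have pos: "0 < pmf \<mu> g" using incl by (simp add: pmf_positive)
    have "defect (green \<mu> x n) g \<le> sqrt (2 / pmf \<mu> g) * sqrt (green \<mu> x n x)" for n
    proof -
      have "pmf \<mu> g * (defect (green \<mu> x n) g)\<^sup>2 \<le>
          (\<Sum>g\<in>set_pmf \<mu>. pmf \<mu> g * (defect (green \<mu> x n) g)\<^sup>2)"
        by (rule member_le_sum) (use incl \<mu>(2) in auto)
      also have "\<dots> \<le> 2 * green \<mu> x n x" by (rule green_energy[OF \<mu>(2) bij])
      finally have "(defect (green \<mu> x n) g)\<^sup>2 \<le> 2 / pmf \<mu> g * green \<mu> x n x"
        using pos by (simp add: field_simps)
      then show ?thesis
        unfolding real_sqrt_mult[symmetric] by (rule real_le_rsqrt)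
    qed
    then show ?case using bij[OF incl] pos by (intro conjI exI[of _ "sqrt (2 / pmf \<mu> g)"]) auto
  next
    case (mult g h)
    then obtain C D where CD: "C \<ge> 0" "D \<ge> 0"
      "\<And>n. defect (green \<mu> x n) g \<le> C * sqrt (green \<mu> x n x)"
      "\<And>n. defect (green \<mu> x n) h \<le> D * sqrt (green \<mu> x n x)" by blast
    have "defect (green \<mu> x n) (h \<circ> g) \<le> (C + D) * sqrt (green \<mu> x n x)" for n
      using defect_comp[of g h "green \<mu> x n"] mult finite_supp_green[OF \<mu>(2)] CD(3)[of n] CD(4)[of n]
      by (simp add: distrib_right)
    moreover have "bij (h \<circ> g)" using mult by (intro bij_comp) auto
    ultimately show ?case
      unfolding mult_thompson_F using CD(1,2) by (intro conjI exI[of _ "C + D"] allI add_nonneg_nonneg)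
  qed
  then show ?thesis by blast
qed

text \<open>The value at any dyadic point differs from the one at the root by at most a defect, and
  the root is controlled by two further defects, so all values are of order
  \<open>sqrt (green \<mu> x n x)\<close>. Applied at \<open>x\<close> itself this bounds
  \<open>green \<mu> x n x\<close>, and then the value at \<open>y\<close>, uniformly in
  \<open>n\<close>.\<close>

theorem walk_transient:
  assumes \<mu>: "set_pmf \<mu> \<subseteq> carrier thompson_F" "finite (set_pmf \<mu>)" "strictly_nondegenerate thompson_F \<mu>"
    and "x \<in> dyadic" "y \<in> dyadic"
  shows "summable (\<lambda>n. pmf (walk_law \<mu> x n) y)"
proof -
  obtain K where K: "0 < K"
    "\<And>f. finite (supp f) \<Longrightarrow> \<bar>f 1\<bar> \<le> K * (defect f gen_B + defect f upper_half)"
    using root_le_defects by blast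
  have bound: "\<exists>C\<ge>0. \<forall>n. green \<mu> x n z \<le> C * sqrt (green \<mu> x n x)" if "z \<in> dyadic" for z
  proof -
    obtain g where g: "g \<in> carrier thompson_F" "g 1 = z" using thompson_F_transitive[OF \<open>z \<in> dyadic\<close>] by blast
    obtain C where C: "C \<ge> 0" "\<And>n. defect (green \<mu> x n) g \<le> C * sqrt (green \<mu> x n x)"
      using green_defect[OF \<mu> g(1)] by blast
    obtain D where D: "D \<ge> 0" "\<And>n. defect (green \<mu> x n) gen_B \<le> D * sqrt (green \<mu> x n x)"
      using green_defect[OF \<mu> gens_in_carrier(2)] by blast
    obtain E where E: "E \<ge> 0" "\<And>n. defect (green \<mu> x n) upper_half \<le> E * sqrt (green \<mu> x n x)"
      using green_defect[OF \<mu> upper_half_in_carrier] by blast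
    have "green \<mu> x n z \<le> (K * (D + E) + C) * sqrt (green \<mu> x n x)" for n
    proof -
      note fin = finite_supp_green[OF \<mu>(2), of x n]
      have "green \<mu> x n z \<le> \<bar>green \<mu> x n 1\<bar> + \<bar>green \<mu> x n 1 - green \<mu> x n (g 1)\<bar>"
        using g(2) by simp
      also have "\<dots> \<le> K * (defect (green \<mu> x n) gen_B + defect (green \<mu> x n) upper_half)
          + defect (green \<mu> x n) g"
        by (intro add_mono K(2) abs_diff_le_defect bij_thompson_F g(1) fin)
      also have "\<dots> \<le> K * (D * sqrt (green \<mu> x n x) + E * sqrt (green \<mu> x n x)) + C * sqrt (green \<mu> x n x)"
        using K(1) by (intro add_mono mult_left_mono C D E) auto
      finally show ?thesis by (simp add: algebra_simps)
    qed
    then show ?thesis using K(1) C(1) D(1) E(1) by (intro exI[of _ "K * (D + E) + C"]) auto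
  qed
  obtain C where C: "C \<ge> 0" "\<And>n. green \<mu> x n x \<le> C * sqrt (green \<mu> x n x)"
    using bound[OF assms(4)] by blast
  obtain D where D: "D \<ge> 0" "\<And>n. green \<mu> x n y \<le> D * sqrt (green \<mu> x n x)"
    using bound[OF assms(5)] by blast
  have "sqrt (green \<mu> x n x) \<le> C" for n
  proof (cases "green \<mu> x n x = 0")
    case False
    then have "0 < sqrt (green \<mu> x n x)" using green_nonneg[of \<mu> x n x] by simp
    moreover have "sqrt (green \<mu> x n x) * sqrt (green \<mu> x n x) \<le> C * sqrt (green \<mu> x n x)"
      using C(2)[of n] green_nonneg[of \<mu> x n x] by simp
    ultimately show ?thesis by (simp only: mult_le_cancel_right) 
  qed (use C(1) in simp)
  then have "green \<mu> x n y \<le> D * C" for n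
    using D(2)[of n] mult_left_mono[OF _ D(1)] order_trans by blast
  then show ?thesis
    by (intro bounded_imp_summable[of _ "D * C"]) (auto simp: green_def)
qed

section \<open>Drift along the rays\<close>

text \<open>Close to infinity every group element is a translation, and translation lengths add
  under composition. \<open>c\<close> measures them outwards, so that a positive value means moving
  away from the skeleton.\<close>

lemma germ_translation:
  fixes c :: "(real \<Rightarrow> real) \<Rightarrow> real"
  assumes \<epsilon>: "\<epsilon> \<in> {-1, 1}" and g: "g \<in> carrier thompson_F"
    and hom: "\<And>f g. f \<in> carrier thompson_F \<Longrightarrow> g \<in> carrier thompson_F \<Longrightarrow> c (g \<circ> f) = c f + c g"
    and cA: "c gen_A = - \<epsilon>" and cB: "c gen_B = - (1 + \<epsilon>) / 2"
  shows "\<exists>N. \<forall>x. N \<le> \<epsilon> * x \<longrightarrow> g x = x + \<epsilon> * c g"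
proof -
  have id: "id \<in> carrier thompson_F"
    using monoid.one_closed[OF group.is_monoid[OF group_thompson_F]] by (simp add: one_thompson_F)
  have c_id: "c id = 0" using hom[OF id id] by simp
  have "gen_A \<circ> (\<lambda>x. x + 1) = id" "gen_B \<circ> gen_B_inv = id"
    by (auto simp: gen_A_def gen_B_inverse)
  then have "c (\<lambda>x. x + 1) + c gen_A = 0" "c gen_B_inv + c gen_B = 0"
    using hom[OF succ_in_carrier gens_in_carrier(1)] hom[OF gen_B_inv_in_carrier gens_in_carrier(2)]
    by (simp_all add: c_id)
  then have inv: "c (\<lambda>x. x + 1) = \<epsilon>" "c gen_B_inv = (1 + \<epsilon>) / 2"
    unfolding cA cB by linarith+
  have sq: "\<epsilon> * \<epsilon> = 1" using \<epsilon> by auto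
  from g show ?thesis
  proof (induction g rule: thompson_F_induct)
    case (mult f g)
    then obtain N N' where N: "\<And>x. N \<le> \<epsilon> * x \<Longrightarrow> f x = x + \<epsilon> * c f"
      and N': "\<And>x. N' \<le> \<epsilon> * x \<Longrightarrow> g x = x + \<epsilon> * c g" by blast
    \<comment> \<open>The coordinate \<open>\<epsilon> * x\<close> increases by \<open>c f\<close>
      under \<open>f\<close>, and must then exceed the threshold \<open>N'\<close> of
      \<open>g\<close>.\<close>
    have "(g \<circ> f) x = x + \<epsilon> * c (g \<circ> f)" if x: "max N (N' - c f) \<le> \<epsilon> * x" for x
    proof -
      have f: "f x = x + \<epsilon> * c f" using x by (intro N) simp
      have "\<epsilon> * f x = \<epsilon> * x + c f" using sq by (simp add: f distrib_left mult.assoc[symmetric])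
      then have "g (f x) = f x + \<epsilon> * c g" using x by (intro N') simp
      then show ?thesis using f hom[OF mult.hyps] by (simp add: distrib_left)
    qed
    then show ?case by blast
  next
    case one
    show ?case unfolding c_id by simp
  next
    case A
    show ?case unfolding cA using sq by (simp add: gen_A_def)
  next
    case A_inv
    show ?case unfolding inv using sq by simp
  next
    case B
    show ?case unfolding cB using \<epsilon> by (intro exI[of _ 2]) (auto simp: gen_B_def)
  next
    case B_inv
    show ?case unfolding inv using \<epsilon> by (intro exI[of _ 2]) (auto simp: gen_B_inv_def)
  qed
qed

text \<open>The bound \<open>p\<close> is the probability of one fixed word in the increments that
  represents \<open>g\<close>, and is therefore the same for all starting points.\<close>

lemma walk_law_reaches:
  assumes "g \<in> semigroup_span thompson_F (set_pmf \<mu>)"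
  shows "\<exists>k p. 0 < p \<and> (\<forall>x. p \<le> pmf (walk_law \<mu> x k) (g x))"
  using assms
proof (induction g rule: semigroup_span_induct)
  case (incl g)
  have "pmf \<mu> g \<le> pmf (walk_law \<mu> x 1) (g x)" for x
  proof -
    have "pmf \<mu> g = measure_pmf.prob \<mu> {g}" by (simp add: measure_pmf_single)
    also have "\<dots> \<le> measure_pmf.prob \<mu> ((\<lambda>g. g x) -` {g x})"
      by (rule measure_pmf.finite_measure_mono) auto
    also have "\<dots> = pmf (walk_law \<mu> x 1) (g x)"
      by (simp add: pmf_map bind_return_pmf)
    finally show ?thesis .
  qed
  then show ?case using incl by (intro exI[of _ 1] exI[of _ "pmf \<mu> g"]) (auto simp: pmf_positive)
next
  case (mult f g)
  then obtain k p l q where p: "0 < p" "\<And>x. p \<le> pmf (walk_law \<mu> x k) (f x)"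
    and q: "0 < q" "\<And>x. q \<le> pmf (walk_law \<mu> x l) (g x)" by blast
  have "p * q \<le> pmf (walk_law \<mu> x (k + l)) (g (f x))" for x
  proof -
    have "p * q \<le> pmf (walk_law \<mu> x k) (f x) * pmf (walk_law \<mu> (f x) l) (g (f x))"
      using p q by (intro mult_mono) (auto intro: less_imp_le)
    also have "\<dots> = measure_pmf.expectation (walk_law \<mu> x k)
        (\<lambda>z. indicator {f x} z * pmf (walk_law \<mu> (f x) l) (g (f x)))"
      by (simp add: measure_pmf_single)
    also have "\<dots> \<le> measure_pmf.expectation (walk_law \<mu> x k) (\<lambda>z. pmf (walk_law \<mu> z l) (g (f x)))"
      by (intro integral_mono measure_pmf.integrable_const_bound[of _ 1])
         (auto simp: indicator_def pmf_le_1 mult_le_one)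
    also have "\<dots> = pmf (walk_law \<mu> x (k + l)) (g (f x))"
      by (simp add: chain_add pmf_bind)
    finally show ?thesis .
  qed
  then show ?case
    using p q by (intro exI[of _ "k + l"] exI[of _ "p * q"]) (auto simp: mult_thompson_F)
qed

section \<open>Superharmonic functions of the walk\<close>

lemma expectation_mono_finite:
  fixes f g :: "'a \<Rightarrow> real"
  assumes "finite (set_pmf p)" "\<And>x. x \<in> set_pmf p \<Longrightarrow> f x \<le> g x"
  shows "measure_pmf.expectation p f \<le> measure_pmf.expectation p g"
  unfolding expectation_finite[OF assms(1) order_refl]
  using assms(2) by (intro sum_mono mult_left_mono) auto

lemma expectation_superharmonic:
  fixes u :: "'a \<Rightarrow> real"
  assumes fin: "finite (set_pmf \<mu>)"
    and u: "\<And>z. z \<in> S \<Longrightarrow> measure_pmf.expectation \<mu> (\<lambda>g. u (H z g)) \<le> u z"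
    and S: "x \<in> S" "\<And>z g. z \<in> S \<Longrightarrow> g \<in> set_pmf \<mu> \<Longrightarrow> H z g \<in> S"
  shows "measure_pmf.expectation (chain H \<mu> x n) u \<le> u x"
proof (induction n)
  case (Suc n)
  have "measure_pmf.expectation (chain H \<mu> x (Suc n)) u \<le> measure_pmf.expectation (chain H \<mu> x n) u"
    unfolding expectation_chain_Suc[OF fin]
    using set_chain_subset[where H = H and n = n and \<mu> = \<mu> and S = S and x = x, OF S]
    by (intro expectation_mono_finite finite_set_chain[OF fin] u) auto
  with Suc show ?case by linarith
qed simp

text \<open>At t = 0 the Laplace transform equals 1, and its derivative is minus the drift, so it
  decreases for small positive t.\<close>

lemma exponential_moment:
  fixes c :: "'g \<Rightarrow> real"
  assumes fin: "finite (set_pmf \<mu>)" and drift: "0 < measure_pmf.expectation \<mu> c"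
  shows "\<exists>t>0. measure_pmf.expectation \<mu> (\<lambda>g. exp (- t * c g)) \<le> 1"
proof -
  define \<phi> where "\<phi> t = (\<Sum>g\<in>set_pmf \<mu>. pmf \<mu> g * exp (- t * c g))" for t
  have "(\<phi> has_real_derivative (\<Sum>g\<in>set_pmf \<mu>. pmf \<mu> g * (exp (- 0 * c g) * (- 1 * c g)))) (at 0)"
    unfolding \<phi>_def by (rule DERIV_sum) (auto intro!: derivative_eq_intros)
  moreover have "(\<Sum>g\<in>set_pmf \<mu>. pmf \<mu> g * (exp (- 0 * c g) * (- 1 * c g))) < 0"
    using drift by (simp add: expectation_finite[OF fin order_refl] sum_negf)
  ultimately obtain d where d: "d > 0" "\<And>t. 0 < t \<Longrightarrow> t < d \<Longrightarrow> \<phi> (0 + t) < \<phi> 0"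
    using DERIV_neg_dec_right by blast
  have "\<phi> 0 = 1" by (simp add: \<phi>_def sum_pmf_eq_1[OF fin order_refl])
  with d(2)[of "d / 2"] d(1) have "\<phi> (d / 2) \<le> 1" by simp
  then show ?thesis
    using d(1) by (intro exI[of _ "d / 2"]) (simp add: expectation_finite[OF fin order_refl] \<phi>_def)
qed

text \<open>The function \<open>u\<close> is superharmonic, and it drops by a definite amount in \<open>k\<close> steps on the window;
  so the expected number of visits to the window is finite.\<close>

lemma window_visits_summable:
  fixes c :: "(real \<Rightarrow> real) \<Rightarrow> real"
  assumes \<mu>: "set_pmf \<mu> \<subseteq> carrier thompson_F" "finite (set_pmf \<mu>)" "strictly_nondegenerate thompson_F \<mu>"
    and \<epsilon>: "\<epsilon> \<in> {-1, 1}"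
    and germ: "\<And>g x. g \<in> set_pmf \<mu> \<Longrightarrow> N \<le> \<epsilon> * x \<Longrightarrow> g x = x + \<epsilon> * c g"
    and drift: "0 < measure_pmf.expectation \<mu> c"
  shows "summable (\<lambda>n. measure_pmf.prob (walk_law \<mu> x n) {z. - R \<le> \<epsilon> * z \<and> \<epsilon> * z \<le> N})"
proof -
  have sq: "\<epsilon> * \<epsilon> = 1" using \<epsilon> by auto
  obtain t where t: "t > 0" "measure_pmf.expectation \<mu> (\<lambda>g. exp (- t * c g)) \<le> 1"
    using exponential_moment[OF \<mu>(2) drift] by blast
  \<comment> \<open>Beyond \<open>N\<close> the exponential is superharmonic by the choice of
    \<open>t\<close>. Truncation at 1 settles all other points, where nothing is known about the
    increments: there \<open>u\<close> attains its maximum.\<close>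
  define u where "u z = min 1 (exp (- t * (\<epsilon> * z - N)))" for z
  have u01: "0 \<le> u z" "u z \<le> 1" for z by (auto simp: u_def)
  have u_super: "measure_pmf.expectation \<mu> (\<lambda>g. u (g z)) \<le> u z" for z
  proof (cases "N \<le> \<epsilon> * z")
    case True
    have "measure_pmf.expectation \<mu> (\<lambda>g. u (g z)) \<le>
        measure_pmf.expectation \<mu> (\<lambda>g. exp (- t * (\<epsilon> * z - N)) * exp (- t * c g))"
    proof (rule expectation_mono_finite[OF \<mu>(2)])
      fix g assume "g \<in> set_pmf \<mu>"
      then have "\<epsilon> * g z = \<epsilon> * z + c g"
        using sq by (simp add: germ[OF _ True] distrib_left mult.assoc[symmetric])
      then show "u (g z) \<le> exp (- t * (\<epsilon> * z - N)) * exp (- t * c g)"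
        by (simp add: u_def exp_add[symmetric] algebra_simps min.coboundedI2)
    qed
    also have "\<dots> \<le> exp (- t * (\<epsilon> * z - N)) * 1"
      using t(2) by (simp del: mult_1_right)
    also have "\<dots> = u z" using True t(1) by (simp add: u_def)
    finally show ?thesis .
  next
    case False
    then have "u z = 1" using t(1) by (simp add: u_def mult_le_0_iff)
    then show ?thesis using expectation_mono_finite[OF \<mu>(2), of "\<lambda>g. u (g z)" "\<lambda>_. 1"] u01
      by simp
  qed
  have Pk: "measure_pmf.expectation (walk_law \<mu> z k) u \<le> u z" for z k
    by (rule expectation_superharmonic[OF \<mu>(2), of UNIV]) (auto simp: u_super)
  \<comment> \<open>A translation outwards by \<open>m\<close> carries every point of the window to
    distance at least 1 beyond \<open>N\<close>, where \<open>u\<close> is at most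
    \<open>exp (- t)\<close>.\<close>
  define m where "m = \<lceil>N + R + 1\<rceil>"
  have m: "N + R + 1 \<le> of_int m" unfolding m_def by (rule le_of_int_ceiling)
  define j where "j = (if \<epsilon> = 1 then m else - m)"
  have j: "real_of_int j = \<epsilon> * of_int m" using \<epsilon> by (auto simp: j_def)
  obtain k p where p: "0 < p" "\<And>z. p \<le> pmf (walk_law \<mu> z k) (z + real_of_int j)"
    using walk_law_reaches[of "\<lambda>x. x + real_of_int j" \<mu>] translation_in_carrier[of j] \<mu>(3)
    unfolding strictly_nondegenerate_def by blast
  define W where "W = {z. - R \<le> \<epsilon> * z \<and> \<epsilon> * z \<le> N}"
  define \<delta> where "\<delta> = p * (1 - exp (- t))"
  have \<delta>: "\<delta> > 0" using p t by (simp add: \<delta>_def)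
  have drop: "measure_pmf.expectation (walk_law \<mu> z k) u \<le> u z - \<delta> * indicator W z" for z
  proof (cases "z \<in> W")
    case True
    define y where "y = z + real_of_int j"
    have "\<epsilon> * y = \<epsilon> * z + of_int m" using sq by (simp add: y_def j distrib_left mult.assoc[symmetric])
    then have "1 \<le> \<epsilon> * y - N" using True m by (auto simp: W_def)
    then have "u y \<le> exp (- t)" using t(1) by (simp add: u_def min.coboundedI2)
    have "measure_pmf.expectation (walk_law \<mu> z k) u \<le>
        measure_pmf.expectation (walk_law \<mu> z k) (\<lambda>v. 1 - (1 - exp (- t)) * indicator {y} v)"
      by (rule expectation_mono_finite[OF finite_set_chain[OF \<mu>(2)]])
         (use u01 \<open>u y \<le> exp (- t)\<close> in \<open>auto simp: indicator_def\<close>)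
    also have "\<dots> = 1 - (1 - exp (- t)) * pmf (walk_law \<mu> z k) y"
      by (subst Bochner_Integration.integral_diff)
         (auto simp: integrable_measure_pmf_finite finite_set_chain[OF \<mu>(2)] measure_pmf_single)
    also have "\<dots> \<le> 1 - \<delta>"
      using mult_left_mono[OF p(2)[of z], of "1 - exp (- t)"] t(1) by (simp add: \<delta>_def y_def mult.commute)
    also have "u z = 1" using True t(1) by (simp add: u_def W_def mult_le_0_iff)
    ultimately show ?thesis using True by simp
  qed (simp add: Pk)
  define a where "a n = measure_pmf.expectation (walk_law \<mu> x n) u" for n
  define w where "w n = measure_pmf.prob (walk_law \<mu> x n) W" for n
  have a01: "0 \<le> a n" "a n \<le> 1" for n
    using expectation_mono_finite[OF finite_set_chain[OF \<mu>(2)], of "\<lambda>z g. g z" x n "\<lambda>_. 0" u]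
      expectation_mono_finite[OF finite_set_chain[OF \<mu>(2)], of "\<lambda>z g. g z" x n u "\<lambda>_. 1"] u01
    by (simp_all add: a_def)
  have step: "\<delta> * w n \<le> a n - a (n + k)" for n
  proof -
    have "a (n + k) \<le> measure_pmf.expectation (walk_law \<mu> x n) (\<lambda>z. u z - \<delta> * indicator W z)"
      unfolding a_def expectation_chain_add[OF \<mu>(2)]
      by (rule expectation_mono_finite[OF finite_set_chain[OF \<mu>(2)] drop])
    also have "\<dots> = a n - \<delta> * w n"
      unfolding a_def w_def
      by (subst Bochner_Integration.integral_diff)
         (auto simp: integrable_measure_pmf_finite finite_set_chain[OF \<mu>(2)])
    finally show ?thesis by simp
  qed
  \<comment> \<open>Differences over \<open>k\<close> steps telescope in blocks, which leaves only
    the first \<open>k\<close> values, each between 0 and 1.\<close>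
  have tele: "(\<Sum>n<J. a n - a (n + k)) = (\<Sum>n<k. a n) - (\<Sum>n<k. a (J + n))" for J
  proof (induction J)
    case (Suc J)
    have "(\<Sum>n<k. a (J + n)) - (\<Sum>n<k. a (Suc J + n)) = a J - a (J + k)"
      using sum_lessThan_telescope'[of "\<lambda>n. a (J + n)" k] by (simp add: sum_subtractf)
    with Suc show ?case by simp
  qed simp
  have "(\<Sum>n<J. w n) \<le> real k / \<delta>" for J
  proof -
    have "\<delta> * (\<Sum>n<J. w n) \<le> (\<Sum>n<J. a n - a (n + k))"
      unfolding sum_distrib_left by (intro sum_mono step)
    also have "\<dots> \<le> (\<Sum>n<k. a n)" by (simp add: tele sum_nonneg a01)
    also have "\<dots> \<le> real k" using sum_bounded_above[of "{..<k}" a 1] a01 by simp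
    finally show ?thesis using \<delta> by (simp add: pos_le_divide_eq mult.commute)
  qed
  moreover have "0 \<le> w n" for n by (simp add: w_def)
  ultimately have "summable w" using bounded_imp_summable[of w "real k / \<delta>"]
    by (metis lessThan_Suc_atMost)
  then show ?thesis by (simp add: w_def[abs_def] W_def)
qed

text \<open>The walk on a ray, stopped on leaving the window \<open>N \<le> \<epsilon> z < L\<close>: since \<open>\<epsilon> z\<close> has non-positive
  drift, the optional stopping inequality bounds the probability of leaving through \<open>L\<close>.\<close>

definition stopped :: "real \<Rightarrow> real \<Rightarrow> real \<Rightarrow> real \<Rightarrow> (real \<Rightarrow> real) \<Rightarrow> real" where
  "stopped \<epsilon> N L z g = (if N \<le> \<epsilon> * z \<and> \<epsilon> * z < L then g z else z)"

lemma stopped_exit: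
  fixes c :: "(real \<Rightarrow> real) \<Rightarrow> real"
  assumes fin: "finite (set_pmf \<mu>)"
    and \<epsilon>: "\<epsilon> \<in> {-1, 1}"
    and germ: "\<And>g x. g \<in> set_pmf \<mu> \<Longrightarrow> N \<le> \<epsilon> * x \<Longrightarrow> g x = x + \<epsilon> * c g"
    and drift: "measure_pmf.expectation \<mu> c \<le> 0"
    and D: "\<And>g. g \<in> set_pmf \<mu> \<Longrightarrow> \<bar>c g\<bar> \<le> D" "0 \<le> D"
    and x: "N \<le> \<epsilon> * x"
  shows "measure_pmf.prob (chain (stopped \<epsilon> N L) \<mu> x n) {z. L \<le> \<epsilon> * z} * (L - N + D) \<le> \<epsilon> * x - N + D"
proof -
  have sq: "\<epsilon> * \<epsilon> = 1" using \<epsilon> by auto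
  \<comment> \<open>A step from the window undershoots \<open>N\<close> by at most \<open>D\<close>;
    the shift by \<open>D\<close> keeps \<open>f\<close> non-negative along the stopped walk. Since
    \<open>f\<close> is at least \<open>L - N + D\<close> after an exit through \<open>L\<close>,
    Markov's inequality applies.\<close>
  define f where "f z = \<epsilon> * z - N + D" for z
  define S where "S = {z. 0 \<le> f z}"
  have gz: "\<epsilon> * g z = \<epsilon> * z + c g" if "g \<in> set_pmf \<mu>" "N \<le> \<epsilon> * z" for g z
    using sq by (simp add: germ[OF that] distrib_left mult.assoc[symmetric])
  have xS: "x \<in> S" using x D(2) by (simp add: S_def f_def)
  have S: "stopped \<epsilon> N L z g \<in> S" if "z \<in> S" "g \<in> set_pmf \<mu>" for z g
  proof (cases "N \<le> \<epsilon> * z \<and> \<epsilon> * z < L")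
    case True
    then show ?thesis using gz[OF that(2), of z] D(1)[OF that(2)]
      by (simp add: S_def f_def stopped_def abs_le_iff)
  qed (use that(1) in \<open>auto simp: stopped_def\<close>)
  have super: "measure_pmf.expectation \<mu> (\<lambda>g. f (stopped \<epsilon> N L z g)) \<le> f z" for z
  proof (cases "N \<le> \<epsilon> * z \<and> \<epsilon> * z < L")
    case True
    have "measure_pmf.expectation \<mu> (\<lambda>g. f (stopped \<epsilon> N L z g)) =
        (\<Sum>g\<in>set_pmf \<mu>. pmf \<mu> g * (f z + c g))"
      unfolding expectation_finite[OF fin order_refl]
      by (rule sum.cong) (use True in \<open>auto simp: stopped_def f_def gz\<close>)
    also have "\<dots> = f z + measure_pmf.expectation \<mu> c"
      by (simp add: expectation_finite[OF fin order_refl] distrib_left sum.distrib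
          sum_distrib_right[symmetric] sum_pmf_eq_1[OF fin order_refl])
    finally show ?thesis using drift by simp
  qed (auto simp: stopped_def)
  let ?p = "chain (stopped \<epsilon> N L) \<mu> x n"
  have finp: "finite (set_pmf ?p)" by (rule finite_set_chain[OF fin])
  have "measure_pmf.prob ?p {z. L \<le> \<epsilon> * z} * (L - N + D) =
      measure_pmf.expectation ?p (\<lambda>z. indicator {z. L \<le> \<epsilon> * z} z * (L - N + D))"
    by simp
  also have "\<dots> \<le> measure_pmf.expectation ?p f"
    using set_chain_subset[where H = "stopped \<epsilon> N L" and n = n, OF xS S]
    by (intro expectation_mono_finite[OF finp]) (auto simp: indicator_def S_def f_def)
  also have "\<dots> \<le> f x"
    by (rule expectation_superharmonic[OF fin super xS S])
  finally show ?thesis by (simp add: f_def)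
qed

section \<open>Random iteration\<close>

primrec iterate :: "('a \<Rightarrow> 'g \<Rightarrow> 'a) \<Rightarrow> 'a \<Rightarrow> (nat \<Rightarrow> 'g) \<Rightarrow> nat \<Rightarrow> 'a" where
  "iterate H z f 0 = z"
| "iterate H z f (Suc n) = H (iterate H z f n) (f n)"

lemma iterate_add: "iterate H z f (m + n) = iterate H (iterate H z f m) (\<lambda>i. f (m + i)) n"
  by (induction n) simp_all

lemma iterate_cong: "(\<And>i. i < n \<Longrightarrow> f i = g i) \<Longrightarrow> iterate H z f n = iterate H z g n"
  by (induction n) simp_all

lemma iterate_closed:
  assumes "z \<in> I" "\<And>z g. z \<in> I \<Longrightarrow> g \<in> C \<Longrightarrow> H z g \<in> I" "\<And>i. f i \<in> C"
  shows "iterate H z f n \<in> I"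
  using assms by (induction n) auto

lemma walk_eq_iterate: "walk thompson_F h n w \<gamma> = iterate (\<lambda>z g. g z) \<gamma> (\<lambda>i. h i w) n"
  by (induction n) (simp_all add: one_thompson_F mult_thompson_F)

text \<open>The state takes countably many values, so it suffices to check one step from each fixed
  state.\<close>

lemma iterate_measurable_PiM:
  assumes "countable I" "z \<in> I" "\<And>z g. z \<in> I \<Longrightarrow> g \<in> C \<Longrightarrow> H z g \<in> I" "k \<le> n"
  shows "(\<lambda>f. iterate H z (\<lambda>i. f (m + i)) k) \<in> Pi\<^sub>M {m..<m + n} (\<lambda>_. count_space C) \<rightarrow>\<^sub>M count_space I"
  using assms(4)
proof (induction k)
  case 0
  show ?case using assms(2) by simp
next
  case (Suc k)
  have "(\<lambda>f. H y (f (m + k))) \<in> Pi\<^sub>M {m..<m + n} (\<lambda>_. count_space C) \<rightarrow>\<^sub>M count_space I" if "y \<in> I" for y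
  proof (rule measurable_compose[of _ _ "count_space C"])
    show "(\<lambda>f. f (m + k)) \<in> Pi\<^sub>M {m..<m + n} (\<lambda>_. count_space C) \<rightarrow>\<^sub>M count_space C"
      using Suc.prems by (intro measurable_component_singleton) auto
  qed (use assms(3)[OF that] in auto)
  from measurable_compose_countable'[OF this Suc.IH assms(1)] Suc.prems
  show ?case by simp
qed

locale iid_sequence = prob_space M for M :: "'w measure" +
  fixes h :: "nat \<Rightarrow> 'w \<Rightarrow> 'g" and \<mu> :: "'g pmf" and C :: "'g set"
  assumes indep: "indep_vars (\<lambda>_. count_space C) h UNIV"
    and distr_h: "\<And>i. distr M (count_space UNIV) (h i) = measure_pmf \<mu>"
    and finite_supp: "finite (set_pmf \<mu>)"
    and supp_C: "set_pmf \<mu> \<subseteq> C"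
begin

lemma h_measurable: "h i \<in> M \<rightarrow>\<^sub>M count_space C"
  using indep by (auto simp: indep_vars_def)

lemma h_in_C: "w \<in> space M \<Longrightarrow> h i w \<in> C"
  using measurable_space[OF h_measurable] by auto

lemma h_sets: "{w \<in> space M. h i w \<in> B} \<in> sets M"
proof -
  have "h i -` (B \<inter> C) \<inter> space M \<in> sets M"
    by (rule measurable_sets[OF h_measurable]) auto
  also have "h i -` (B \<inter> C) \<inter> space M = {w \<in> space M. h i w \<in> B}" using h_in_C by auto
  finally show ?thesis .
qed

lemma h_prob: "prob {w \<in> space M. h i w \<in> B} = measure_pmf.prob \<mu> B"
proof -
  have "h i \<in> M \<rightarrow>\<^sub>M count_space UNIV"
    using measurable_compose[OF h_measurable, of "\<lambda>x. x" "count_space UNIV"] by simp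
  then have "measure (distr M (count_space UNIV) (h i)) B = prob (h i -` B \<inter> space M)"
    by (rule measure_distr) simp
  also have "h i -` B \<inter> space M = {w \<in> space M. h i w \<in> B}" by auto
  finally show ?thesis by (simp add: distr_h)
qed

lemma AE_h_supp: "AE w in M. \<forall>i. h i w \<in> set_pmf \<mu>"
proof (subst AE_all_countable, rule allI)
  fix i
  have "prob {w \<in> space M. h i w \<in> set_pmf \<mu>} = 1"
    by (simp add: h_prob measure_pmf.prob_eq_1 AE_measure_pmf_iff)
  then show "AE w in M. h i w \<in> set_pmf \<mu>"
    using prob_Collect_eq_1[OF h_sets[of i "set_pmf \<mu>"]] by simp
qed

context
  fixes I :: "'a set" and H :: "'a \<Rightarrow> 'g \<Rightarrow> 'a"
  assumes I: "countable I" and H: "\<And>z g. z \<in> I \<Longrightarrow> g \<in> C \<Longrightarrow> H z g \<in> I"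
begin

lemma iterate_restrict:
  "iterate H z (\<lambda>i. h (m + i) w) n =
    iterate H z (\<lambda>i. restrict (\<lambda>i. h i w) {m..<m + n} (m + i)) n"
  by (rule iterate_cong) simp

lemma iterate_measurable:
  assumes "z \<in> I"
  shows "(\<lambda>w. iterate H z (\<lambda>i. h (m + i) w) n) \<in> M \<rightarrow>\<^sub>M count_space I"
  unfolding iterate_restrict
proof (rule measurable_compose[OF _ iterate_measurable_PiM[OF I assms H order_refl]])
  show "(\<lambda>w. restrict (\<lambda>i. h i w) {m..<m + n}) \<in> M \<rightarrow>\<^sub>M Pi\<^sub>M {m..<m + n} (\<lambda>_. count_space C)"
    by (intro measurable_restrict h_measurable)
qed

lemma iterate_in_I: "z \<in> I \<Longrightarrow> w \<in> space M \<Longrightarrow> iterate H z (\<lambda>i. h (m + i) w) n \<in> I"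
  using measurable_space[OF iterate_measurable] by auto

lemma iterate_sets:
  assumes "z \<in> I"
  shows "{w \<in> space M. iterate H z (\<lambda>i. h (m + i) w) n \<in> A} \<in> sets M"
proof -
  have "(\<lambda>w. iterate H z (\<lambda>i. h (m + i) w) n) -` (A \<inter> I) \<inter> space M \<in> sets M"
    by (rule measurable_sets[OF iterate_measurable[OF assms]]) auto
  also have "(\<lambda>w. iterate H z (\<lambda>i. h (m + i) w) n) -` (A \<inter> I) \<inter> space M =
      {w \<in> space M. iterate H z (\<lambda>i. h (m + i) w) n \<in> A}"
    using iterate_in_I[OF assms] by auto
  finally show ?thesis .
qed

text \<open>The position depends only on the increments with indices in \<open>{m..<m + n}\<close>,
  a block disjoint from \<open>{m + n}\<close>.\<close>

lemma iterate_indep: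
  assumes "z \<in> I"
  shows "prob {w \<in> space M. iterate H z (\<lambda>i. h (m + i) w) n = y \<and> h (m + n) w \<in> B} =
    prob {w \<in> space M. iterate H z (\<lambda>i. h (m + i) w) n = y} * prob {w \<in> space M. h (m + n) w \<in> B}"
proof -
  let ?Z = "\<lambda>w. iterate H z (\<lambda>i. h (m + i) w) n"
  have "indep_var (Pi\<^sub>M {m..<m + n} (\<lambda>_. count_space C)) (\<lambda>w. restrict (\<lambda>i. h i w) {m..<m + n})
      (Pi\<^sub>M {m + n} (\<lambda>_. count_space C)) (\<lambda>w. restrict (\<lambda>i. h i w) {m + n})"
    by (rule indep_var_restrict[OF indep]) auto
  then have "indep_var (count_space UNIV)
      ((\<lambda>f. iterate H z (\<lambda>i. f (m + i)) n = y) \<circ> (\<lambda>w. restrict (\<lambda>i. h i w) {m..<m + n}))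
      (count_space UNIV) ((\<lambda>f. f (m + n) \<in> B) \<circ> (\<lambda>w. restrict (\<lambda>i. h i w) {m + n}))"
  proof (rule indep_var_compose)
    show "(\<lambda>f. iterate H z (\<lambda>i. f (m + i)) n = y) \<in> Pi\<^sub>M {m..<m + n} (\<lambda>_. count_space C) \<rightarrow>\<^sub>M count_space UNIV"
      by (rule measurable_compose[OF iterate_measurable_PiM[OF I assms H order_refl]]) simp_all
    show "(\<lambda>f. f (m + n) \<in> B) \<in> Pi\<^sub>M {m + n} (\<lambda>_. count_space C) \<rightarrow>\<^sub>M count_space UNIV"
      by (rule measurable_compose[of "\<lambda>f. f (m + n)" _ "count_space C"])
         (simp_all add: measurable_component_singleton)
  qed
  then have iv: "indep_var (count_space UNIV) (\<lambda>w. ?Z w = y) (count_space UNIV) (\<lambda>w. h (m + n) w \<in> B)"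
    unfolding o_def iterate_restrict[symmetric] by simp
  have "prob ((\<lambda>w. (?Z w = y, h (m + n) w \<in> B)) -` ({True} \<times> {True}) \<inter> space M) =
      prob ((\<lambda>w. ?Z w = y) -` {True} \<inter> space M) * prob ((\<lambda>w. h (m + n) w \<in> B) -` {True} \<inter> space M)"
    by (rule indep_varD[OF iv]) auto
  moreover have "(\<lambda>w. (?Z w = y, h (m + n) w \<in> B)) -` ({True} \<times> {True}) \<inter> space M =
      {w \<in> space M. ?Z w = y \<and> h (m + n) w \<in> B}"
    by auto
  moreover have "(\<lambda>w. ?Z w = y) -` {True} \<inter> space M = {w \<in> space M. ?Z w = y}" by auto
  moreover have "(\<lambda>w. h (m + n) w \<in> B) -` {True} \<inter> space M = {w \<in> space M. h (m + n) w \<in> B}"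
    by auto
  ultimately show ?thesis by simp
qed

text \<open>The bridge between sample paths and the chain, by conditioning on the penultimate
  position. The offset \<open>m\<close> allows a restart at any fixed time.\<close>

lemma iterate_prob:
  assumes z: "z \<in> I"
  shows "prob {w \<in> space M. iterate H z (\<lambda>i. h (m + i) w) n \<in> A} = measure_pmf.prob (chain H \<mu> z n) A"
proof (induction n arbitrary: A)
  case 0
  then show ?case using prob_space by (cases "z \<in> A") simp_all
next
  case (Suc n)
  let ?Z = "\<lambda>n w. iterate H z (\<lambda>i. h (m + i) w) n"
  let ?S = "set_pmf (chain H \<mu> z n)"
  have fin: "finite ?S" by (rule finite_set_chain[OF finite_supp])
  have SI: "?S \<subseteq> I" by (rule set_chain_subset[OF z]) (use H supp_C in auto)
  have sets: "{w \<in> space M. ?Z n w = y \<and> h (m + n) w \<in> B} \<in> sets M" for y B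
  proof -
    have "{w \<in> space M. ?Z n w \<in> {y}} \<inter> {w \<in> space M. h (m + n) w \<in> B} \<in> sets M"
      by (intro sets.Int iterate_sets z h_sets)
    also have "{w \<in> space M. ?Z n w \<in> {y}} \<inter> {w \<in> space M. h (m + n) w \<in> B} =
        {w \<in> space M. ?Z n w = y \<and> h (m + n) w \<in> B}" by auto
    finally show ?thesis .
  qed
  have sets': "{w \<in> space M. ?Z n w = y \<and> H y (h (m + n) w) \<in> A} \<in> sets M" for y
    using sets[of y "{g. H y g \<in> A}"] by simp
  have "AE w in M. ?Z n w \<in> ?S"
  proof -
    have "prob {w \<in> space M. ?Z n w \<in> ?S} = 1"
      by (simp only: Suc.IH) (simp add: measure_pmf.prob_eq_1 AE_measure_pmf_iff)
    then show ?thesis using prob_Collect_eq_1[OF iterate_sets[OF z, of m n ?S]] by simp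
  qed
  then have "prob {w \<in> space M. ?Z (Suc n) w \<in> A} =
      prob (\<Union>y\<in>?S. {w \<in> space M. ?Z n w = y \<and> h (m + n) w \<in> {g. H y g \<in> A}})"
    by (intro finite_measure_eq_AE iterate_sets z sets.finite_UN fin sets) auto
  also have "\<dots> = (\<Sum>y\<in>?S. prob {w \<in> space M. ?Z n w = y \<and> h (m + n) w \<in> {g. H y g \<in> A}})"
    by (rule finite_measure_finite_Union[OF fin]) (use sets' in \<open>auto simp: disjoint_family_on_def\<close>)
  also have "\<dots> = (\<Sum>y\<in>?S. pmf (chain H \<mu> z n) y * measure_pmf.prob \<mu> {g. H y g \<in> A})"
  proof (rule sum.cong[OF refl])
    fix y assume "y \<in> ?S"
    have "prob {w \<in> space M. ?Z n w = y} = pmf (chain H \<mu> z n) y"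
      using Suc.IH[of "{y}"] by (simp add: measure_pmf_single)
    then show "prob {w \<in> space M. ?Z n w = y \<and> h (m + n) w \<in> {g. H y g \<in> A}} =
        pmf (chain H \<mu> z n) y * measure_pmf.prob \<mu> {g. H y g \<in> A}"
      unfolding iterate_indep[OF z] h_prob by simp
  qed
  also have "\<dots> = measure_pmf.expectation (chain H \<mu> z n)
      (\<lambda>y. measure_pmf.expectation \<mu> (\<lambda>g. indicator A (H y g)))"
  proof -
    have "measure_pmf.expectation \<mu> (\<lambda>g. indicator A (H y g)) = measure_pmf.prob \<mu> {g. H y g \<in> A}" for y
    proof -
      have "(\<lambda>g. indicator A (H y g) :: real) = indicator {g. H y g \<in> A}"
        by (auto simp: indicator_def)
      then show ?thesis by simp
    qed
    then show ?thesis by (simp add: expectation_finite[OF fin order_refl])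
  qed
  also have "\<dots> = measure_pmf.expectation (chain H \<mu> z (Suc n)) (indicator A)"
    by (rule expectation_chain_Suc[OF finite_supp, symmetric])
  finally show ?case by simp
qed

lemma AE_eventually_not_in:
  assumes "z \<in> I" "summable (\<lambda>n. measure_pmf.prob (chain H \<mu> z n) A)"
  shows "AE w in M. \<forall>\<^sub>F n in sequentially. iterate H z (\<lambda>i. h i w) n \<notin> A"
proof -
  have "AE w in M. \<forall>\<^sub>F n in sequentially. w \<in> space M - {w \<in> space M. iterate H z (\<lambda>i. h (0 + i) w) n \<in> A}"
  proof (rule borel_cantelli_AE1)
    show "summable (\<lambda>n. prob {w \<in> space M. iterate H z (\<lambda>i. h (0 + i) w) n \<in> A})"
      unfolding iterate_prob[OF assms(1)] by (rule assms(2))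
  qed (use iterate_sets[OF assms(1), of 0] in \<open>auto simp: emeasure_eq_measure\<close>)
  then show ?thesis
    by eventually_elim (auto elim: eventually_mono)
qed

end

end

section \<open>Convergence of the walk\<close>

text \<open>For finitely many increments the exceptional sets have a finite union, which a transient
  path avoids from some time on.\<close>

lemma bounded_walk_tends_to_end:
  fixes x :: "nat \<Rightarrow> real"
  assumes S: "finite S" "S \<subseteq> carrier thompson_F"
    and x: "\<And>n. x n \<in> dyadic" "\<And>n. x (Suc n) = g n (x n)" "\<And>n. g n \<in> S"
    and transient: "\<And>y. y \<in> dyadic \<Longrightarrow> \<forall>\<^sub>F n in sequentially. x n \<noteq> y"
  shows "\<exists>e. tends_to_Gamma_end x e"
proof (rule tends_to_end_if_component[OF sym_schreier_edges countable_dyadic])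
  fix K :: "real set" assume K: "finite K"
  have "\<forall>s\<in>S. \<exists>K'. finite K' \<and> (\<forall>y\<in>dyadic - K'. y \<notin> K \<and> s y \<notin> K \<and>
      (y, s y) \<in> (schreier_edges \<inter> (dyadic - K) \<times> (dyadic - K))\<^sup>*)"
    using schreier_displacement[OF _ K] S(2) by blast
  then obtain K' where K': "\<And>s. s \<in> S \<Longrightarrow> finite (K' s)"
    "\<And>s y. s \<in> S \<Longrightarrow> y \<in> dyadic - K' s \<Longrightarrow> y \<notin> K \<and>
      (y, s y) \<in> (schreier_edges \<inter> (dyadic - K) \<times> (dyadic - K))\<^sup>*"
    by metis
  define L where "L = (\<Union>s\<in>S. K' s) \<inter> dyadic"
  have "finite L" using S(1) K'(1) by (simp add: L_def)
  then have "\<forall>\<^sub>F n in sequentially. \<forall>y\<in>L. x n \<noteq> y"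
    by (subst eventually_ball_finite_distrib) (use transient in \<open>auto simp: L_def\<close>)
  then obtain N where N: "\<And>n. n \<ge> N \<Longrightarrow> x n \<notin> L" by (auto simp: eventually_sequentially)
  have "x n \<in> dyadic - K \<and> (x n, x (Suc n)) \<in> (schreier_edges \<inter> (dyadic - K) \<times> (dyadic - K))\<^sup>*"
    if "n \<ge> N" for n
    using K'(2)[OF x(3)[of n], of "x n"] N[OF that] x by (auto simp: L_def)
  then show "\<exists>N. \<forall>n\<ge>N. x n \<in> dyadic - K \<and>
      (x n, x (Suc n)) \<in> (schreier_edges \<inter> (dyadic - K) \<times> (dyadic - K))\<^sup>*" by blast
qed

text \<open>Convergence confines the path to the tail of one ray, and transience removes it from
  every initial segment of this ray.\<close>

lemma ray_limit_imp_escape: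
  fixes x :: "nat \<Rightarrow> real"
  assumes \<epsilon>: "\<epsilon> \<in> {-1, 1}" and e: "tends_to_Gamma_end x e" "e \<in> ray_ends \<epsilon>"
    and transient: "\<And>y. y \<in> dyadic \<Longrightarrow> \<forall>\<^sub>F n in sequentially. x n \<noteq> y"
  shows "filterlim (\<lambda>n. \<epsilon> * x n) at_top sequentially"
  unfolding filterlim_at_top
proof
  fix Z :: real
  have sq: "\<epsilon> * \<epsilon> = 1" using \<epsilon> by auto
  obtain s where s: "s \<in> ray_base \<epsilon>" "e = end_of schreier_edges dyadic (ray \<epsilon> s)"
    using e(2) by (auto simp: ray_ends_def)
  have tail: "\<forall>\<^sub>F n in sequentially. x n \<in> ray_tail \<epsilon> s"
    using tends_to_ray_end[OF \<epsilon> e(1) s(1)] s(2) by simp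
  obtain J :: nat where J: "Z - \<epsilon> * s < real J" using reals_Archimedean2 by blast
  have "\<forall>\<^sub>F n in sequentially. \<forall>y\<in>ray \<epsilon> s ` {..J}. x n \<noteq> y"
    by (subst eventually_ball_finite_distrib)
       (use transient ray_dyadic[OF \<epsilon>] s(1) in \<open>auto simp: ray_base_def\<close>)
  with tail show "\<forall>\<^sub>F n in sequentially. Z \<le> \<epsilon> * x n"
  proof eventually_elim
    case (elim n)
    then obtain k where k: "x n = ray \<epsilon> s (Suc k)" by (auto simp: ray_tail_def)
    then have "J < Suc k" using elim(2) by (metis atMost_iff imageI not_le)
    moreover have "\<epsilon> * x n = \<epsilon> * s + (1 + real (Suc k))"
      by (simp add: k ray_def distrib_left sq mult.assoc[symmetric])
    ultimately show ?case using J by simp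
  qed
qed

text \<open>Steps are no longer than \<open>T\<close>, so a path that stays outside the window
  cannot change sides. On one side it moves by integer translations, so it stays on one ray.\<close>

lemma outside_window_imp_ray:
  fixes x :: "nat \<Rightarrow> real" and c :: "real \<Rightarrow> (real \<Rightarrow> real) \<Rightarrow> int"
  assumes x: "\<And>n. x n \<in> dyadic" "\<And>n. x (Suc n) = g n (x n)" "\<And>n. g n \<in> S"
    and germ: "\<And>\<epsilon> s y. \<epsilon> \<in> {-1, 1} \<Longrightarrow> s \<in> S \<Longrightarrow> T \<le> \<epsilon> * y \<Longrightarrow> s y = y + \<epsilon> * of_int (c \<epsilon> s)"
    and T: "\<And>\<epsilon> s. \<epsilon> \<in> {-1, 1} \<Longrightarrow> s \<in> S \<Longrightarrow> \<bar>of_int (c \<epsilon> s)\<bar> \<le> T" "3 \<le> T"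
    and out: "\<forall>\<^sub>F n in sequentially. T < \<bar>x n\<bar>"
    and e: "tends_to_Gamma_end x e"
  shows "e \<in> ray_ends (-1) \<union> ray_ends 1"
proof -
  obtain m where m: "\<And>n. n \<ge> m \<Longrightarrow> T < \<bar>x n\<bar>" using out by (auto simp: eventually_sequentially)
  define \<epsilon> where "\<epsilon> = sgn (x m)"
  have "x m \<noteq> 0" using m[of m] T(2) by auto
  then have \<epsilon>: "\<epsilon> \<in> {-1, 1}" by (auto simp: \<epsilon>_def sgn_if)
  have sq: "\<epsilon> * \<epsilon> = 1" using \<epsilon> by auto
  have \<epsilon>xm: "T < \<epsilon> * x m" using m[of m] \<open>x m \<noteq> 0\<close> by (auto simp: \<epsilon>_def sgn_if abs_if)
  then have "far \<epsilon> (x m)" using T(2) \<epsilon> by (auto simp: far_def)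
  then obtain s k where s: "s \<in> ray_base \<epsilon>" "x m = ray \<epsilon> s k" using far_on_ray[OF \<epsilon> _ x(1)] by blast
  have main: "T < \<epsilon> * x n \<and> (\<exists>j. x n = s + \<epsilon> * of_int j)" if "n \<ge> m" for n
    using that
  proof (induction rule: dec_induct)
    case base
    show ?case using \<epsilon>xm s(2) by (auto simp: ray_def intro: exI[of _ "1 + int k"])
  next
    case (step n)
    then obtain j where j: "x n = s + \<epsilon> * of_int j" by blast
    have *: "x (Suc n) = x n + \<epsilon> * of_int (c \<epsilon> (g n))"
      unfolding x(2) using step by (intro germ[OF \<epsilon> x(3)]) auto
    then have "\<epsilon> * x (Suc n) = \<epsilon> * x n + of_int (c \<epsilon> (g n))"
      by (simp add: distrib_left sq mult.assoc[symmetric])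
    then have "0 < \<epsilon> * x (Suc n)" using T(1)[OF \<epsilon> x(3)[of n]] step by linarith
    then have "\<bar>x (Suc n)\<bar> = \<epsilon> * x (Suc n)" using \<epsilon> by auto
    then have "T < \<epsilon> * x (Suc n)" using m[of "Suc n"] step by simp
    moreover have "x (Suc n) = s + \<epsilon> * of_int (j + c \<epsilon> (g n))"
      using * j by (simp add: distrib_left)
    ultimately show ?case by blast
  qed
  have "x n \<in> ray_tail \<epsilon> s" if n: "n \<ge> m" for n
  proof -
    obtain j where j: "T < \<epsilon> * x n" "x n = s + \<epsilon> * of_int j" using main[OF n] by blast
    have "\<epsilon> * s < 2" using s(1) \<epsilon> by (auto simp: ray_base_def far_def)
    moreover have "\<epsilon> * x n = \<epsilon> * s + of_int j"
      by (simp add: j(2) distrib_left sq mult.assoc[symmetric])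
    \<comment> \<open>With \<open>\<epsilon> * s < 2\<close> and \<open>3 \<le> T\<close> the index
      is at least 2, as needed because the tail starts one point after the beginning of the
      ray.\<close>
    ultimately have "(1 :: real) < of_int j" using j(1) T(2) by linarith
    then have "2 \<le> j" by linarith
    then have "x n = ray \<epsilon> s (Suc (nat (j - 2)))" by (simp add: j(2) ray_def)
    then show ?thesis by (auto simp: ray_tail_def)
  qed
  then have "\<forall>\<^sub>F n in sequentially. x n \<in> ray_tail \<epsilon> s" by (auto simp: eventually_sequentially)
  then have "e = end_of schreier_edges dyadic (ray \<epsilon> s)" using tends_to_ray_end[OF \<epsilon> e s(1)] by simp
  then have "e \<in> ray_ends \<epsilon>" using s(1) by (auto simp: ray_ends_def)
  then show ?thesis using \<epsilon> by auto
qed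

lemma stopped_eq_iterate:
  assumes "\<And>j. j < n \<Longrightarrow> N \<le> \<epsilon> * iterate (\<lambda>z g. g z) x f j \<and> \<epsilon> * iterate (\<lambda>z g. g z) x f j < L"
  shows "iterate (stopped \<epsilon> N L) x f n = iterate (\<lambda>z g. g z) x f n"
  using assms by (induction n) (simp_all add: stopped_def)

text \<open>\<open>c \<epsilon>\<close> is the outward translation length at the side of sign
  \<epsilon>. The values on the generators make it \<open>\<chi>a\<close> for the negative side and
  \<open>- (\<chi>a + \<chi>b)\<close> for the positive one.\<close>

locale thompson_walk = iid_sequence M h \<mu> "carrier thompson_F"
  for M :: "'w measure" and h :: "nat \<Rightarrow> 'w \<Rightarrow> real \<Rightarrow> real" and \<mu> :: "(real \<Rightarrow> real) pmf" +
  fixes c :: "real \<Rightarrow> (real \<Rightarrow> real) \<Rightarrow> int"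
  assumes nondegenerate: "strictly_nondegenerate thompson_F \<mu>"
    and c_hom: "\<And>\<epsilon> f g. \<epsilon> \<in> {-1, 1} \<Longrightarrow> f \<in> carrier thompson_F \<Longrightarrow> g \<in> carrier thompson_F \<Longrightarrow>
      c \<epsilon> (g \<circ> f) = c \<epsilon> f + c \<epsilon> g"
    and c_A: "\<And>\<epsilon>. \<epsilon> \<in> {-1, 1} \<Longrightarrow> of_int (c \<epsilon> gen_A) = - \<epsilon>"
    and c_B: "\<And>\<epsilon>. \<epsilon> \<in> {-1, 1} \<Longrightarrow> of_int (c \<epsilon> gen_B) = - (1 + \<epsilon>) / 2"
begin

abbreviation orbit :: "real \<Rightarrow> 'w \<Rightarrow> nat \<Rightarrow> real" where
  "orbit \<gamma> w \<equiv> iterate (\<lambda>z g. g z) \<gamma> (\<lambda>i. h i w)"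

abbreviation drift :: "real \<Rightarrow> real" where
  "drift \<epsilon> \<equiv> measure_pmf.expectation \<mu> (\<lambda>g. of_int (c \<epsilon> g))"

lemma apply_closed: "z \<in> dyadic \<Longrightarrow> g \<in> carrier thompson_F \<Longrightarrow> g z \<in> dyadic"
  by (rule thompson_F_dyadic)

lemma stopped_closed: "z \<in> dyadic \<Longrightarrow> g \<in> carrier thompson_F \<Longrightarrow> stopped \<epsilon> N L z g \<in> dyadic"
  by (simp add: stopped_def thompson_F_dyadic)

lemma orbit_dyadic: "\<gamma> \<in> dyadic \<Longrightarrow> w \<in> space M \<Longrightarrow> orbit \<gamma> w n \<in> dyadic"
  by (rule iterate_closed[where C = "carrier thompson_F"]) (auto intro: apply_closed h_in_C)

lemma AE_orbit_eventually_not_in: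
  assumes "\<gamma> \<in> dyadic" "summable (\<lambda>n. measure_pmf.prob (walk_law \<mu> \<gamma> n) A)"
  shows "AE w in M. \<forall>\<^sub>F n in sequentially. orbit \<gamma> w n \<notin> A"
  by (rule AE_eventually_not_in[where H = "\<lambda>z g. g z" and I = dyadic])
     (use assms in \<open>auto intro: apply_closed countable_dyadic\<close>)

text \<open>Finite support gives one threshold for both signs and all increments. The same number
  bounds the translation lengths, which later prevents jumps across the window.\<close>

lemma uniform_germ:
  obtains T where "3 \<le> T"
    "\<And>\<epsilon> g y. \<epsilon> \<in> {-1, 1} \<Longrightarrow> g \<in> set_pmf \<mu> \<Longrightarrow> T \<le> \<epsilon> * y \<Longrightarrow> g y = y + \<epsilon> * of_int (c \<epsilon> g)"
    "\<And>\<epsilon> g. \<epsilon> \<in> {-1, 1} \<Longrightarrow> g \<in> set_pmf \<mu> \<Longrightarrow> \<bar>of_int (c \<epsilon> g)\<bar> \<le> T"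
proof -
  let ?P = "\<lambda>(\<epsilon>, g) N. \<forall>y. N \<le> \<epsilon> * y \<longrightarrow> g y = y + \<epsilon> * real_of_int (c \<epsilon> g)"
  let ?X = "{-1, 1 :: real} \<times> set_pmf \<mu>"
  have "\<forall>p\<in>?X. \<exists>N. ?P p N"
    using supp_C germ_translation[where c = "\<lambda>g. real_of_int (c _ g)"] c_hom c_A c_B
    by (fastforce simp: subset_eq)
  then obtain N where N: "\<forall>p\<in>?X. ?P p (N p)" by (rule bchoice[THEN exE])
  define T where "T = Max (insert 3 (N ` ?X \<union> (\<lambda>(\<epsilon>, g). \<bar>real_of_int (c \<epsilon> g)\<bar>) ` ?X))"
  have fin: "finite (insert 3 (N ` ?X \<union> (\<lambda>(\<epsilon>, g). \<bar>real_of_int (c \<epsilon> g)\<bar>) ` ?X))"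
    using finite_supp by simp
  show ?thesis
  proof (rule that[of T])
    show "3 \<le> T" unfolding T_def by (rule Max_ge[OF fin]) simp
    fix \<epsilon> :: real and g assume p: "\<epsilon> \<in> {-1, 1}" "g \<in> set_pmf \<mu>"
    then have "(\<epsilon>, g) \<in> ?X" by simp
    then have "N (\<epsilon>, g) \<in> N ` ?X" "\<bar>real_of_int (c \<epsilon> g)\<bar> \<in> (\<lambda>(\<epsilon>, g). \<bar>real_of_int (c \<epsilon> g)\<bar>) ` ?X"
      by (blast, force)
    then have "N (\<epsilon>, g) \<le> T" "\<bar>real_of_int (c \<epsilon> g)\<bar> \<le> T"
      unfolding T_def by (intro Max_ge[OF fin]; blast)+
    show "\<bar>real_of_int (c \<epsilon> g)\<bar> \<le> T" by fact
    show "g y = y + \<epsilon> * real_of_int (c \<epsilon> g)" if "T \<le> \<epsilon> * y" for y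
      using bspec[OF N \<open>(\<epsilon>, g) \<in> ?X\<close>] \<open>N (\<epsilon>, g) \<le> T\<close> that by force
  qed
qed

lemma AE_transient: "AE w in M. \<forall>\<gamma>\<in>dyadic. \<forall>y\<in>dyadic. \<forall>\<^sub>F n in sequentially. orbit \<gamma> w n \<noteq> y"
proof (intro AE_ball_countable' countable_dyadic)
  fix \<gamma> y :: real assume \<gamma>: "\<gamma> \<in> dyadic" and y: "y \<in> dyadic"
  have "summable (\<lambda>n. measure_pmf.prob (walk_law \<mu> \<gamma> n) {y})"
    using walk_transient[OF supp_C finite_supp nondegenerate \<gamma> y] by (simp add: measure_pmf_single)
  from AE_orbit_eventually_not_in[OF \<gamma> this]
  show "AE w in M. \<forall>\<^sub>F n in sequentially. orbit \<gamma> w n \<noteq> y" by simp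
qed

lemma AE_tends_to_end: "AE w in M. \<forall>\<gamma>\<in>dyadic. \<exists>e. tends_to_Gamma_end (orbit \<gamma> w) e"
  using AE_transient AE_h_supp AE_space
proof eventually_elim
  case (elim w)
  show ?case
  proof
    fix \<gamma> assume \<gamma>: "\<gamma> \<in> dyadic"
    show "\<exists>e. tends_to_Gamma_end (orbit \<gamma> w) e"
      by (rule bounded_walk_tends_to_end[OF finite_supp supp_C orbit_dyadic[OF \<gamma> elim(3)],
            where g = "\<lambda>n. h n w"]) (use elim \<gamma> in auto)
  qed
qed

lemma AE_leaves_window:
  assumes "\<epsilon> \<in> {-1, 1}" "0 < drift \<epsilon>" 
    and germ: "\<And>g y. g \<in> set_pmf \<mu> \<Longrightarrow> T \<le> \<epsilon> * y \<Longrightarrow> g y = y + \<epsilon> * of_int (c \<epsilon> g)"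
  shows "AE w in M. \<forall>\<gamma>\<in>dyadic. \<forall>\<^sub>F n in sequentially. T < \<bar>orbit \<gamma> w n\<bar>"
proof (intro AE_ball_countable' countable_dyadic)
  fix \<gamma> :: real assume \<gamma>: "\<gamma> \<in> dyadic"
  have W: "{z. - T \<le> \<epsilon> * z \<and> \<epsilon> * z \<le> T} = {z. \<bar>z\<bar> \<le> T}" using assms(1) by auto
  have "summable (\<lambda>n. measure_pmf.prob (walk_law \<mu> \<gamma> n) {z. \<bar>z\<bar> \<le> T})"
    unfolding W[symmetric]
    by (rule window_visits_summable[OF supp_C finite_supp nondegenerate assms(1) germ assms(2)])
  from AE_orbit_eventually_not_in[OF \<gamma> this]
  show "AE w in M. \<forall>\<^sub>F n in sequentially. T < \<bar>orbit \<gamma> w n\<bar>" by (simp add: not_le)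
qed

text \<open>Positive drift on one side alone makes the path leave the bounded window for good; it
  may still end up on the other side, hence the union.\<close>

lemma AE_limit_in_ray_ends:
  assumes "\<epsilon> \<in> {-1, 1}" "0 < drift \<epsilon>"
  shows "AE w in M. \<forall>\<gamma>\<in>dyadic. \<forall>e. tends_to_Gamma_end (orbit \<gamma> w) e \<longrightarrow> e \<in> ray_ends (-1) \<union> ray_ends 1"
proof -
  obtain T where T: "3 \<le> T"
    "\<And>\<epsilon> g y. \<epsilon> \<in> {-1, 1} \<Longrightarrow> g \<in> set_pmf \<mu> \<Longrightarrow> T \<le> \<epsilon> * y \<Longrightarrow> g y = y + \<epsilon> * of_int (c \<epsilon> g)"
    "\<And>\<epsilon> g. \<epsilon> \<in> {-1, 1} \<Longrightarrow> g \<in> set_pmf \<mu> \<Longrightarrow> \<bar>of_int (c \<epsilon> g)\<bar> \<le> T"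
    using uniform_germ by blast
  have "AE w in M. \<forall>\<gamma>\<in>dyadic. \<forall>\<^sub>F n in sequentially. T < \<bar>orbit \<gamma> w n\<bar>"
    by (rule AE_leaves_window[OF assms]) (rule T(2)[OF assms(1)])
  then show ?thesis
    using AE_h_supp AE_space
  proof eventually_elim
    case (elim w)
    show ?case
    proof (intro ballI allI impI)
      fix \<gamma> e assume \<gamma>: "\<gamma> \<in> dyadic" and e: "tends_to_Gamma_end (orbit \<gamma> w) e"
      show "e \<in> ray_ends (-1) \<union> ray_ends 1"
      proof (rule outside_window_imp_ray[where x = "orbit \<gamma> w" and g = "\<lambda>n. h n w"
            and S = "set_pmf \<mu>" and T = T and c = c])
        show "orbit \<gamma> w n \<in> dyadic" for n by (rule orbit_dyadic[OF \<gamma> elim(3)])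
        show "orbit \<gamma> w (Suc n) = h n w (orbit \<gamma> w n)" for n by simp
        show "h n w \<in> set_pmf \<mu>" for n using elim(2) by blast
      qed (erule (2) T(2), erule (1) T(3), rule T(1), use elim(1) \<gamma> in blast, rule e)
    qed
  qed
qed

text \<open>An escaping path passes every level \<open>L\<close> without falling below
  \<open>N\<close>, so the stopped walk exits through \<open>L\<close>. This has probability at most
  \<open>b / (L - N + D)\<close>, which tends to 0 as \<open>L\<close> grows.\<close>

lemma AE_not_escaping:
  fixes N D :: real
  assumes \<epsilon>: "\<epsilon> \<in> {-1, 1}" and drift: "drift \<epsilon> \<le> 0"
    and germ: "\<And>g y. g \<in> set_pmf \<mu> \<Longrightarrow> N \<le> \<epsilon> * y \<Longrightarrow> g y = y + \<epsilon> * of_int (c \<epsilon> g)"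
    and D: "\<And>g. g \<in> set_pmf \<mu> \<Longrightarrow> \<bar>of_int (c \<epsilon> g)\<bar> \<le> D" "0 \<le> D"
    and x: "x \<in> dyadic" "N \<le> \<epsilon> * x"
  shows "AE w in M. \<not> ((\<forall>n. N \<le> \<epsilon> * iterate (\<lambda>z g. g z) x (\<lambda>i. h (m + i) w) n) \<and>
    filterlim (\<lambda>n. \<epsilon> * iterate (\<lambda>z g. g z) x (\<lambda>i. h (m + i) w) n) at_top sequentially)"
proof -
  let ?Y = "\<lambda>w. iterate (\<lambda>z g. g z) x (\<lambda>i. h (m + i) w)"
  let ?Z = "\<lambda>L w. iterate (stopped \<epsilon> N L) x (\<lambda>i. h (m + i) w)"
  define b where "b = \<epsilon> * x - N + D"
  define A where "A L n = {w \<in> space M. ?Z L w n \<in> {z. L \<le> \<epsilon> * z}}" for L n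
  have A_sets: "A L n \<in> sets M" for L n
    unfolding A_def by (rule iterate_sets[where H = "stopped \<epsilon> N L", OF countable_dyadic _ x(1)]) (rule stopped_closed)
  have A_inc: "incseq (A L)" for L
    by (rule incseq_SucI) (auto simp: A_def stopped_def)
  have A_prob: "prob (\<Union>n. A L n) * (L - N + D) \<le> b" if "L > N" for L
  proof (rule LIMSEQ_le_const2)
    show "(\<lambda>n. prob (A L n) * (L - N + D)) \<longlonglongrightarrow> prob (\<Union>n. A L n) * (L - N + D)"
      using A_sets A_inc by (intro tendsto_mult_right finite_Lim_measure_incseq) auto
    have "prob (A L n) * (L - N + D) \<le> b" for n
    proof -
      have "prob (A L n) = measure_pmf.prob (chain (stopped \<epsilon> N L) \<mu> x n) {z. L \<le> \<epsilon> * z}"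
        unfolding A_def by (rule iterate_prob[where H = "stopped \<epsilon> N L", OF countable_dyadic _ x(1)]) (rule stopped_closed)
      moreover have "measure_pmf.prob (chain (stopped \<epsilon> N L) \<mu> x n) {z. L \<le> \<epsilon> * z} * (L - N + D)
          \<le> \<epsilon> * x - N + D"
        by (rule stopped_exit[where c = "\<lambda>g. of_int (c \<epsilon> g)", OF finite_supp \<epsilon>])
           (use germ drift D x(2) in auto)
      ultimately show ?thesis by (simp add: b_def)
    qed
    then show "\<exists>K. \<forall>n\<ge>K. prob (A L n) * (L - N + D) \<le> b" by blast
  qed
  \<comment> \<open>Levels start at \<open>N + 1\<close> to lie above \<open>N\<close>; then
    \<open>L - N + D\<close> is at least \<open>real j\<close>.\<close>
  define Q where "Q = (\<Inter>j. \<Union>n. A (N + 1 + real j) n)"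
  have Q_sets: "Q \<in> sets M" unfolding Q_def using A_sets by auto
  have "prob Q = 0"
  proof (rule ccontr)
    assume "prob Q \<noteq> 0"
    then have pos: "0 < prob Q" by (simp add: zero_less_measure_iff)
    obtain j where j: "b / prob Q < real j" using reals_Archimedean2 by blast
    have "prob Q \<le> prob (\<Union>n. A (N + 1 + real j) n)"
      unfolding Q_def using A_sets by (intro finite_measure_mono) auto
    then have "prob Q * real j \<le> prob (\<Union>n. A (N + 1 + real j) n) * (N + 1 + real j - N + D)"
      using D(2) by (intro mult_mono) auto
    also have "\<dots> \<le> b" by (rule A_prob) simp
    finally show False using j pos by (simp add: pos_divide_less_eq mult.commute)
  qed
  then have "Q \<in> null_sets M" using Q_sets by (simp add: null_sets_def emeasure_eq_measure)
  moreover have "{w \<in> space M. \<not> \<not> ((\<forall>n. N \<le> \<epsilon> * ?Y w n) \<and>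
      filterlim (\<lambda>n. \<epsilon> * ?Y w n) at_top sequentially)} \<subseteq> Q"
  proof
    fix w assume "w \<in> {w \<in> space M. \<not> \<not> ((\<forall>n. N \<le> \<epsilon> * ?Y w n) \<and>
      filterlim (\<lambda>n. \<epsilon> * ?Y w n) at_top sequentially)}"
    then have w: "w \<in> space M" "\<And>n. N \<le> \<epsilon> * ?Y w n" "filterlim (\<lambda>n. \<epsilon> * ?Y w n) at_top sequentially"
      by auto
    have "\<exists>n. w \<in> A L n" for L
    proof -
      have "\<forall>\<^sub>F n in sequentially. L \<le> \<epsilon> * ?Y w n" using w(3) by (simp add: filterlim_at_top)
      then have ex: "\<exists>n. L \<le> \<epsilon> * ?Y w n" by (auto simp: eventually_sequentially)
      \<comment> \<open>Up to the first passage of \<open>L\<close> the path stays in the window, so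
        the stopped walk coincides with the walk.\<close>
      define n where "n = (LEAST n. L \<le> \<epsilon> * ?Y w n)"
      have n: "L \<le> \<epsilon> * ?Y w n" unfolding n_def using ex by (rule LeastI_ex)
      have "\<epsilon> * ?Y w j < L" if "j < n" for j
        using not_less_Least[of j "\<lambda>n. L \<le> \<epsilon> * ?Y w n"] that by (simp add: n_def)
      then have "?Z L w n = ?Y w n" using w(2) by (intro stopped_eq_iterate) auto
      then have "w \<in> A L n" using n w(1) by (simp add: A_def)
      then show ?thesis by blast
    qed
    then show "w \<in> Q" by (auto simp: Q_def)
  qed
  ultimately show ?thesis by (rule AE_I')
qed

text \<open>A path tending to an end of this type stays beyond \<open>T\<close> from some random
  time on. No stopping time is needed: the restarted walk is excluded simultaneously for the
  countably many fixed times \<open>m\<close> and positions \<open>x\<close>.\<close>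

lemma AE_limit_not_in_ray_ends:
  assumes \<epsilon>: "\<epsilon> \<in> {-1, 1}" and drift: "drift \<epsilon> \<le> 0"
  shows "AE w in M. \<forall>\<gamma>\<in>dyadic. \<forall>e. tends_to_Gamma_end (orbit \<gamma> w) e \<longrightarrow> e \<notin> ray_ends \<epsilon>"
proof -
  obtain T where T: "3 \<le> T"
    "\<And>\<epsilon> g y. \<epsilon> \<in> {-1, 1} \<Longrightarrow> g \<in> set_pmf \<mu> \<Longrightarrow> T \<le> \<epsilon> * y \<Longrightarrow> g y = y + \<epsilon> * of_int (c \<epsilon> g)"
    "\<And>\<epsilon> g. \<epsilon> \<in> {-1, 1} \<Longrightarrow> g \<in> set_pmf \<mu> \<Longrightarrow> \<bar>of_int (c \<epsilon> g)\<bar> \<le> T"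
    using uniform_germ by blast
  have "AE w in M. \<forall>m. \<forall>x\<in>dyadic. T \<le> \<epsilon> * x \<longrightarrow>
      \<not> ((\<forall>n. T \<le> \<epsilon> * iterate (\<lambda>z g. g z) x (\<lambda>i. h (m + i) w) n) \<and>
        filterlim (\<lambda>n. \<epsilon> * iterate (\<lambda>z g. g z) x (\<lambda>i. h (m + i) w) n) at_top sequentially)"
  proof (subst AE_all_countable, intro allI AE_ball_countable' countable_dyadic)
    fix m and x :: real assume x: "x \<in> dyadic"
    show "AE w in M. T \<le> \<epsilon> * x \<longrightarrow>
      \<not> ((\<forall>n. T \<le> \<epsilon> * iterate (\<lambda>z g. g z) x (\<lambda>i. h (m + i) w) n) \<and>
        filterlim (\<lambda>n. \<epsilon> * iterate (\<lambda>z g. g z) x (\<lambda>i. h (m + i) w) n) at_top sequentially)"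
    proof (cases "T \<le> \<epsilon> * x")
      case True
      have "AE w in M. \<not> ((\<forall>n. T \<le> \<epsilon> * iterate (\<lambda>z g. g z) x (\<lambda>i. h (m + i) w) n) \<and>
          filterlim (\<lambda>n. \<epsilon> * iterate (\<lambda>z g. g z) x (\<lambda>i. h (m + i) w) n) at_top sequentially)"
        by (rule AE_not_escaping[OF \<epsilon> drift, where D = T]) (use T \<epsilon> x True in auto)
      then show ?thesis by eventually_elim simp
    qed simp
  qed
  then show ?thesis
    using AE_transient AE_space
  proof eventually_elim
    case (elim w)
    show ?case
    proof (intro ballI allI impI notI)
      fix \<gamma> e assume \<gamma>: "\<gamma> \<in> dyadic" and e: "tends_to_Gamma_end (orbit \<gamma> w) e" "e \<in> ray_ends \<epsilon>"
      have lim: "filterlim (\<lambda>n. \<epsilon> * orbit \<gamma> w n) at_top sequentially"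
        by (rule ray_limit_imp_escape[OF \<epsilon> e]) (use elim(2) \<gamma> in blast)
      then have "\<forall>\<^sub>F n in sequentially. T \<le> \<epsilon> * orbit \<gamma> w n" by (simp add: filterlim_at_top)
      then obtain m where m: "\<And>n. n \<ge> m \<Longrightarrow> T \<le> \<epsilon> * orbit \<gamma> w n" by (auto simp: eventually_sequentially)
      have shift: "iterate (\<lambda>z g. g z) (orbit \<gamma> w m) (\<lambda>i. h (m + i) w) n = orbit \<gamma> w (m + n)" for n
        by (rule iterate_add[symmetric])
      have "filterlim (\<lambda>n. \<epsilon> * orbit \<gamma> w (m + n)) at_top sequentially"
        using filterlim_compose[OF lim filterlim_add_const_nat_at_top[of m]] by (simp add: add.commute)
      then show False
        using elim(1)[rule_format, OF orbit_dyadic[OF \<gamma> elim(3), of m], of m] m by (simp add: shift)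
    qed
  qed
qed

section \<open>The law of the limit configuration\<close>

lemma walk_eq_orbit: "walk thompson_F h n w \<gamma> = orbit \<gamma> w n"
  by (rule walk_eq_iterate)

lemma limit_configuration_measurable:
  "limit_configuration h \<in> M \<rightarrow>\<^sub>M (\<Pi>\<^sub>M \<gamma>\<in>dyadic. Gamma_end_borel)"
  unfolding limit_configuration_def walk_eq_orbit
proof (rule measurable_restrict, rule measurable_limit_end[OF sym_schreier_edges countable_dyadic])
  show "Gamma_ends \<noteq> {}"
    using end_of_in_ends[OF ray_in_rays[of 1 0]] dyadic_of_int[of 0] by auto
  fix \<gamma> n assume "\<gamma> \<in> dyadic"
  show "(\<lambda>w. orbit \<gamma> w n) \<in> M \<rightarrow>\<^sub>M count_space UNIV"
  proof -
    have "(\<lambda>w. iterate (\<lambda>z g. g z) \<gamma> (\<lambda>i. h (0 + i) w) n) \<in> M \<rightarrow>\<^sub>M count_space dyadic"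
      by (rule iterate_measurable[OF countable_dyadic]) (auto intro: apply_closed \<open>\<gamma> \<in> dyadic\<close>)
    from measurable_compose[OF this, of "\<lambda>x. x" "count_space UNIV"] show ?thesis by simp
  qed
qed

text \<open>Countability of the vertex set makes the set of configurations with values in
  \<open>S\<close> measurable in the product.\<close>

lemma boundary_law_eq_1:
  assumes S: "S \<in> sets Gamma_end_borel"
    and lim: "AE w in M. \<forall>\<gamma>\<in>dyadic. \<forall>e. tends_to_Gamma_end (orbit \<gamma> w) e \<longrightarrow> e \<in> S"
  shows "measure (boundary_law M h) (dyadic \<rightarrow>\<^sub>E S) = 1"
proof -
  have sets: "(dyadic \<rightarrow>\<^sub>E S) \<in> sets (\<Pi>\<^sub>M \<gamma>\<in>dyadic. Gamma_end_borel)"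
    by (rule sets_PiM_I_countable[OF countable_dyadic]) (rule S)
  have "AE w in M. limit_configuration h w \<in> (dyadic \<rightarrow>\<^sub>E S)"
    using lim AE_tends_to_end
  proof eventually_elim
    case (elim w)
    have "limit_end schreier_edges dyadic (orbit \<gamma> w) \<in> S" if "\<gamma> \<in> dyadic" for \<gamma>
      using elim that limit_end_eq[OF sym_schreier_edges] by metis
    then show ?case by (simp add: limit_configuration_def walk_eq_orbit)
  qed
  then have "prob (limit_configuration h -` (dyadic \<rightarrow>\<^sub>E S) \<inter> space M) = 1"
    using measurable_sets[OF limit_configuration_measurable sets] by (subst prob_eq_1) auto
  then show ?thesis
    unfolding boundary_law_def by (simp add: measure_distr[OF limit_configuration_measurable sets])
qed

end

theorem theorem41:
  fixes \<mu> :: "(real \<Rightarrow> real) pmf"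
    and \<chi>a \<chi>b :: "(real \<Rightarrow> real) \<Rightarrow> int"
    and \<alpha> \<beta> :: real
    and M :: "'w measure"
    and h :: "nat \<Rightarrow> 'w \<Rightarrow> real \<Rightarrow> real"
  assumes "set_pmf \<mu> \<subseteq> carrier thompson_F"
    and "finite (set_pmf \<mu>)"
    and "strictly_nondegenerate thompson_F \<mu>"
    and "\<chi>a \<in> hom thompson_F integer_group" "\<chi>a gen_A = 1" "\<chi>a gen_B = 0"
    and "\<chi>b \<in> hom thompson_F integer_group" "\<chi>b gen_A = 0" "\<chi>b gen_B = 1"
    and "\<alpha> = (\<Sum>g\<in>set_pmf \<mu>. pmf \<mu> g * real_of_int (\<chi>a g))"
    and "\<beta> = (\<Sum>g\<in>set_pmf \<mu>. pmf \<mu> g * real_of_int (\<chi>b g))"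
    and "iid_increments thompson_F \<mu> M h"
  shows "(AE w in M. \<forall>\<gamma>\<in>dyadic. \<exists>!\<omega>. \<omega> \<in> Gamma_ends \<and>
            tends_to_Gamma_end (\<lambda>n. walk thompson_F h n w \<gamma>) \<omega>) \<and>
         limit_configuration h \<in> M \<rightarrow>\<^sub>M (\<Pi>\<^sub>M \<gamma>\<in>dyadic. Gamma_end_borel) \<and>
         measure (boundary_law M h)
           (dyadic \<rightarrow>\<^sub>E
             (if \<alpha> > 0 \<and> \<alpha> + \<beta> < 0 then negative_ends \<union> positive_ends
              else if \<alpha> > 0 \<and> \<alpha> + \<beta> \<ge> 0 then negative_ends
              else if \<alpha> \<le> 0 \<and> \<alpha> + \<beta> < 0 then positive_ends
              else skeleton_ends)) = 1"
proof -
  \<comment> \<open>The generator \<open>gen_A\<close> shifts towards minus infinity, hence the plus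
    sign on the negative side and the minus sign on the positive side; \<open>gen_B\<close> is a
    translation only on the latter.\<close>
  define c where "c \<epsilon> g = (if \<epsilon> = (-1::real) then \<chi>a g else - (\<chi>a g + \<chi>b g))" for \<epsilon> g
  have hom: "\<phi> (g \<circ> f) = \<phi> f + \<phi> g"
    if "\<phi> \<in> hom thompson_F integer_group" "f \<in> carrier thompson_F" "g \<in> carrier thompson_F"
    for \<phi> :: "(real \<Rightarrow> real) \<Rightarrow> int" and f g
    using hom_mult[OF that] by (simp add: mult_thompson_F)
  interpret prob_space M using assms(12) by (simp add: iid_increments_def)
  interpret thompson_walk M h \<mu> c
  proof
    show "indep_vars (\<lambda>_. count_space (carrier thompson_F)) h UNIV"
      "\<And>i. distr M (count_space UNIV) (h i) = measure_pmf \<mu>"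
      using assms(12) by (simp_all add: iid_increments_def)
    show "c \<epsilon> (g \<circ> f) = c \<epsilon> f + c \<epsilon> g"
      if "\<epsilon> \<in> {-1, 1}" "f \<in> carrier thompson_F" "g \<in> carrier thompson_F" for \<epsilon> f g
      unfolding c_def using hom[OF assms(4) that(2,3)] hom[OF assms(7) that(2,3)] by simp
  qed (use assms in \<open>auto simp: c_def\<close>)
  have drift: "drift (-1) = \<alpha>" "drift 1 = - (\<alpha> + \<beta>)"
    by (simp_all add: c_def expectation_finite[OF assms(2) order_refl] assms(10,11)
        sum.distrib[symmetric] sum_negf[symmetric] algebra_simps)
  define S where "S = (if \<alpha> > 0 \<and> \<alpha> + \<beta> < 0 then negative_ends \<union> positive_ends
              else if \<alpha> > 0 \<and> \<alpha> + \<beta> \<ge> 0 then negative_ends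
              else if \<alpha> \<le> 0 \<and> \<alpha> + \<beta> < 0 then positive_ends
              else skeleton_ends)"
  have S: "S \<in> sets Gamma_end_borel"
    using sets_ray_ends[of 1] sets_ray_ends[of "-1"] sets_skeleton_ends
    by (simp add: S_def negative_ends_eq positive_ends_eq sets.Un)
  have out: "AE w in M. \<forall>\<gamma>\<in>dyadic. \<forall>e. tends_to_Gamma_end (orbit \<gamma> w) e \<longrightarrow>
      e \<in> ray_ends (-1) \<union> ray_ends 1" if "\<alpha> > 0 \<or> \<alpha> + \<beta> < 0"
    using that AE_limit_in_ray_ends[of "-1"] AE_limit_in_ray_ends[of 1] drift by auto
  \<comment> \<open>The three facts are collected for all cases at once; in each case they determine
    the allowed set of ends.\<close>
  have no: "AE w in M. \<forall>\<gamma>\<in>dyadic. \<forall>e. tends_to_Gamma_end (orbit \<gamma> w) e \<longrightarrow>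
      (\<alpha> \<le> 0 \<longrightarrow> e \<notin> ray_ends (-1)) \<and> (\<alpha> + \<beta> \<ge> 0 \<longrightarrow> e \<notin> ray_ends 1) \<and>
      (\<alpha> > 0 \<or> \<alpha> + \<beta> < 0 \<longrightarrow> e \<in> ray_ends (-1) \<union> ray_ends 1)"
  proof -
    have "AE w in M. \<forall>\<gamma>\<in>dyadic. \<forall>e. tends_to_Gamma_end (orbit \<gamma> w) e \<longrightarrow> \<alpha> \<le> 0 \<longrightarrow> e \<notin> ray_ends (-1)"
      using AE_limit_not_in_ray_ends[of "-1"] drift by (cases "\<alpha> \<le> 0") auto
    moreover have "AE w in M. \<forall>\<gamma>\<in>dyadic. \<forall>e. tends_to_Gamma_end (orbit \<gamma> w) e \<longrightarrow>
        \<alpha> + \<beta> \<ge> 0 \<longrightarrow> e \<notin> ray_ends 1"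
      using AE_limit_not_in_ray_ends[of 1] drift by (cases "\<alpha> + \<beta> \<ge> 0") auto
    moreover have "AE w in M. \<forall>\<gamma>\<in>dyadic. \<forall>e. tends_to_Gamma_end (orbit \<gamma> w) e \<longrightarrow>
        \<alpha> > 0 \<or> \<alpha> + \<beta> < 0 \<longrightarrow> e \<in> ray_ends (-1) \<union> ray_ends 1"
      using out by (cases "\<alpha> > 0 \<or> \<alpha> + \<beta> < 0") auto
    ultimately show ?thesis by eventually_elim blast
  qed
  have "measure (boundary_law M h) (dyadic \<rightarrow>\<^sub>E S) = 1"
  proof (rule boundary_law_eq_1[OF S])
    show "AE w in M. \<forall>\<gamma>\<in>dyadic. \<forall>e. tends_to_Gamma_end (orbit \<gamma> w) e \<longrightarrow> e \<in> S"
      using no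
    proof eventually_elim
      case (elim w)
      show ?case
      proof (intro ballI allI impI)
        fix \<gamma> e assume "\<gamma> \<in> dyadic" "tends_to_Gamma_end (orbit \<gamma> w) e"
        with elim tends_to_end_in_ends[OF sym_schreier_edges this(2)]
        show "e \<in> S"
          unfolding S_def negative_ends_eq positive_ends_eq skeleton_ends_eq by auto
      qed
    qed
  qed
  moreover have "AE w in M. \<forall>\<gamma>\<in>dyadic. \<exists>!\<omega>. \<omega> \<in> Gamma_ends \<and>
      tends_to_Gamma_end (\<lambda>n. walk thompson_F h n w \<gamma>) \<omega>"
    unfolding walk_eq_orbit using AE_tends_to_end
    by eventually_elim
       (use tends_to_end_in_ends[OF sym_schreier_edges] tends_to_end_unique[OF sym_schreier_edges] in blast)
  ultimately show ?thesis using limit_configuration_measurable by (simp add: S_def)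
qed

end
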